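(* Let $(x_0,y_j)\in\Gamma_1$ be a grid point on the side $\Gamma_1=\{l_1\}\times(l_3,l_4)$, with boundary condition $\mathcal{B}_1u=\frac{\partial u}{\partial\vec n}+\alpha u=g_1$ on $\Gamma_1$, where $\alpha=\alpha(y)$ is smooth; take $(x_0,y_j)$ as base point. Let $$C^{\mathcal{B}_1}_{k,\ell}(h)=\sum_{i=0}^{6}c^{\mathcal{B}_1}_{k,\ell,i}h^i,\qquad k\in\{0,1\},\ \ell\in\{-1,0,1\},$$ be any non-trivial solution of the linear system induced by $$\sum_{k=0}^1\sum_{\ell=-1}^1C^{\mathcal{B}_1}_{k,\ell}(h)\Big(G^V_{5,0,n}(kh,\ell h)+\sum_{i=n}^5\binom{i}{n}\alpha^{(i-n)}G^V_{5,1,i}(kh,\ell h)(1-\delta_{n,6})\Big)=\mathcal{O}(h^7),\quad n=0,1,\dots,6,$$ where $\delta_{a,b}=1$ if $a=b$ and $0$ otherwise. Put $$C^{\mathcal{B}_1}_{f,m,n}:=\sum_{k=0}^1\sum_{\ell=-1}^1C^{\mathcal{B}_1}_{k,\ell}Q^V_{5,m,n}(kh,\ell h),\ (m,n)\in\Lambda_4,\qquad C^{\mathcal{B}_1}_{g_1,n}:=-\sum_{k=0}^1\sum_{\ell=-1}^1C^{\mathcal{B}_1}_{k,\ell}G^V_{5,1,n}(kh,\ell h),\ n=0,\dots,5.$$ Then the 6-point scheme $$\sum_{k=0}^1\sum_{\ell=-1}^1C^{\mathcal{B}_1}_{k,\ell}(u_h)_{k,j+\ell}=\sum_{(m,n)\in\Lambda_4}f^{(m,n)}C^{\mathcal{B}_1}_{f,m,n}+\sum_{n=0}^5g_1^{(n)}C^{\mathcal{B}_1}_{g_1,n}$$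 achieves sixth order of accuracy for $\mathcal{B}_1u=\frac{\partial u}{\partial\vec n}+\alpha u=g_1$ at $(x_0,y_j)$. Moreover, the maximum accuracy order of a 6-point finite difference scheme for $\mathcal{B}_1u=\frac{\partial u}{\partial\vec n}+\alpha u=g_1$ at $(x_0,y_j)\in\Gamma_1$ with two smooth functions $\alpha(y)$ and $a(x,y)$ is six.
   Context: **Grid and problem.** $\Omega=(l_1,l_2)\times(l_3,l_4)$ with uniform grid $x_i=l_1+ih$ ($0\le i\le N_1$), $y_j=l_3+jh$ ($0\le j\le N_2$). The function $u$ solves $-\nabla\cdot(a\nabla u)=f$ (away from an interface in the interior across which $a$ may jump). Near the boundary point considered, $a$ is positive and smooth and $u,f$ are smooth up to the boundary. $\vec n$ is the outward normal, so on $\Gamma_1$ the condition reads $-u_x+\alpha u=g_1$. $(u_h)_{i,j}$ is the numerical approximation of $u(x_i,y_j)$. The analysis is local at the fixed base point as $h\to0^+$. **Notation.** $a^{(m,n)},u^{(m,n)},f^{(m,n)}$ denote $\partial_x^m\partial_y^n$ of $a,u,f$ at the base point $(x_0,y_j)$; $\alpha^{(n)},g_1^{(n)}$ denote $n$-th derivatives in $y$ at $y_j$. For an integer $N\ge0$: $\Lambda_N=\{(m,n)\in\mathbb{N}_0^2: m+n\le N\}$, $\Lambda_N^{V,1}=\{(m,n)\in\Lambda_N: m\in\{0,1\}\}$, $\Lambda_N^{V,2}=\Lambda_N\setminus\Lambda_N^{V,1}$. **The functions $G^V_{M,m,n}$ and $Q^V_{M,m,n}$.** For smooth $u$ and $f=-\nabla\cdot(a\nabla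 u)$, solving the equation for $u_{xx}$ and differentiating repeatedly, each $u^{(m',n')}$ with $(m',n')\in\Lambda_{M+1}^{V,2}$ is written uniquely (identically in $u$) as $$u^{(m',n')}=\sum_{(m,n)\in\Lambda_{M+1}^{V,1},\,m+n\le m'+n'}A^{V,u}_{m',n',m,n}u^{(m,n)}+\sum_{(m,n)\in\Lambda_{M-1},\,m+n\le m'+n'-2}A^{V,f}_{m',n',m,n}f^{(m,n)},$$ with constants determined by $\{a^{(m,n)}:(m,n)\in\Lambda_M\}$. Then for $(m,n)\in\Lambda_{M+1}^{V,1}$, $$G^V_{M,m,n}(x,y)=\sum_{\ell=0}^{\lfloor n/2\rfloor}\frac{(-1)^\ell x^{m+2\ell}y^{n-2\ell}}{(m+2\ell)!(n-2\ell)!}+\sum_{(m',n')\in\Lambda_{M+1}^{V,2},\,m'+n'>m+n}A^{V,u}_{m',n',m,n}\frac{x^{m'}y^{n'}}{m'!n'!},$$ and for $(m,n)\in\Lambda_{M-1}$, $$Q^V_{M,m,n}(x,y)=\frac1{a^{(0,0)}}\sum_{\ell=1}^{1+\lfloor n/2\rfloor}\frac{(-1)^\ell x^{m+2\ell}y^{n-2\ell+2}}{(m+2\ell)!(n-2\ell+2)!}+\sum_{(m',n')\in\Lambda_{M+1}^{V,2},\,m'+n'>m+n+2}A^{V,f}_{m',n',m,n}\frac{x^{m'}y^{n'}}{m'!n'!}.$$ **Non-trivial and accuracy order.** A family $\{C_{k,\ell}(h)\}$ is non-trivial if $C_{k,\ell}(0)\ne0$ for at least one $(k,\ell)$. A 6-point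 scheme at $(x_0,y_j)$ is given by non-trivial polynomials $C_{k,\ell}(h)$, $k\in\{0,1\}$, $\ell\in\{-1,0,1\}$, and a right-hand side that is a finite linear combination of the $f^{(m,n)}$ and $g_1^{(n)}$ with coefficients depending only on $a,\alpha,h$. It has accuracy order $p$ if, for every smooth $u$ near the point, with $f:=-\nabla\cdot(a\nabla u)$ and $g_1:=(-u_x+\alpha u)|_{\Gamma_1}$, the difference between $\sum_{k,\ell}C_{k,\ell}(h)u(x_0+kh,y_j+\ell h)$ and the right-hand side is $\mathcal{O}(h^{p+1})$ as $h\to0$ (i.e. $\mathcal{O}(h^p)$ after division by $h$). That the maximum accuracy order is six means that six is the largest $p$ such that for every smooth $\alpha$ and every positive smooth $a$ there is a 6-point scheme of accuracy order $p$. *)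

theory Defs
  imports
    "HOL-Analysis.Analysis"
    "HOL-Library.Landau_Symbols"
    "HOL-Computational_Algebra.Polynomial"
begin

text \<open>
  The domain lies locally in the closed half-plane of points with first coordinate at least
  \<open>x0\<close>.  Partial derivatives in \<open>x\<close> are taken within \<open>{x0..}\<close>: they are ordinary derivatives
  for \<open>x > x0\<close> and one-sided ones on the boundary \<open>x = x0\<close>.
\<close>

definition dx :: "real \<Rightarrow> (real \<Rightarrow> real \<Rightarrow> real) \<Rightarrow> real \<Rightarrow> real \<Rightarrow> real" where
  "dx x0 u = (\<lambda>x y. vector_derivative (\<lambda>t. u t y) (at x within {x0..}))"

definition dy :: "(real \<Rightarrow> real \<Rightarrow> real) \<Rightarrow> real \<Rightarrow> real \<Rightarrow> real" where
  "dy u = (\<lambda>x y. deriv (u x) y)"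

text \<open>The value \<open>u\<^sup>(\<^sup>m\<^sup>,\<^sup>n\<^sup>)\<close> at the base point \<open>(x0, y0)\<close>.\<close>

definition pderiv_at :: "real \<Rightarrow> real \<Rightarrow> nat \<Rightarrow> nat \<Rightarrow> (real \<Rightarrow> real \<Rightarrow> real) \<Rightarrow> real" where
  "pderiv_at x0 y0 m n u = (dx x0 ^^ m) ((dy ^^ n) u) x0 y0"

definition half_box :: "real \<Rightarrow> real \<Rightarrow> real \<Rightarrow> (real \<times> real) set" where
  "half_box x0 y0 d = {x0..<x0 + d} \<times> {y0 - d<..<y0 + d}"

text \<open>
  \<open>C_k\<close> up to the boundary: all iterated partial derivatives of order at most \<open>k\<close>, taken in
  any order, exist and are continuous on \<open>S\<close>.
\<close>

fun Ck_on :: "real \<Rightarrow> (real \<times> real) set \<Rightarrow> nat \<Rightarrow> (real \<Rightarrow> real \<Rightarrow> real) \<Rightarrow> bool" where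
  "Ck_on x0 S 0 u \<longleftrightarrow> continuous_on S (\<lambda>(x, y). u x y)"
| "Ck_on x0 S (Suc k) u \<longleftrightarrow>
     continuous_on S (\<lambda>(x, y). u x y) \<and>
     (\<forall>(x, y)\<in>S. (\<lambda>t. u t y) differentiable (at x within {x0..}) \<and> u x differentiable (at y)) \<and>
     Ck_on x0 S k (dx x0 u) \<and> Ck_on x0 S k (dy u)"

definition smooth_near :: "real \<Rightarrow> real \<Rightarrow> (real \<Rightarrow> real \<Rightarrow> real) \<Rightarrow> bool" where
  "smooth_near x0 y0 u \<longleftrightarrow> (\<exists>d>0. \<forall>k. Ck_on x0 (half_box x0 y0 d) k u)"

definition positive_near :: "real \<Rightarrow> real \<Rightarrow> (real \<Rightarrow> real \<Rightarrow> real) \<Rightarrow> bool" where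
  "positive_near x0 y0 a \<longleftrightarrow> (\<exists>d>0. \<forall>(x, y)\<in>half_box x0 y0 d. a x y > 0)"

definition smooth1_on :: "real set \<Rightarrow> (real \<Rightarrow> real) \<Rightarrow> bool" where
  "smooth1_on I g \<longleftrightarrow> (\<forall>n. \<forall>y\<in>I. ((deriv ^^ n) g) differentiable (at y))"

text \<open>The source term \<open>f = - div (a grad u)\<close>.\<close>

definition source :: "real \<Rightarrow> (real \<Rightarrow> real \<Rightarrow> real) \<Rightarrow> (real \<Rightarrow> real \<Rightarrow> real) \<Rightarrow> real \<Rightarrow> real \<Rightarrow> real" where
  "source x0 a u = (\<lambda>x y.
     - (dx x0 (\<lambda>x y. a x y * dx x0 u x y) x y + dy (\<lambda>x y. a x y * dy u x y) x y))"

text \<open>The boundary data; the outward normal on the side \<open>x = x0\<close> is \<open>(-1, 0)\<close>.\<close>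

definition robin_data :: "real \<Rightarrow> (real \<Rightarrow> real) \<Rightarrow> (real \<Rightarrow> real \<Rightarrow> real) \<Rightarrow> real \<Rightarrow> real" where
  "robin_data x0 \<alpha> u = (\<lambda>y. - dx x0 u x0 y + \<alpha> y * u x0 y)"

definition Lam :: "nat \<Rightarrow> (nat \<times> nat) set" where
  "Lam N = {(m, n). m + n \<le> N}"

definition LamV1 :: "nat \<Rightarrow> (nat \<times> nat) set" where
  "LamV1 N = {(m, n) \<in> Lam N. m \<in> {0, 1}}"

definition LamV2 :: "nat \<Rightarrow> (nat \<times> nat) set" where
  "LamV2 N = Lam N - LamV1 N"

text \<open>
  For \<open>(m', n')\<close> in \<open>LamV2 (M + 1)\<close> the pairs of \<open>LamV1 (M + 1)\<close> with \<open>m + n \<le> m' + n'\<close> are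
  those of \<open>LamV1 (m' + n')\<close>, and the pairs of \<open>Lam (M - 1)\<close> with \<open>m + n \<le> m' + n' - 2\<close> are
  those of \<open>Lam (m' + n' - 2)\<close>; so the coefficients do not depend on \<open>M\<close>.
\<close>

definition is_representation ::
  "real \<Rightarrow> real \<Rightarrow> (real \<Rightarrow> real \<Rightarrow> real) \<Rightarrow> nat \<Rightarrow> nat \<Rightarrow>
   (nat \<Rightarrow> nat \<Rightarrow> real) \<Rightarrow> (nat \<Rightarrow> nat \<Rightarrow> real) \<Rightarrow> bool" where
  "is_representation x0 y0 a m' n' Au Af \<longleftrightarrow>
     (\<forall>u. smooth_near x0 y0 u \<longrightarrow>
        pderiv_at x0 y0 m' n' u =
          (\<Sum>(m, n)\<in>LamV1 (m' + n'). Au m n * pderiv_at x0 y0 m n u) +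
          (\<Sum>(m, n)\<in>Lam (m' + n' - 2). Af m n * pderiv_at x0 y0 m n (source x0 a u)))"

text \<open>
  The coefficients of the representation are unique on its index sets; the choice only affects
  values outside of them, which are never used.
\<close>

definition AV ::
  "real \<Rightarrow> real \<Rightarrow> (real \<Rightarrow> real \<Rightarrow> real) \<Rightarrow> nat \<Rightarrow> nat \<Rightarrow>
   (nat \<Rightarrow> nat \<Rightarrow> real) \<times> (nat \<Rightarrow> nat \<Rightarrow> real)" where
  "AV x0 y0 a m' n' = (SOME A. is_representation x0 y0 a m' n' (fst A) (snd A))"

definition AVu ::
  "real \<Rightarrow> real \<Rightarrow> (real \<Rightarrow> real \<Rightarrow> real) \<Rightarrow> nat \<Rightarrow> nat \<Rightarrow> nat \<Rightarrow> nat \<Rightarrow> real" where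
  "AVu x0 y0 a m' n' = fst (AV x0 y0 a m' n')"

definition AVf ::
  "real \<Rightarrow> real \<Rightarrow> (real \<Rightarrow> real \<Rightarrow> real) \<Rightarrow> nat \<Rightarrow> nat \<Rightarrow> nat \<Rightarrow> nat \<Rightarrow> real" where
  "AVf x0 y0 a m' n' = snd (AV x0 y0 a m' n')"

definition GV ::
  "real \<Rightarrow> real \<Rightarrow> (real \<Rightarrow> real \<Rightarrow> real) \<Rightarrow> nat \<Rightarrow> nat \<Rightarrow> nat \<Rightarrow> real \<Rightarrow> real \<Rightarrow> real" where
  "GV x0 y0 a M m n x y =
     (\<Sum>l = 0..n div 2.
        (-1) ^ l * x ^ (m + 2 * l) * y ^ (n - 2 * l) / (fact (m + 2 * l) * fact (n - 2 * l))) +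
     (\<Sum>(m', n') \<in> {(m', n') \<in> LamV2 (M + 1). m' + n' > m + n}.
        AVu x0 y0 a m' n' m n * (x ^ m' * y ^ n' / (fact m' * fact n')))"

definition QV ::
  "real \<Rightarrow> real \<Rightarrow> (real \<Rightarrow> real \<Rightarrow> real) \<Rightarrow> nat \<Rightarrow> nat \<Rightarrow> nat \<Rightarrow> real \<Rightarrow> real \<Rightarrow> real" where
  "QV x0 y0 a M m n x y =
     1 / a x0 y0 * (\<Sum>l = 1..1 + n div 2.
        (-1) ^ l * x ^ (m + 2 * l) * y ^ (n + 2 - 2 * l) /
        (fact (m + 2 * l) * fact (n + 2 - 2 * l))) +
     (\<Sum>(m', n') \<in> {(m', n') \<in> LamV2 (M + 1). m' + n' > m + n + 2}.
        AVf x0 y0 a m' n' m n * (x ^ m' * y ^ n' / (fact m' * fact n')))"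

text \<open>A family of stencil coefficients is indexed by \<open>k \<in> {0, 1}\<close> and \<open>l \<in> {-1, 0, 1}\<close>.\<close>

definition stencil_sum :: "(nat \<Rightarrow> int \<Rightarrow> real poly) \<Rightarrow> (real \<Rightarrow> real \<Rightarrow> real) \<Rightarrow> real \<Rightarrow> real" where
  "stencil_sum C w h =
     (\<Sum>k\<in>{0, 1}. \<Sum>l\<in>{-1, 0, 1}. poly (C k l) h * w (real k * h) (of_int l * h))"

definition nontrivial :: "(nat \<Rightarrow> int \<Rightarrow> real poly) \<Rightarrow> bool" where
  "nontrivial C \<longleftrightarrow> (\<exists>k\<in>{0, 1}. \<exists>l\<in>{-1, 0, 1}. poly (C k l) 0 \<noteq> 0)"

text \<open>
  The 6-point scheme at \<open>(x0, y0)\<close> whose right-hand side is the linear combination of the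
  \<open>f\<^sup>(\<^sup>m\<^sup>,\<^sup>n\<^sup>)\<close>, \<open>(m, n) \<in> I\<close>, and \<open>g\<^sup>(\<^sup>n\<^sup>)\<close>, \<open>n \<in> J\<close>, with the \<open>h\<close>-dependent coefficients \<open>cf m n\<close>
  and \<open>cg n\<close>, has accuracy order \<open>p\<close> for the pair \<open>(a, \<alpha>)\<close>.
\<close>

definition scheme_of_order ::
  "real \<Rightarrow> real \<Rightarrow> (real \<Rightarrow> real \<Rightarrow> real) \<Rightarrow> (real \<Rightarrow> real) \<Rightarrow> (nat \<Rightarrow> int \<Rightarrow> real poly) \<Rightarrow>
   (nat \<times> nat) set \<Rightarrow> (nat \<Rightarrow> nat \<Rightarrow> real \<Rightarrow> real) \<Rightarrow> nat set \<Rightarrow> (nat \<Rightarrow> real \<Rightarrow> real) \<Rightarrow> nat \<Rightarrow> bool" where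
  "scheme_of_order x0 y0 a \<alpha> C I cf J cg p \<longleftrightarrow>
     nontrivial C \<and> finite I \<and> finite J \<and>
     (\<forall>u. smooth_near x0 y0 u \<longrightarrow>
        (\<lambda>h. stencil_sum C (\<lambda>x y. u (x0 + x) (y0 + y)) h -
              ((\<Sum>(m, n)\<in>I. pderiv_at x0 y0 m n (source x0 a u) * cf m n h) +
               (\<Sum>n\<in>J. (deriv ^^ n) (robin_data x0 \<alpha> u) y0 * cg n h)))
        \<in> O[at_right 0](\<lambda>h. h ^ (p + 1)))"

end

theory Submission
  imports Defs
begin

text \<open>
  The argument takes place in the jet of \<open>u\<close> at the base point, with \<open>z = y + i x\<close> as the
  natural coordinate.

  \<^bold>\<open>Consistency.\<close>  Solving the equation for \<open>u\<^sub>x\<^sub>x\<close> expresses every derivative of \<open>u\<close> by the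
  derivatives \<open>u\<^sup>(\<^sup>0\<^sup>,\<^sup>n\<^sup>)\<close>, \<open>u\<^sup>(\<^sup>1\<^sup>,\<^sup>n\<^sup>)\<close> and those of \<open>f\<close> (\<open>pderiv_at_tables\<close>), and the boundary
  condition eliminates \<open>u\<^sup>(\<^sup>1\<^sup>,\<^sup>n\<^sup>)\<close>.  The Taylor polynomial of \<open>u\<close> therefore equals
  \<open>\<Sum> u\<^sup>(\<^sup>0\<^sup>,\<^sup>n\<^sup>) B\<^sub>n\<close> plus multiples of the derivatives of \<open>f\<close> and \<open>g\<close> (\<open>taylor_poly_robin\<close>).
  Here \<open>B\<^sub>n\<close>, called \<open>robin_basis\<close> below, is the Taylor polynomial of the solution with vanishing
  data \<open>f\<close>, \<open>g\<close> and with trace \<open>y\<^sup>n / n!\<close>.  The linear system says that the stencil annihilates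
  all \<open>B\<^sub>n\<close> up to \<open>O(h\<^sup>7)\<close>, and the multiples that are left over form the right-hand side of the
  scheme (\<open>scheme_of_order_from_system\<close>).

  \<^bold>\<open>Solvability.\<close>  Write \<open>C = \<Sum> c\<^sub>j h\<^sup>j\<close> and split \<open>B\<^sub>n\<close> into homogeneous parts; the lowest one
  is \<open>P\<^sub>n = Re z\<^sup>n / n!\<close>.  The system becomes triangular: \<open>c\<^sub>j\<close> has to take prescribed values on
  all \<open>P\<^sub>n\<close> with \<open>n \<le> 6 - j\<close>, and these values depend on \<open>c\<^sub>i\<close> for \<open>i < j\<close> only.
  On the six nodes \<open>P\<^sub>0, \<dots>, P\<^sub>5\<close> satisfy exactly one linear relation,
  \<open>120 P\<^sub>5 - 10 P\<^sub>3 + 2/3 P\<^sub>1 = 0\<close>.  So nothing can go wrong for \<open>j \<ge> 2\<close>.  For \<open>j = 0\<close> the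
  nine-point Laplacian, folded along the boundary, annihilates \<open>P\<^sub>0, \<dots>, P\<^sub>6\<close>.  The case \<open>j = 1\<close>
  requires the values to respect the relation.  They do: with \<open>p = a\<^sub>x / a\<close> and \<open>q = a\<^sub>y / a\<close> the
  second part of \<open>B\<^sub>n\<close> is \<open>-(p x + q y) P\<^sub>n / 2\<close> plus a harmonic polynomial (to first order the
  substitution \<open>u = v / \<surd>a\<close> removes the gradient of \<open>a\<close>), and for odd \<open>n\<close> the weights \<open>c\<^sub>0\<close>,
  which are symmetric and annihilate the polynomials \<open>P\<close>, only see \<open>-q y P\<^sub>n / 2\<close>, to which the
  relation carries over node by node
  (\<open>folded_laplacian_compatible\<close>, which rests on \<open>AVu_second\<close>).

  \<^bold>\<open>The order barrier.\<close>  For \<open>a = 1\<close> and \<open>\<alpha> = 1\<close> the polynomials \<open>P\<^sub>n + R\<close>, where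
  \<open>R = Im z\<^sup>n\<^sup>+\<^sup>1 / (n+1)!\<close>, have vanishing data.  Order seven would force \<open>c\<^sub>0 P\<^sub>n = 0\<close> and
  \<open>c\<^sub>1 P\<^sub>n + c\<^sub>0 R = 0\<close> for \<open>n \<le> 6\<close>.  As \<open>Re z\<^sup>6 = Re z\<^sup>2\<close> on the six nodes, the second equation
  for \<open>n = 2\<close> and \<open>n = 6\<close> eliminates \<open>c\<^sub>1\<close> and leaves a condition on \<open>c\<^sub>0\<close> that is violated by the
  folded Laplacian, the only candidate (\<open>scheme_order_le_six\<close>).  For \<open>\<alpha> = 0\<close> the terms \<open>c\<^sub>0 R\<close> are
  absent and \<open>c\<^sub>1 = 0\<close> would do, hence the choice \<open>\<alpha> = 1\<close>.
\<close>

section \<open>Calculus in a half-box\<close>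

lemma half_box_iff: "(x, y) \<in> half_box x0 y0 d \<longleftrightarrow> x0 \<le> x \<and> x < x0 + d \<and> y0 - d < y \<and> y < y0 + d"
  by (auto simp: half_box_def)

lemma base_in_half_box [simp]: "d > 0 \<Longrightarrow> (x0, y0) \<in> half_box x0 y0 d"
  by (simp add: half_box_iff)

lemma half_box_mono: "d \<le> e \<Longrightarrow> half_box x0 y0 d \<subseteq> half_box x0 y0 e"
  by (auto simp: half_box_def)

lemma at_within_half_line_neq_bot: "x0 \<le> x \<Longrightarrow> at x within {x0..} \<noteq> (bot :: real filter)"
  for x :: real
proof -
  assume "x0 \<le> x"
  hence "at x within {x<..} \<le> at x within {x0..}"
    by (intro at_le) auto
  thus ?thesis
    using trivial_limit_at_right_real[of x] by (auto simp: bot_unique)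
qed

lemma dx_eqI:
  assumes "x0 \<le> x" "((\<lambda>t. u t y) has_real_derivative D) (at x within {x0..})"
  shows "dx x0 u x y = D"
  unfolding dx_def
  by (rule vector_derivative_within)
     (use assms at_within_half_line_neq_bot in \<open>auto simp: has_real_derivative_iff_has_vector_derivative\<close>)

lemma dy_eqI: "(u x has_real_derivative D) (at y) \<Longrightarrow> dy u x y = D"
  by (simp add: dy_def DERIV_imp_deriv)

lemma dx_works:
  "(\<lambda>t. u t y) differentiable (at x within {x0..}) \<Longrightarrow>
   ((\<lambda>t. u t y) has_real_derivative dx x0 u x y) (at x within {x0..})"
  unfolding dx_def has_real_derivative_iff_has_vector_derivative
  using vector_derivative_works by blast

lemma dy_works: "u x differentiable (at y) \<Longrightarrow> (u x has_real_derivative dy u x y) (at y)"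
  unfolding dy_def using DERIV_deriv_iff_real_differentiable by blast

text \<open>
  A half-box is relatively open in the half-plane, so the one-sided derivatives at its points
  depend only on the values in it.  This is what makes the congruence rules below work up to the
  boundary line.
\<close>

lemma eventually_half_box_x:
  assumes "(x, y) \<in> half_box x0 y0 d"
  shows "\<forall>\<^sub>F t in nhds x. t \<in> {x0..} \<longrightarrow> (t, y) \<in> half_box x0 y0 d"
proof -
  have "\<forall>\<^sub>F t in nhds x. t < x0 + d"
    using assms by (intro order_tendstoD) (auto simp: half_box_iff filterlim_ident)
  thus ?thesis
    by eventually_elim (use assms in \<open>auto simp: half_box_iff\<close>)
qed

lemma eventually_half_box_y:
  assumes "(x, y) \<in> half_box x0 y0 d"
  shows "\<forall>\<^sub>F t in nhds y. (x, t) \<in> half_box x0 y0 d"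
proof -
  have "\<forall>\<^sub>F t in nhds y. t \<in> {y0 - d<..<y0 + d}"
    using assms by (intro eventually_nhds_in_open) (auto simp: half_box_iff)
  thus ?thesis
    by eventually_elim (use assms in \<open>auto simp: half_box_iff\<close>)
qed

lemma dx_cong_box:
  assumes "\<And>x y. (x, y) \<in> half_box x0 y0 d \<Longrightarrow> u x y = v x y" "(x, y) \<in> half_box x0 y0 d"
  shows "dx x0 u x y = dx x0 v x y"
  unfolding dx_def
  by (rule vector_derivative_cong_eq)
     (use eventually_half_box_x[OF assms(2)] assms in \<open>auto elim!: eventually_mono simp: half_box_iff\<close>)

lemma dy_cong_box:
  assumes "\<And>x y. (x, y) \<in> half_box x0 y0 d \<Longrightarrow> u x y = v x y" "(x, y) \<in> half_box x0 y0 d"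
  shows "dy u x y = dy v x y"
  unfolding dy_def
  by (rule deriv_cong_ev)
     (use eventually_half_box_y[OF assms(2)] assms in \<open>auto elim!: eventually_mono\<close>)

lemma differentiable_x_cong_box:
  fixes u v :: "real \<Rightarrow> real \<Rightarrow> real"
  assumes "\<And>x y. (x, y) \<in> half_box x0 y0 d \<Longrightarrow> u x y = v x y" "(x, y) \<in> half_box x0 y0 d"
    and "(\<lambda>t. u t y) differentiable (at x within {x0..})"
  shows "(\<lambda>t. v t y) differentiable (at x within {x0..})"
proof -
  have "((\<lambda>t. u t y) has_real_derivative dx x0 u x y) (at x within {x0..})"
    using assms(3) by (rule dx_works)
  hence "((\<lambda>t. v t y) has_real_derivative dx x0 u x y) (at x within {x0..})"
    by (rule has_field_derivative_cong_ev[OF refl _ refl refl, THEN iffD1, rotated 2])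
      (use eventually_half_box_x[OF assms(2)] assms in \<open>auto elim!: eventually_mono simp: half_box_iff\<close>)
  thus ?thesis
    by (auto simp: real_differentiable_def)
qed

lemma differentiable_y_cong_box:
  fixes u v :: "real \<Rightarrow> real \<Rightarrow> real"
  assumes "\<And>x y. (x, y) \<in> half_box x0 y0 d \<Longrightarrow> u x y = v x y" "(x, y) \<in> half_box x0 y0 d"
    and "u x differentiable (at y)"
  shows "v x differentiable (at y)"
proof -
  have "(u x has_real_derivative dy u x y) (at y)"
    using assms(3) by (rule dy_works)
  hence "(v x has_real_derivative dy u x y) (at y)"
    by (rule DERIV_cong_ev[OF refl _ refl, THEN iffD1, rotated])
      (use eventually_half_box_y[OF assms(2)] assms in \<open>auto elim!: eventually_mono\<close>)
  thus ?thesis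
    by (auto simp: real_differentiable_def)
qed

lemma Ck_on_SucI:
  assumes "continuous_on S (\<lambda>(x, y). u x y)"
    and "\<And>x y. (x, y) \<in> S \<Longrightarrow> (\<lambda>t. u t y) differentiable (at x within {x0..})"
    and "\<And>x y. (x, y) \<in> S \<Longrightarrow> u x differentiable (at y)"
    and "Ck_on x0 S k (dx x0 u)" "Ck_on x0 S k (dy u)"
  shows "Ck_on x0 S (Suc k) u"
  using assms by auto

lemma Ck_on_SucD:
  assumes "Ck_on x0 S (Suc k) u"
  shows "continuous_on S (\<lambda>(x, y). u x y)"
    and "\<And>x y. (x, y) \<in> S \<Longrightarrow> (\<lambda>t. u t y) differentiable (at x within {x0..})"
    and "\<And>x y. (x, y) \<in> S \<Longrightarrow> u x differentiable (at y)"
    and "Ck_on x0 S k (dx x0 u)" "Ck_on x0 S k (dy u)"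
  using assms by auto

lemma Ck_on_cong_box:
  assumes "\<And>x y. (x, y) \<in> half_box x0 y0 d \<Longrightarrow> u x y = v x y"
    and "Ck_on x0 (half_box x0 y0 d) k u"
  shows "Ck_on x0 (half_box x0 y0 d) k v"
  using assms
proof (induction k arbitrary: u v)
  case 0
  have "continuous_on (half_box x0 y0 d) (\<lambda>(x, y). u x y) \<longleftrightarrow>
        continuous_on (half_box x0 y0 d) (\<lambda>(x, y). v x y)"
    by (rule continuous_on_cong) (use 0 in auto)
  with 0 show ?case by simp
next
  case (Suc k)
  note U = Ck_on_SucD[OF Suc.prems(2)]
  show ?case
  proof (rule Ck_on_SucI)
    have "continuous_on (half_box x0 y0 d) (\<lambda>(x, y). u x y) \<longleftrightarrow>
          continuous_on (half_box x0 y0 d) (\<lambda>(x, y). v x y)"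
      by (rule continuous_on_cong) (use Suc.prems(1) in auto)
    with U(1) show "continuous_on (half_box x0 y0 d) (\<lambda>(x, y). v x y)" by blast
    show "Ck_on x0 (half_box x0 y0 d) k (dx x0 v)"
      by (rule Suc.IH[OF dx_cong_box[OF Suc.prems(1)] U(4)])
    show "Ck_on x0 (half_box x0 y0 d) k (dy v)"
      by (rule Suc.IH[OF dy_cong_box[OF Suc.prems(1)] U(5)])
    show "(\<lambda>t. v t y) differentiable (at x within {x0..})" if "(x, y) \<in> half_box x0 y0 d" for x y
      by (rule differentiable_x_cong_box[of x0 y0 d u v, OF Suc.prems(1) that U(2)[OF that]])
    show "v x differentiable (at y)" if "(x, y) \<in> half_box x0 y0 d" for x y
      by (rule differentiable_y_cong_box[of x0 y0 d u v, OF Suc.prems(1) that U(3)[OF that]])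
  qed
qed

lemma Ck_on_Suc_imp: "Ck_on x0 S (Suc k) u \<Longrightarrow> Ck_on x0 S k u"
proof (induction k arbitrary: u)
  case (Suc k)
  note U = Ck_on_SucD[OF Suc.prems]
  show ?case by (rule Ck_on_SucI[OF U(1-3) Suc.IH[OF U(4)] Suc.IH[OF U(5)]])
qed simp

lemma Ck_on_subset: "Ck_on x0 S k u \<Longrightarrow> T \<subseteq> S \<Longrightarrow> Ck_on x0 T k u"
proof (induction k arbitrary: u)
  case 0
  thus ?case using continuous_on_subset by simp blast
next
  case (Suc k)
  note U = Ck_on_SucD[OF Suc.prems(1)] and T = Suc.prems(2)
  show ?case
    by (rule Ck_on_SucI[OF continuous_on_subset[OF U(1) T] U(2,3)
          Suc.IH[OF U(4) T] Suc.IH[OF U(5) T]]) (use T in blast)+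
qed

lemma Ck_on_const: "Ck_on x0 (half_box x0 y0 d) k (\<lambda>x y. c)"
proof (induction k arbitrary: c)
  case (Suc k)
  show ?case
  proof (rule Ck_on_SucI)
    show "Ck_on x0 (half_box x0 y0 d) k (dx x0 (\<lambda>x y. c))"
      by (rule Ck_on_cong_box[OF _ Suc[of 0]])
        (rule dx_eqI[OF _ DERIV_const, symmetric], simp add: half_box_iff)
    show "Ck_on x0 (half_box x0 y0 d) k (dy (\<lambda>x y. c))"
      by (rule Ck_on_cong_box[OF _ Suc[of 0]]) (rule dy_eqI[OF DERIV_const, symmetric])
  qed (simp_all add: case_prod_unfold)
qed (simp add: case_prod_unfold)

lemma dx_add:
  assumes "x0 \<le> x" "(\<lambda>t. u t y) differentiable (at x within {x0..})"
    "(\<lambda>t. v t y) differentiable (at x within {x0..})"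
  shows "dx x0 (\<lambda>x y. u x y + v x y) x y = dx x0 u x y + dx x0 v x y"
  by (rule dx_eqI) (use assms in \<open>auto intro!: derivative_eq_intros dx_works\<close>)

lemma dx_mult:
  assumes "x0 \<le> x" "(\<lambda>t. u t y) differentiable (at x within {x0..})"
    "(\<lambda>t. v t y) differentiable (at x within {x0..})"
  shows "dx x0 (\<lambda>x y. u x y * v x y) x y = dx x0 u x y * v x y + u x y * dx x0 v x y"
  by (rule dx_eqI) (use assms in \<open>auto intro!: derivative_eq_intros dx_works\<close>)

lemma dy_add:
  assumes "u x differentiable (at y)" "v x differentiable (at y)"
  shows "dy (\<lambda>x y. u x y + v x y) x y = dy u x y + dy v x y"
  by (rule dy_eqI) (use assms in \<open>auto intro!: derivative_eq_intros dy_works\<close>)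

lemma dy_mult:
  assumes "u x differentiable (at y)" "v x differentiable (at y)"
  shows "dy (\<lambda>x y. u x y * v x y) x y = dy u x y * v x y + u x y * dy v x y"
  by (rule dy_eqI) (use assms in \<open>auto intro!: derivative_eq_intros dy_works\<close>)

lemma continuous_on_add2:
  fixes u v :: "real \<Rightarrow> real \<Rightarrow> real"
  assumes "continuous_on S (\<lambda>(x, y). u x y)" "continuous_on S (\<lambda>(x, y). v x y)"
  shows "continuous_on S (\<lambda>(x, y). u x y + v x y)"
  using continuous_on_add[OF assms] by (simp add: case_prod_unfold)

lemma continuous_on_mult2:
  fixes u v :: "real \<Rightarrow> real \<Rightarrow> real"
  assumes "continuous_on S (\<lambda>(x, y). u x y)" "continuous_on S (\<lambda>(x, y). v x y)"
  shows "continuous_on S (\<lambda>(x, y). u x y * v x y)"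
  using continuous_on_mult[OF assms] by (simp add: case_prod_unfold)

lemma Ck_on_add:
  assumes "Ck_on x0 (half_box x0 y0 d) k u" "Ck_on x0 (half_box x0 y0 d) k v"
  shows "Ck_on x0 (half_box x0 y0 d) k (\<lambda>x y. u x y + v x y)"
  using assms
proof (induction k arbitrary: u v)
  case 0
  thus ?case by (simp add: continuous_on_add2)
next
  case (Suc k)
  note U = Ck_on_SucD[OF Suc.prems(1)] and V = Ck_on_SucD[OF Suc.prems(2)]
  show ?case
  proof (rule Ck_on_SucI)
    show "Ck_on x0 (half_box x0 y0 d) k (dx x0 (\<lambda>x y. u x y + v x y))"
      by (rule Ck_on_cong_box[OF _ Suc.IH[OF U(4) V(4)]])
        (rule dx_add[symmetric], auto simp: U V half_box_iff)
    show "Ck_on x0 (half_box x0 y0 d) k (dy (\<lambda>x y. u x y + v x y))"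
      by (rule Ck_on_cong_box[OF _ Suc.IH[OF U(5) V(5)]])
        (rule dy_add[symmetric], auto simp: U V)
  qed (simp_all only: continuous_on_add2[OF U(1) V(1)] differentiable_add[OF U(2) V(2)]
        differentiable_add[OF U(3) V(3)])
qed

lemma Ck_on_mult:
  assumes "Ck_on x0 (half_box x0 y0 d) k u" "Ck_on x0 (half_box x0 y0 d) k v"
  shows "Ck_on x0 (half_box x0 y0 d) k (\<lambda>x y. u x y * v x y)"
  using assms
proof (induction k arbitrary: u v)
  case 0
  thus ?case by (simp add: continuous_on_mult2)
next
  case (Suc k)
  note U = Ck_on_SucD[OF Suc.prems(1)] and V = Ck_on_SucD[OF Suc.prems(2)]
  note u = Ck_on_Suc_imp[OF Suc.prems(1)] and v = Ck_on_Suc_imp[OF Suc.prems(2)]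
  show ?case
  proof (rule Ck_on_SucI)
    show "Ck_on x0 (half_box x0 y0 d) k (dx x0 (\<lambda>x y. u x y * v x y))"
      by (rule Ck_on_cong_box[OF _ Ck_on_add[OF Suc.IH[OF U(4) v] Suc.IH[OF u V(4)]]])
        (rule dx_mult[symmetric], auto simp: U V half_box_iff)
    show "Ck_on x0 (half_box x0 y0 d) k (dy (\<lambda>x y. u x y * v x y))"
      by (rule Ck_on_cong_box[OF _ Ck_on_add[OF Suc.IH[OF U(5) v] Suc.IH[OF u V(5)]]])
        (rule dy_mult[symmetric], auto simp: U V)
    show "(\<lambda>t. u t y * v t y) differentiable (at x within {x0..})"
      if "(x, y) \<in> half_box x0 y0 d" for x y
      by (rule differentiable_mult[OF U(2)[OF that] V(2)[OF that]])
    show "(\<lambda>y. u x y * v x y) differentiable (at y)" if "(x, y) \<in> half_box x0 y0 d" for x y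
      by (rule differentiable_mult[OF U(3)[OF that] V(3)[OF that]])
  qed (rule continuous_on_mult2[OF U(1) V(1)])
qed

text \<open>
  Symmetry of second derivatives up to the boundary line, where interior versions do not apply.
  Integrating \<open>u\<^sub>x\<close> along the normal from the boundary gives \<open>u(t, y) - u(x0, y)\<close>;
  differentiation under the integral in \<open>y\<close> and then at the upper end point in \<open>t\<close> gives the
  claim, also at the left end of the interval.
\<close>

lemma dx_dy_commute:
  assumes C: "Ck_on x0 (half_box x0 y0 d) 2 u" and xy: "(x, y) \<in> half_box x0 y0 d"
  shows "dx x0 (dy u) x y = dy (dx x0 u) x y"
proof -
  let ?S = "half_box x0 y0 d" and ?U = "{y0 - d<..<y0 + d}"
  have C': "Ck_on x0 ?S (Suc (Suc 0)) u" using C by (simp add: numeral_2_eq_2)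
  have contx: "continuous_on ?S (\<lambda>(x, y). dx x0 u x y)"
    and contxy: "continuous_on ?S (\<lambda>(x, y). dy (dx x0 u) x y)"
    and dux: "\<And>x y. (x, y) \<in> ?S \<Longrightarrow> ((\<lambda>t. u t y) has_real_derivative dx x0 u x y) (at x within {x0..})"
    and duy: "\<And>x y. (x, y) \<in> ?S \<Longrightarrow> (u x has_real_derivative dy u x y) (at y)"
    and duxy: "\<And>x y. (x, y) \<in> ?S \<Longrightarrow> (dx x0 u x has_real_derivative dy (dx x0 u) x y) (at y)"
    using Ck_on_SucD[OF C'] Ck_on_SucD[OF Ck_on_SucD(4)[OF C']]
    by (simp_all add: dx_works dy_works)
  \<comment> \<open>any point strictly between the abscissa and the right end of the box serves as upper limit\<close>
  define x1 where "x1 = (x + (x0 + d)) / 2"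
  have x1: "x < x1" "x0 \<le> x" "x1 < x0 + d" "x0 < x1" "y \<in> ?U"
    using xy by (auto simp: x1_def half_box_iff field_simps)
  have inS: "(t, \<eta>) \<in> ?S" if "t \<in> {x0..x1}" "\<eta> \<in> ?U" for t \<eta>
    using that x1 by (auto simp: half_box_iff)
  have cont_sub: "continuous_on {x0..t} (\<lambda>s. dx x0 u s \<eta>)"
    "continuous_on {x0..t} (\<lambda>s. dy (dx x0 u) s \<eta>)"
    if "t \<in> {x0..x1}" "\<eta> \<in> ?U" for t \<eta>
    using continuous_on_compose2[OF contx, of "{x0..t}" "\<lambda>s. (s, \<eta>)"]
      continuous_on_compose2[OF contxy, of "{x0..t}" "\<lambda>s. (s, \<eta>)"] inS that
    by (force intro!: continuous_intros)+
  have ftc: "integral {x0..t} (\<lambda>s. dx x0 u s \<eta>) = u t \<eta> - u x0 \<eta>"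
    if "t \<in> {x0..x1}" "\<eta> \<in> ?U" for t \<eta>
  proof (rule integral_unique, rule fundamental_theorem_of_calculus)
    fix s assume "s \<in> {x0..t}"
    thus "((\<lambda>s. u s \<eta>) has_vector_derivative dx x0 u s \<eta>) (at s within {x0..t})"
      using dux[of s \<eta>] inS[of s \<eta>] that
      by (auto simp: has_real_derivative_iff_has_vector_derivative
          intro: has_vector_derivative_within_subset)
  qed (use that in auto)
  have under: "dy u t y - dy u x0 y = integral {x0..t} (\<lambda>s. dy (dx x0 u) s y)"
    if t: "t \<in> {x0..x1}" for t
  proof -
    have "((\<lambda>\<eta>. integral (cbox x0 t) (\<lambda>s. dx x0 u s \<eta>)) has_field_derivative
        integral (cbox x0 t) (\<lambda>s. dy (dx x0 u) s y)) (at y within ?U)"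
    proof (rule leibniz_rule_field_derivative)
      show "((\<lambda>\<eta>. dx x0 u s \<eta>) has_real_derivative dy (dx x0 u) s \<eta>) (at \<eta> within ?U)"
        if "\<eta> \<in> ?U" "s \<in> cbox x0 t" for \<eta> s
        using duxy[of s \<eta>] inS[of s \<eta>] that t by (auto intro: has_field_derivative_at_within)
      show "(\<lambda>s. dx x0 u s \<eta>) integrable_on cbox x0 t" if "\<eta> \<in> ?U" for \<eta>
        using cont_sub(1)[OF t that] by (simp add: integrable_continuous_interval)
      show "continuous_on (?U \<times> cbox x0 t) (\<lambda>(\<eta>, s). dy (dx x0 u) s \<eta>)"
        using continuous_on_compose2[OF contxy, of "?U \<times> cbox x0 t" "\<lambda>(\<eta>, s). (s, \<eta>)"] inS t
        by (force intro!: continuous_intros simp: case_prod_unfold)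
    qed (use x1 in auto)
    hence deriv_integral: "((\<lambda>\<eta>. integral {x0..t} (\<lambda>s. dx x0 u s \<eta>)) has_field_derivative
        integral {x0..t} (\<lambda>s. dy (dx x0 u) s y)) (at y)"
      using x1 by (simp add: at_within_open[of y ?U])
    have "\<forall>\<^sub>F \<eta> in nhds y. \<eta> \<in> ?U"
      using x1 by (intro eventually_nhds_in_open) auto
    hence ev: "\<forall>\<^sub>F \<eta> in nhds y. integral {x0..t} (\<lambda>s. dx x0 u s \<eta>) = u t \<eta> - u x0 \<eta>"
      by eventually_elim (use ftc[OF t] in auto)
    have "((\<lambda>\<eta>. u t \<eta> - u x0 \<eta>) has_field_derivative
        integral {x0..t} (\<lambda>s. dy (dx x0 u) s y)) (at y)"
      by (rule iffD1[OF DERIV_cong_ev[OF refl ev refl] deriv_integral])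
    moreover have "((\<lambda>\<eta>. u t \<eta> - u x0 \<eta>) has_field_derivative (dy u t y - dy u x0 y)) (at y)"
      using duy[of t y] duy[of x0 y] inS[of t y] inS[of x0 y] t x1
      by (auto intro!: derivative_eq_intros)
    ultimately show ?thesis using DERIV_unique by blast
  qed
  have nb: "at x within {x0..x1} = at x within {x0..}"
    using x1 by (intro at_within_nhd[of x "{..<x1}"]) auto
  have "((\<lambda>t. integral {x0..t} (\<lambda>s. dy (dx x0 u) s y)) has_real_derivative dy (dx x0 u) x y)
      (at x within {x0..x1})"
    by (rule integral_has_real_derivative) (use cont_sub[of x1 y] x1 in auto)
  hence "((\<lambda>t. dy u x0 y + integral {x0..t} (\<lambda>s. dy (dx x0 u) s y)) has_real_derivative
      dy (dx x0 u) x y) (at x within {x0..x1})"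
    by (auto intro!: derivative_eq_intros)
  hence "((\<lambda>t. dy u t y) has_real_derivative dy (dx x0 u) x y) (at x within {x0..x1})"
    by (rule has_field_derivative_transform_within[OF _ zero_less_one])
      (use x1 in \<open>auto simp: under[symmetric]\<close>)
  thus ?thesis
    by (intro dx_eqI) (use x1 nb in auto)
qed


section \<open>Germs and jets at the base point\<close>

text \<open>
  Derivatives at the base point are functions of the germ, and product rule and symmetry of second
  derivatives hold as equations between germs.  The values of \<open>dx\<close> to the left of the boundary
  are meaningless, so these are not equations between functions.
\<close>

definition near_eq ::
  "real \<Rightarrow> real \<Rightarrow> (real \<Rightarrow> real \<Rightarrow> real) \<Rightarrow> (real \<Rightarrow> real \<Rightarrow> real) \<Rightarrow> bool" where
  "near_eq x0 y0 u v \<longleftrightarrow> (\<exists>d>0. \<forall>(x, y)\<in>half_box x0 y0 d. u x y = v x y)"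

lemma near_eqI:
  assumes "d > 0" "\<And>x y. (x, y) \<in> half_box x0 y0 d \<Longrightarrow> u x y = v x y"
  shows "near_eq x0 y0 u v"
  using assms by (auto simp: near_eq_def)

lemma near_eqE:
  assumes "near_eq x0 y0 u v"
  obtains d where "d > 0" "\<And>x y. (x, y) \<in> half_box x0 y0 d \<Longrightarrow> u x y = v x y"
  using assms by (auto simp: near_eq_def)

lemma near_eq_refl [simp]: "near_eq x0 y0 u u"
  by (rule near_eqI[of 1]) auto

lemma near_eq_sym: "near_eq x0 y0 u v \<Longrightarrow> near_eq x0 y0 v u"
  by (elim near_eqE, rule near_eqI) auto

lemma near_eq_trans [trans]:
  assumes "near_eq x0 y0 u v" "near_eq x0 y0 v w"
  shows "near_eq x0 y0 u w"
proof -
  obtain d e where "d > 0" "\<And>x y. (x, y) \<in> half_box x0 y0 d \<Longrightarrow> u x y = v x y"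
    "e > 0" "\<And>x y. (x, y) \<in> half_box x0 y0 e \<Longrightarrow> v x y = w x y"
    using assms by (metis near_eqE)
  thus ?thesis
    using half_box_mono[of "min d e" d x0 y0] half_box_mono[of "min d e" e x0 y0]
    by (intro near_eqI[of "min d e"]) (auto simp: subset_iff)
qed

lemma near_eq_dx: "near_eq x0 y0 u v \<Longrightarrow> near_eq x0 y0 (dx x0 u) (dx x0 v)"
  by (elim near_eqE, rule near_eqI, assumption, rule dx_cong_box) auto

lemma near_eq_dy: "near_eq x0 y0 u v \<Longrightarrow> near_eq x0 y0 (dy u) (dy v)"
  by (elim near_eqE, rule near_eqI, assumption, rule dy_cong_box) auto

lemma near_eq_dx_funpow: "near_eq x0 y0 u v \<Longrightarrow> near_eq x0 y0 ((dx x0 ^^ m) u) ((dx x0 ^^ m) v)"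
  by (induction m) (auto intro: near_eq_dx)

lemma near_eq_dy_funpow: "near_eq x0 y0 u v \<Longrightarrow> near_eq x0 y0 ((dy ^^ m) u) ((dy ^^ m) v)"
  by (induction m) (auto intro: near_eq_dy)

lemma near_eq_at_base: "near_eq x0 y0 u v \<Longrightarrow> u x0 y0 = v x0 y0"
  by (elim near_eqE) auto

lemma pderiv_at_cong: "near_eq x0 y0 u v \<Longrightarrow> pderiv_at x0 y0 m n u = pderiv_at x0 y0 m n v"
  unfolding pderiv_at_def
  by (intro near_eq_at_base near_eq_dx_funpow near_eq_dy_funpow)

lemma smooth_nearE:
  assumes "smooth_near x0 y0 u"
  obtains d where "d > 0" "\<And>k. Ck_on x0 (half_box x0 y0 d) k u"
  using assms by (auto simp: smooth_near_def)

lemma smooth_nearI: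
  assumes "d > 0" "\<And>k. Ck_on x0 (half_box x0 y0 d) k u"
  shows "smooth_near x0 y0 u"
  using assms by (auto simp: smooth_near_def)

lemma smooth_nearE2:
  assumes "smooth_near x0 y0 u" "smooth_near x0 y0 v"
  obtains d where "d > 0" "\<And>k. Ck_on x0 (half_box x0 y0 d) k u"
    "\<And>k. Ck_on x0 (half_box x0 y0 d) k v"
proof -
  obtain d e where *: "d > 0" "\<And>k. Ck_on x0 (half_box x0 y0 d) k u"
    "e > 0" "\<And>k. Ck_on x0 (half_box x0 y0 e) k v"
    using assms by (metis smooth_nearE)
  show ?thesis
  proof (rule that[of "min d e"])
    show "Ck_on x0 (half_box x0 y0 (min d e)) k u" for k
      by (rule Ck_on_subset[OF *(2) half_box_mono]) simp
    show "Ck_on x0 (half_box x0 y0 (min d e)) k v" for k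
      by (rule Ck_on_subset[OF *(4) half_box_mono]) simp
  qed (use * in simp)
qed

lemma smooth_near_dx: "smooth_near x0 y0 u \<Longrightarrow> smooth_near x0 y0 (dx x0 u)"
  by (elim smooth_nearE, rule smooth_nearI, assumption, rule Ck_on_SucD(4)) blast

lemma smooth_near_dy: "smooth_near x0 y0 u \<Longrightarrow> smooth_near x0 y0 (dy u)"
  by (elim smooth_nearE, rule smooth_nearI, assumption, rule Ck_on_SucD(5)) blast

lemma smooth_near_const [simp]: "smooth_near x0 y0 (\<lambda>x y. c)"
  by (rule smooth_nearI[of 1]) (auto intro: Ck_on_const)

lemma smooth_near_add:
  "smooth_near x0 y0 u \<Longrightarrow> smooth_near x0 y0 v \<Longrightarrow> smooth_near x0 y0 (\<lambda>x y. u x y + v x y)"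
  by (rule smooth_nearE2[of x0 y0 u v], assumption, assumption, rule smooth_nearI, assumption,
      rule Ck_on_add) auto

lemma smooth_near_mult:
  "smooth_near x0 y0 u \<Longrightarrow> smooth_near x0 y0 v \<Longrightarrow> smooth_near x0 y0 (\<lambda>x y. u x y * v x y)"
  by (rule smooth_nearE2[of x0 y0 u v], assumption, assumption, rule smooth_nearI, assumption,
      rule Ck_on_mult) auto

lemma smooth_near_cmult: "smooth_near x0 y0 u \<Longrightarrow> smooth_near x0 y0 (\<lambda>x y. c * u x y)"
  by (intro smooth_near_mult) auto

lemma smooth_near_sum:
  "(\<And>i. i \<in> I \<Longrightarrow> smooth_near x0 y0 (u i)) \<Longrightarrow> smooth_near x0 y0 (\<lambda>x y. \<Sum>i\<in>I. u i x y)"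
  by (induction I rule: infinite_finite_induct) (auto intro: smooth_near_add)

lemma near_eq_dx_add:
  assumes "smooth_near x0 y0 u" "smooth_near x0 y0 v"
  shows "near_eq x0 y0 (dx x0 (\<lambda>x y. u x y + v x y)) (\<lambda>x y. dx x0 u x y + dx x0 v x y)"
proof -
  obtain d where d: "d > 0" "\<And>k. Ck_on x0 (half_box x0 y0 d) k u"
    "\<And>k. Ck_on x0 (half_box x0 y0 d) k v"
    using assms by (rule smooth_nearE2) blast
  show ?thesis
    by (rule near_eqI[OF d(1)], rule dx_add)
      (use Ck_on_SucD(2)[OF d(2)] Ck_on_SucD(2)[OF d(3)] in \<open>auto simp: half_box_iff\<close>)
qed

lemma near_eq_dy_add:
  assumes "smooth_near x0 y0 u" "smooth_near x0 y0 v"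
  shows "near_eq x0 y0 (dy (\<lambda>x y. u x y + v x y)) (\<lambda>x y. dy u x y + dy v x y)"
proof -
  obtain d where d: "d > 0" "\<And>k. Ck_on x0 (half_box x0 y0 d) k u"
    "\<And>k. Ck_on x0 (half_box x0 y0 d) k v"
    using assms by (rule smooth_nearE2) blast
  show ?thesis
    by (rule near_eqI[OF d(1)], rule dy_add)
      (use Ck_on_SucD(3)[OF d(2)] Ck_on_SucD(3)[OF d(3)] in auto)
qed

lemma near_eq_dx_mult:
  assumes "smooth_near x0 y0 u" "smooth_near x0 y0 v"
  shows "near_eq x0 y0 (dx x0 (\<lambda>x y. u x y * v x y))
    (\<lambda>x y. dx x0 u x y * v x y + u x y * dx x0 v x y)"
proof -
  obtain d where d: "d > 0" "\<And>k. Ck_on x0 (half_box x0 y0 d) k u"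
    "\<And>k. Ck_on x0 (half_box x0 y0 d) k v"
    using assms by (rule smooth_nearE2) blast
  show ?thesis
    by (rule near_eqI[OF d(1)], rule dx_mult)
      (use Ck_on_SucD(2)[OF d(2)] Ck_on_SucD(2)[OF d(3)] in \<open>auto simp: half_box_iff\<close>)
qed

lemma near_eq_dy_mult:
  assumes "smooth_near x0 y0 u" "smooth_near x0 y0 v"
  shows "near_eq x0 y0 (dy (\<lambda>x y. u x y * v x y))
    (\<lambda>x y. dy u x y * v x y + u x y * dy v x y)"
proof -
  obtain d where d: "d > 0" "\<And>k. Ck_on x0 (half_box x0 y0 d) k u"
    "\<And>k. Ck_on x0 (half_box x0 y0 d) k v"
    using assms by (rule smooth_nearE2) blast
  show ?thesis
    by (rule near_eqI[OF d(1)], rule dy_mult)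
      (use Ck_on_SucD(3)[OF d(2)] Ck_on_SucD(3)[OF d(3)] in auto)
qed

lemma near_eq_dx_dy:
  assumes "smooth_near x0 y0 u"
  shows "near_eq x0 y0 (dx x0 (dy u)) (dy (dx x0 u))"
proof -
  obtain d where d: "d > 0" "\<And>k. Ck_on x0 (half_box x0 y0 d) k u"
    using assms by (rule smooth_nearE) blast
  show ?thesis
    by (rule near_eqI[OF d(1)], rule dx_dy_commute[OF d(2)])
qed

lemma smooth_near_dx_funpow: "smooth_near x0 y0 u \<Longrightarrow> smooth_near x0 y0 ((dx x0 ^^ m) u)"
  by (induction m) (auto intro: smooth_near_dx)

lemma smooth_near_dy_funpow: "smooth_near x0 y0 u \<Longrightarrow> smooth_near x0 y0 ((dy ^^ m) u)"
  by (induction m) (auto intro: smooth_near_dy)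

lemma near_eq_dy_funpow_dx:
  assumes "smooth_near x0 y0 u"
  shows "near_eq x0 y0 ((dy ^^ n) (dx x0 u)) (dx x0 ((dy ^^ n) u))"
proof (induction n)
  case (Suc n)
  have "near_eq x0 y0 (dy ((dy ^^ n) (dx x0 u))) (dy (dx x0 ((dy ^^ n) u)))"
    using Suc by (rule near_eq_dy)
  also have "near_eq x0 y0 (dy (dx x0 ((dy ^^ n) u))) (dx x0 (dy ((dy ^^ n) u)))"
    by (rule near_eq_sym[OF near_eq_dx_dy[OF smooth_near_dy_funpow[OF assms]]])
  finally show ?case by simp
qed simp

lemma near_eq_dy_funpow_dx_funpow:
  assumes "smooth_near x0 y0 u"
  shows "near_eq x0 y0 ((dy ^^ n) ((dx x0 ^^ m) u)) ((dx x0 ^^ m) ((dy ^^ n) u))"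
proof (induction m)
  case (Suc m)
  have "near_eq x0 y0 ((dy ^^ n) (dx x0 ((dx x0 ^^ m) u))) (dx x0 ((dy ^^ n) ((dx x0 ^^ m) u)))"
    by (rule near_eq_dy_funpow_dx[OF smooth_near_dx_funpow[OF assms]])
  also have "near_eq x0 y0 \<dots> (dx x0 ((dx x0 ^^ m) ((dy ^^ n) u)))"
    using Suc by (rule near_eq_dx)
  finally show ?case by simp
qed simp

lemma pderiv_at_dx:
  assumes "smooth_near x0 y0 u"
  shows "pderiv_at x0 y0 m n (dx x0 u) = pderiv_at x0 y0 (Suc m) n u"
proof -
  have "near_eq x0 y0 ((dx x0 ^^ m) ((dy ^^ n) (dx x0 u))) ((dx x0 ^^ m) (dx x0 ((dy ^^ n) u)))"
    by (intro near_eq_dx_funpow near_eq_dy_funpow_dx assms)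
  thus ?thesis
    unfolding pderiv_at_def by (simp add: near_eq_at_base funpow_swap1)
qed

lemma pderiv_at_dy: "pderiv_at x0 y0 m n (dy u) = pderiv_at x0 y0 m (Suc n) u"
  by (simp add: pderiv_at_def funpow_swap1)

lemma pderiv_at_0_0 [simp]: "pderiv_at x0 y0 0 0 u = u x0 y0"
  by (simp add: pderiv_at_def)

lemma pderiv_at_add:
  assumes "smooth_near x0 y0 u" "smooth_near x0 y0 v"
  shows "pderiv_at x0 y0 m n (\<lambda>x y. u x y + v x y) = pderiv_at x0 y0 m n u + pderiv_at x0 y0 m n v"
  using assms
proof (induction n arbitrary: u v)
  case 0
  thus ?case
  proof (induction m arbitrary: u v)
    case (Suc m)
    show ?case
      using Suc.IH[of "dx x0 u" "dx x0 v"] Suc.prems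
      by (simp add: smooth_near_dx smooth_near_add pderiv_at_cong[OF near_eq_dx_add]
          flip: pderiv_at_dx)
  qed simp
next
  case (Suc n)
  show ?case
    using Suc.IH[of "dy u" "dy v"] Suc.prems
    by (simp add: smooth_near_dy pderiv_at_cong[OF near_eq_dy_add] flip: pderiv_at_dy)
qed

lemma pderiv_at_const: "pderiv_at x0 y0 m n (\<lambda>x y. c) = (if m = 0 \<and> n = 0 then c else 0)"
proof (induction n arbitrary: c)
  case 0
  show ?case
  proof (induction m arbitrary: c)
    case (Suc m)
    have "near_eq x0 y0 (dx x0 (\<lambda>x y. c)) (\<lambda>x y. 0)"
      by (rule near_eqI[of 1]) (auto intro: dx_eqI[OF _ DERIV_const] simp: half_box_iff)
    thus ?case
      using Suc[of 0] by (simp add: pderiv_at_cong flip: pderiv_at_dx)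
  qed simp
next
  case (Suc n)
  have "dy (\<lambda>x y. c) = (\<lambda>x y. 0)" by (simp add: dy_def)
  thus ?case using Suc[of 0] by (simp flip: pderiv_at_dy)
qed

lemma pderiv_at_cmult:
  assumes "smooth_near x0 y0 u"
  shows "pderiv_at x0 y0 m n (\<lambda>x y. c * u x y) = c * pderiv_at x0 y0 m n u"
  using assms
proof (induction n arbitrary: u)
  case 0
  thus ?case
  proof (induction m arbitrary: u)
    case (Suc m)
    have "near_eq x0 y0 (dx x0 (\<lambda>x y. c)) (\<lambda>x y. 0)"
      by (rule near_eqI[of 1]) (auto intro: dx_eqI[OF _ DERIV_const] simp: half_box_iff)
    hence "near_eq x0 y0 (\<lambda>x y. dx x0 (\<lambda>x y. c) x y * u x y + c * dx x0 u x y) (\<lambda>x y. c * dx x0 u x y)"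
      by (elim near_eqE, intro near_eqI) auto
    with near_eq_dx_mult[of x0 y0 "\<lambda>x y. c" u] Suc.prems
    have "near_eq x0 y0 (dx x0 (\<lambda>x y. c * u x y)) (\<lambda>x y. c * dx x0 u x y)"
      by (auto intro: near_eq_trans)
    thus ?case
      using Suc.IH[of "dx x0 u"] Suc.prems
      by (simp add: smooth_near_dx smooth_near_cmult pderiv_at_cong flip: pderiv_at_dx)
  qed simp
next
  case (Suc n)
  have "dy (\<lambda>x y. c) = (\<lambda>x y. 0)" by (simp add: dy_def)
  with near_eq_dy_mult[of x0 y0 "\<lambda>x y. c" u] Suc.prems
  have "near_eq x0 y0 (dy (\<lambda>x y. c * u x y)) (\<lambda>x y. c * dy u x y)"
    by simp
  thus ?case
    using Suc.IH[of "dy u"] Suc.prems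
    by (simp add: smooth_near_dy pderiv_at_cong flip: pderiv_at_dy)
qed

lemma pderiv_at_sum:
  "(\<And>i. i \<in> I \<Longrightarrow> smooth_near x0 y0 (u i)) \<Longrightarrow>
   pderiv_at x0 y0 m n (\<lambda>x y. \<Sum>i\<in>I. u i x y) = (\<Sum>i\<in>I. pderiv_at x0 y0 m n (u i))"
  by (induction I rule: infinite_finite_induct)
     (auto simp: pderiv_at_const pderiv_at_add smooth_near_sum)

section \<open>Polynomials with prescribed jets\<close>

text \<open>
  Polynomials realise every prescribed finite jet.  They are the test functions by which the
  coefficients of a representation are identified.
\<close>

definition taylor_mono :: "real \<Rightarrow> real \<Rightarrow> nat \<Rightarrow> nat \<Rightarrow> real \<Rightarrow> real \<Rightarrow> real" where
  "taylor_mono x0 y0 i j = (\<lambda>x y. (x - x0) ^ i / fact i * ((y - y0) ^ j / fact j))"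

lemma taylor_factor_derivative:
  "((\<lambda>t. (t - c) ^ Suc i / fact (Suc i)) has_real_derivative (x - c) ^ i / fact i) (at x within S)"
proof -
  have "((\<lambda>t. (t - c) ^ Suc i) has_real_derivative (1 + real i) * (1 * (x - c) ^ i)) (at x within S)"
    by (rule DERIV_power_Suc) (auto intro!: derivative_eq_intros)
  moreover have "1 + real i \<noteq> 0" by linarith
  ultimately show ?thesis
    using DERIV_cdivide[of "\<lambda>t. (t - c) ^ Suc i" _ x S "fact (Suc i)"] by fastforce
qed

lemma dx_taylor_mono_0: "x0 \<le> x \<Longrightarrow> dx x0 (taylor_mono x0 y0 0 j) x y = 0"
  by (rule dx_eqI) (simp_all add: taylor_mono_def)

lemma dx_taylor_mono_Suc:
  assumes "x0 \<le> x"
  shows "dx x0 (taylor_mono x0 y0 (Suc i) j) x y = taylor_mono x0 y0 i j x y"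
proof (rule dx_eqI[OF assms])
  from DERIV_cmult_right[OF taylor_factor_derivative[of x0 i x "{x0..}"], of "(y - y0) ^ j / fact j"]
  show "((\<lambda>t. taylor_mono x0 y0 (Suc i) j t y) has_real_derivative taylor_mono x0 y0 i j x y)
      (at x within {x0..})"
    by (simp add: taylor_mono_def)
qed

lemma dy_taylor_mono_0: "dy (taylor_mono x0 y0 i 0) = (\<lambda>x y. 0)"
  by (intro ext dy_eqI) (simp add: taylor_mono_def)

lemma dy_taylor_mono_Suc: "dy (taylor_mono x0 y0 i (Suc j)) = taylor_mono x0 y0 i j"
proof (intro ext dy_eqI)
  fix x y
  from DERIV_cmult[OF taylor_factor_derivative, of "(x - x0) ^ i / fact i"]
  show "(taylor_mono x0 y0 i (Suc j) x has_real_derivative taylor_mono x0 y0 i j x y) (at y)"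
    by (simp add: taylor_mono_def)
qed

lemma Ck_on_taylor_mono: "Ck_on x0 (half_box x0 y0 1) k (taylor_mono x0 y0 i j)"
proof (induction k arbitrary: i j)
  case 0
  show ?case by (auto simp: taylor_mono_def case_prod_unfold intro!: continuous_intros)
next
  case (Suc k)
  show ?case
  proof (rule Ck_on_SucI)
    show "continuous_on (half_box x0 y0 1) (\<lambda>(x, y). taylor_mono x0 y0 i j x y)"
      by (auto simp: taylor_mono_def case_prod_unfold intro!: continuous_intros)
    show "(\<lambda>t. taylor_mono x0 y0 i j t y) differentiable (at x within {x0..})" for x y
      by (auto simp: taylor_mono_def intro!: derivative_intros)
    show "taylor_mono x0 y0 i j x differentiable (at y)" for x y
      by (auto simp: taylor_mono_def intro!: derivative_intros)
    show "Ck_on x0 (half_box x0 y0 1) k (dx x0 (taylor_mono x0 y0 i j))"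
    proof (cases i)
      case 0
      show ?thesis unfolding 0
        by (rule Ck_on_cong_box[OF _ Ck_on_const[of _ _ _ _ 0]])
          (simp add: half_box_iff dx_taylor_mono_0)
    next
      case (Suc i')
      show ?thesis unfolding Suc
        by (rule Ck_on_cong_box[OF _ Suc.IH[of i' j]]) (simp add: half_box_iff dx_taylor_mono_Suc)
    qed
    show "Ck_on x0 (half_box x0 y0 1) k (dy (taylor_mono x0 y0 i j))"
      using Suc.IH by (cases j) (simp_all add: dy_taylor_mono_0 dy_taylor_mono_Suc Ck_on_const)
  qed
qed

lemma smooth_near_taylor_mono [simp]: "smooth_near x0 y0 (taylor_mono x0 y0 i j)"
  by (rule smooth_nearI[OF zero_less_one Ck_on_taylor_mono])

lemma pderiv_at_taylor_mono:
  "pderiv_at x0 y0 m n (taylor_mono x0 y0 i j) = (if m = i \<and> n = j then 1 else 0)"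
proof (induction n arbitrary: j)
  case 0
  show ?case
  proof (induction m arbitrary: i)
    case 0
    show ?case by (cases i; cases j) (simp_all add: taylor_mono_def)
  next
    case (Suc m)
    show ?case
    proof (cases i)
      case 0
      thus ?thesis
        using pderiv_at_cong[OF near_eqI[OF zero_less_one, of x0 y0 "dx x0 (taylor_mono x0 y0 0 j)" "\<lambda>x y. 0"], of m 0]
          dx_taylor_mono_0
        by (simp add: pderiv_at_const half_box_iff flip: pderiv_at_dx)
    next
      case (Suc i')
      thus ?thesis
        using pderiv_at_cong[OF near_eqI[OF zero_less_one,
              of x0 y0 "dx x0 (taylor_mono x0 y0 (Suc i') j)" "taylor_mono x0 y0 i' j"], of m 0]
          dx_taylor_mono_Suc Suc.IH[of i']
        by (simp add: half_box_iff flip: pderiv_at_dx)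
    qed
  qed
next
  case (Suc n)
  show ?case
    by (cases j)
      (simp_all add: Suc.IH dy_taylor_mono_0 dy_taylor_mono_Suc pderiv_at_const flip: pderiv_at_dy)
qed

lemma finite_Lam [simp, intro]: "finite (Lam N)"
  by (rule finite_subset[of _ "{..N} \<times> {..N}"]) (auto simp: Lam_def)

lemma Lam_iff [simp]: "(m, n) \<in> Lam N \<longleftrightarrow> m + n \<le> N"
  by (simp add: Lam_def)

lemma LamV1_iff [simp]: "(m, n) \<in> LamV1 N \<longleftrightarrow> m + n \<le> N \<and> (m = 0 \<or> m = 1)"
  by (auto simp: LamV1_def)

lemma LamV2_iff [simp]: "(m, n) \<in> LamV2 N \<longleftrightarrow> m + n \<le> N \<and> 2 \<le> m"
  by (auto simp: LamV2_def)

lemma finite_LamV1 [simp, intro]: "finite (LamV1 N)"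
  by (rule finite_subset[OF _ finite_Lam[of N]]) (auto simp: LamV1_def)

lemma finite_LamV2 [simp, intro]: "finite (LamV2 N)"
  by (simp add: LamV2_def)

definition jet_poly :: "real \<Rightarrow> real \<Rightarrow> nat \<Rightarrow> (nat \<Rightarrow> nat \<Rightarrow> real) \<Rightarrow> real \<Rightarrow> real \<Rightarrow> real" where
  "jet_poly x0 y0 N U = (\<lambda>x y. \<Sum>p\<in>Lam N. U (fst p) (snd p) * taylor_mono x0 y0 (fst p) (snd p) x y)"

lemma smooth_near_jet_poly [simp]: "smooth_near x0 y0 (jet_poly x0 y0 N U)"
  unfolding jet_poly_def by (intro smooth_near_sum smooth_near_cmult) auto

lemma pderiv_at_jet_poly:
  "pderiv_at x0 y0 m n (jet_poly x0 y0 N U) = (if m + n \<le> N then U m n else 0)"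
proof -
  have "pderiv_at x0 y0 m n (jet_poly x0 y0 N U) =
      (\<Sum>p\<in>Lam N. U (fst p) (snd p) * (if m = fst p \<and> n = snd p then 1 else 0))"
    unfolding jet_poly_def
    by (subst pderiv_at_sum)
      (auto intro!: sum.cong smooth_near_cmult simp: pderiv_at_cmult pderiv_at_taylor_mono)
  also have "\<dots> = (\<Sum>p\<in>Lam N. if p = (m, n) then U m n else 0)"
    by (intro sum.cong) auto
  finally show ?thesis by simp
qed

section \<open>Spans of functionals on germs\<close>

text \<open>
  Statements such as ``a linear combination of derivatives of order less than \<open>K\<close>, with
  coefficients that do not depend on \<open>u\<close>'' are all that is needed of the lower order terms in the
  Leibniz rule.  Keeping the coefficients existentially quantified avoids writing them down.
\<close>

definition spanned ::
  "real \<Rightarrow> real \<Rightarrow> 'i set \<Rightarrow> ('i \<Rightarrow> (real \<Rightarrow> real \<Rightarrow> real) \<Rightarrow> real) \<Rightarrow>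
   ((real \<Rightarrow> real \<Rightarrow> real) \<Rightarrow> real) \<Rightarrow> bool" where
  "spanned x0 y0 I \<phi> L \<longleftrightarrow>
     (\<exists>\<kappa>. \<forall>u. smooth_near x0 y0 u \<longrightarrow> L u = (\<Sum>i\<in>I. \<kappa> i * \<phi> i u))"

lemma spannedI:
  "(\<And>u. smooth_near x0 y0 u \<Longrightarrow> L u = (\<Sum>i\<in>I. \<kappa> i * \<phi> i u)) \<Longrightarrow> spanned x0 y0 I \<phi> L"
  by (auto simp: spanned_def)

lemma spannedE:
  assumes "spanned x0 y0 I \<phi> L"
  obtains \<kappa> where "\<And>u. smooth_near x0 y0 u \<Longrightarrow> L u = (\<Sum>i\<in>I. \<kappa> i * \<phi> i u)"
  using assms by (auto simp: spanned_def)

lemma spanned_cong: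
  assumes "spanned x0 y0 I \<phi> L" "\<And>u. smooth_near x0 y0 u \<Longrightarrow> L' u = L u"
  shows "spanned x0 y0 I \<phi> L'"
  using assms by (auto simp: spanned_def)

lemma spanned_zero: "spanned x0 y0 I \<phi> (\<lambda>u. 0)"
  by (rule spannedI[where \<kappa> = "\<lambda>_. 0"]) simp

lemma spanned_add:
  assumes "spanned x0 y0 I \<phi> L" "spanned x0 y0 I \<phi> L'"
  shows "spanned x0 y0 I \<phi> (\<lambda>u. L u + L' u)"
proof -
  obtain \<kappa> \<kappa>' where "\<And>u. smooth_near x0 y0 u \<Longrightarrow> L u = (\<Sum>i\<in>I. \<kappa> i * \<phi> i u)"
    "\<And>u. smooth_near x0 y0 u \<Longrightarrow> L' u = (\<Sum>i\<in>I. \<kappa>' i * \<phi> i u)"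
    using assms by (metis spannedE)
  thus ?thesis
    by (intro spannedI[where \<kappa> = "\<lambda>i. \<kappa> i + \<kappa>' i"]) (simp add: distrib_right sum.distrib)
qed

lemma spanned_cmult:
  assumes "spanned x0 y0 I \<phi> L"
  shows "spanned x0 y0 I \<phi> (\<lambda>u. c * L u)"
proof -
  obtain \<kappa> where "\<And>u. smooth_near x0 y0 u \<Longrightarrow> L u = (\<Sum>i\<in>I. \<kappa> i * \<phi> i u)"
    using assms by (metis spannedE)
  thus ?thesis
    by (intro spannedI[where \<kappa> = "\<lambda>i. c * \<kappa> i"]) (simp add: sum_distrib_left mult.assoc)
qed

lemma spanned_member:
  assumes "finite I" "i \<in> I"
  shows "spanned x0 y0 I \<phi> (\<phi> i)"
proof (rule spannedI[where \<kappa> = "\<lambda>j. if j = i then 1 else 0"])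
  fix u
  have "(\<Sum>j\<in>I. (if j = i then 1 else 0) * \<phi> j u) = (\<Sum>j\<in>I. if j = i then \<phi> i u else 0)"
    by (intro sum.cong) auto
  thus "\<phi> i u = (\<Sum>j\<in>I. (if j = i then 1 else 0) * \<phi> j u)"
    using assms by simp
qed

lemma spanned_trans:
  assumes "spanned x0 y0 I \<phi> L" "\<And>i. i \<in> I \<Longrightarrow> spanned x0 y0 J \<psi> (\<phi> i)"
  shows "spanned x0 y0 J \<psi> L"
proof -
  obtain \<kappa> where \<kappa>: "\<And>u. smooth_near x0 y0 u \<Longrightarrow> L u = (\<Sum>i\<in>I. \<kappa> i * \<phi> i u)"
    using assms(1) by (metis spannedE)
  have "spanned x0 y0 J \<psi> (\<lambda>u. \<Sum>i\<in>I. \<kappa> i * \<phi> i u)"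
    using assms(2)
  proof (induction I rule: infinite_finite_induct)
    case (insert i F)
    show ?case
      using spanned_add[OF spanned_cmult[OF insert.prems] insert.IH, of i "\<kappa> i"] insert.hyps insert.prems
      by simp
  qed (simp_all add: spanned_zero)
  thus ?thesis by (rule spanned_cong) (rule \<kappa>)
qed

definition jet :: "real \<Rightarrow> real \<Rightarrow> nat \<times> nat \<Rightarrow> (real \<Rightarrow> real \<Rightarrow> real) \<Rightarrow> real" where
  "jet x0 y0 p u = pderiv_at x0 y0 (fst p) (snd p) u"

definition low_orders :: "nat \<Rightarrow> (nat \<times> nat) set" where
  "low_orders K = {(m, n). m + n < K}"

lemma low_orders_iff [simp]: "(m, n) \<in> low_orders K \<longleftrightarrow> m + n < K"
  by (simp add: low_orders_def)

lemma finite_low_orders [simp, intro]: "finite (low_orders K)"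
  by (rule finite_subset[of _ "{..K} \<times> {..K}"]) (auto simp: low_orders_def)

abbreviation below :: "real \<Rightarrow> real \<Rightarrow> nat \<Rightarrow> ((real \<Rightarrow> real \<Rightarrow> real) \<Rightarrow> real) \<Rightarrow> bool" where
  "below x0 y0 K L \<equiv> spanned x0 y0 (low_orders K) (jet x0 y0) L"

lemma below_pderiv_at: "m + n < K \<Longrightarrow> below x0 y0 K (pderiv_at x0 y0 m n)"
  using spanned_member[of "low_orders K" "(m, n)" x0 y0 "jet x0 y0"] by (simp add: jet_def[abs_def])

lemma below_mono: "below x0 y0 K L \<Longrightarrow> K \<le> K' \<Longrightarrow> below x0 y0 K' L"
  by (erule spanned_trans) (rule spanned_member, auto)

lemma below_dx:
  assumes "below x0 y0 K L"
  shows "below x0 y0 (Suc K) (\<lambda>u. L (dx x0 u))"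
proof -
  obtain \<kappa> where \<kappa>: "\<And>u. smooth_near x0 y0 u \<Longrightarrow> L u = (\<Sum>p\<in>low_orders K. \<kappa> p * jet x0 y0 p u)"
    using assms by (metis spannedE)
  have "spanned x0 y0 (low_orders K) (\<lambda>p u. jet x0 y0 p (dx x0 u)) (\<lambda>u. L (dx x0 u))"
    by (rule spannedI[where \<kappa> = \<kappa>]) (simp add: \<kappa> smooth_near_dx)
  thus ?thesis
  proof (rule spanned_trans)
    fix p assume "p \<in> low_orders K"
    hence "below x0 y0 (Suc K) (pderiv_at x0 y0 (Suc (fst p)) (snd p))"
      by (intro below_pderiv_at) (auto simp: low_orders_def)
    thus "below x0 y0 (Suc K) (\<lambda>u. jet x0 y0 p (dx x0 u))"
      by (rule spanned_cong) (simp add: jet_def pderiv_at_dx)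
  qed
qed

lemma below_dy:
  assumes "below x0 y0 K L"
  shows "below x0 y0 (Suc K) (\<lambda>u. L (dy u))"
proof -
  obtain \<kappa> where \<kappa>: "\<And>u. smooth_near x0 y0 u \<Longrightarrow> L u = (\<Sum>p\<in>low_orders K. \<kappa> p * jet x0 y0 p u)"
    using assms by (metis spannedE)
  have "spanned x0 y0 (low_orders K) (\<lambda>p u. jet x0 y0 p (dy u)) (\<lambda>u. L (dy u))"
    by (rule spannedI[where \<kappa> = \<kappa>]) (simp add: \<kappa> smooth_near_dy)
  thus ?thesis
  proof (rule spanned_trans)
    fix p assume "p \<in> low_orders K"
    hence "below x0 y0 (Suc K) (pderiv_at x0 y0 (fst p) (Suc (snd p)))"
      by (intro below_pderiv_at) (auto simp: low_orders_def)
    thus "below x0 y0 (Suc K) (\<lambda>u. jet x0 y0 p (dy u))"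
      by (rule spanned_cong) (simp add: jet_def pderiv_at_dy)
  qed
qed

lemma below_vanish:
  assumes "below x0 y0 K L" "smooth_near x0 y0 u"
    and "\<And>m n. m + n < K \<Longrightarrow> pderiv_at x0 y0 m n u = 0"
  shows "L u = 0"
proof -
  obtain \<kappa> where \<kappa>: "\<And>u. smooth_near x0 y0 u \<Longrightarrow> L u = (\<Sum>p\<in>low_orders K. \<kappa> p * jet x0 y0 p u)"
    using assms(1) by (metis spannedE)
  show ?thesis
    unfolding \<kappa>[OF assms(2)]
    by (rule sum.neutral) (auto simp: jet_def assms(3))
qed

text \<open>
  Leibniz rule modulo lower order: only the term in which no derivative falls on \<open>a\<close> has full
  order in \<open>v\<close>.  The induction moves one derivative into the product; the term with a derivative
  of \<open>a\<close> is then of lower order by the hypothesis for that derivative, hence the generalisation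
  over \<open>a\<close>.
\<close>

lemma below_pderiv_at_mult:
  assumes "smooth_near x0 y0 a"
  shows "below x0 y0 (m + n)
    (\<lambda>v. pderiv_at x0 y0 m n (\<lambda>x y. a x y * v x y) - a x0 y0 * pderiv_at x0 y0 m n v)"
  using assms
proof (induction n arbitrary: a)
  case 0
  thus ?case
  proof (induction m arbitrary: a)
    case 0
    show ?case by (rule spanned_cong[OF spanned_zero]) simp
  next
    case (Suc m)
    let ?D = "\<lambda>a v. pderiv_at x0 y0 m 0 (\<lambda>x y. a x y * v x y) - a x0 y0 * pderiv_at x0 y0 m 0 v"
    have "below x0 y0 (Suc m) (\<lambda>v. (?D (dx x0 a) v + dx x0 a x0 y0 * pderiv_at x0 y0 m 0 v) +
        ?D a (dx x0 v))"
      using Suc.IH[OF smooth_near_dx[OF Suc.prems]] below_dx[OF Suc.IH[OF Suc.prems]]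
      by (intro spanned_add spanned_cmult below_pderiv_at) (auto elim: below_mono)
    thus ?case
    proof (simp only: add_Suc add_0_right, elim spanned_cong)
      fix v assume v: "smooth_near x0 y0 v"
      have "pderiv_at x0 y0 (Suc m) 0 (\<lambda>x y. a x y * v x y) =
          pderiv_at x0 y0 m 0 (\<lambda>x y. dx x0 a x y * v x y + a x y * dx x0 v x y)"
        by (simp add: pderiv_at_cong[OF near_eq_dx_mult] Suc.prems v smooth_near_mult
            flip: pderiv_at_dx)
      also have "\<dots> = pderiv_at x0 y0 m 0 (\<lambda>x y. dx x0 a x y * v x y) +
          pderiv_at x0 y0 m 0 (\<lambda>x y. a x y * dx x0 v x y)"
        using Suc.prems v by (intro pderiv_at_add smooth_near_mult smooth_near_dx)
      finally show "pderiv_at x0 y0 (Suc m) 0 (\<lambda>x y. a x y * v x y) -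
          a x0 y0 * pderiv_at x0 y0 (Suc m) 0 v =
          (?D (dx x0 a) v + dx x0 a x0 y0 * pderiv_at x0 y0 m 0 v) + ?D a (dx x0 v)"
        by (simp add: pderiv_at_dx v)
    qed
  qed
next
  case (Suc n)
  let ?D = "\<lambda>a v. pderiv_at x0 y0 m n (\<lambda>x y. a x y * v x y) - a x0 y0 * pderiv_at x0 y0 m n v"
  have "below x0 y0 (Suc (m + n)) (\<lambda>v. (?D (dy a) v + dy a x0 y0 * pderiv_at x0 y0 m n v) +
      ?D a (dy v))"
    using Suc.IH[OF smooth_near_dy[OF Suc.prems]] below_dy[OF Suc.IH[OF Suc.prems]]
    by (intro spanned_add spanned_cmult below_pderiv_at) (auto elim: below_mono)
  thus ?case
  proof (simp only: add_Suc_right, elim spanned_cong)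
    fix v assume v: "smooth_near x0 y0 v"
    have "pderiv_at x0 y0 m (Suc n) (\<lambda>x y. a x y * v x y) =
        pderiv_at x0 y0 m n (\<lambda>x y. dy a x y * v x y + a x y * dy v x y)"
      by (simp add: pderiv_at_cong[OF near_eq_dy_mult] Suc.prems v flip: pderiv_at_dy)
    also have "\<dots> = pderiv_at x0 y0 m n (\<lambda>x y. dy a x y * v x y) +
        pderiv_at x0 y0 m n (\<lambda>x y. a x y * dy v x y)"
      using Suc.prems v by (intro pderiv_at_add smooth_near_mult smooth_near_dy)
    finally show "pderiv_at x0 y0 m (Suc n) (\<lambda>x y. a x y * v x y) -
        a x0 y0 * pderiv_at x0 y0 m (Suc n) v =
        (?D (dy a) v + dy a x0 y0 * pderiv_at x0 y0 m n v) + ?D a (dy v)"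
      by (simp add: pderiv_at_dy)
  qed
qed

section \<open>Jets of the source term\<close>

lemma pderiv_at_source:
  assumes "smooth_near x0 y0 a" "smooth_near x0 y0 u"
  shows "pderiv_at x0 y0 m n (source x0 a u) =
    - (pderiv_at x0 y0 (Suc m) n (\<lambda>x y. a x y * dx x0 u x y) +
       pderiv_at x0 y0 m (Suc n) (\<lambda>x y. a x y * dy u x y))"
proof -
  let ?F = "\<lambda>x y. a x y * dx x0 u x y" and ?G = "\<lambda>x y. a x y * dy u x y"
  have s: "smooth_near x0 y0 ?F" "smooth_near x0 y0 ?G"
    using assms by (auto intro: smooth_near_mult smooth_near_dx smooth_near_dy)
  have "source x0 a u = (\<lambda>x y. -1 * (dx x0 ?F x y + dy ?G x y))"
    by (simp add: source_def)
  hence "pderiv_at x0 y0 m n (source x0 a u) =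
      - 1 * (pderiv_at x0 y0 m n (dx x0 ?F) + pderiv_at x0 y0 m n (dy ?G))"
    using s
    by (simp only: pderiv_at_cmult pderiv_at_add smooth_near_add smooth_near_dx smooth_near_dy)
  thus ?thesis
    using s by (simp add: pderiv_at_dx pderiv_at_dy)
qed

text \<open>
  The principal part of \<open>f\<close> is \<open>-a \<Delta>u\<close> with \<open>a\<close> frozen at the base point.
\<close>

lemma below_source:
  assumes "smooth_near x0 y0 a"
  shows "below x0 y0 (m + n + 2)
    (\<lambda>u. pderiv_at x0 y0 m n (source x0 a u) +
         a x0 y0 * (pderiv_at x0 y0 (m + 2) n u + pderiv_at x0 y0 m (n + 2) u))"
proof -
  let ?D = "\<lambda>m n v. pderiv_at x0 y0 m n (\<lambda>x y. a x y * v x y) - a x0 y0 * pderiv_at x0 y0 m n v"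
  have "below x0 y0 (m + n + 2) (\<lambda>u. (-1) * (?D (Suc m) n (dx x0 u) + ?D m (Suc n) (dy u)))"
    using below_dx[OF below_pderiv_at_mult[OF assms, of "Suc m" n]]
      below_dy[OF below_pderiv_at_mult[OF assms, of m "Suc n"]]
    by (intro spanned_cmult spanned_add) (simp_all add: numeral_2_eq_2)
  thus ?thesis
    by (rule spanned_cong)
      (simp add: pderiv_at_source assms pderiv_at_dx pderiv_at_dy numeral_2_eq_2 algebra_simps)
qed

lemma pderiv_at_source_leading:
  assumes "smooth_near x0 y0 a" "smooth_near x0 y0 u"
    and "\<And>i j. i + j < m + n + 2 \<Longrightarrow> pderiv_at x0 y0 i j u = 0"
  shows "pderiv_at x0 y0 m n (source x0 a u) =
    - a x0 y0 * (pderiv_at x0 y0 (m + 2) n u + pderiv_at x0 y0 m (n + 2) u)"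
  using below_vanish[OF below_source[OF assms(1), of m n] assms(2,3)] by (simp add: algebra_simps)

text \<open>
  Expanded form \<open>f = -(a \<Delta>u + a\<^sub>x u\<^sub>x + a\<^sub>y u\<^sub>y)\<close>: where the jets of \<open>\<Delta>u\<close> and of the gradient
  start late enough, the three coefficients may be frozen, which is one order more precise than
  freezing \<open>a\<close> in the divergence form.
\<close>

lemma pderiv_at_source_second:
  assumes a: "smooth_near x0 y0 a" and u: "smooth_near x0 y0 u"
    and lap: "\<And>i j. i + j < m + n \<Longrightarrow> pderiv_at x0 y0 (i + 2) j u + pderiv_at x0 y0 i (j + 2) u = 0"
    and low: "\<And>i j. i + j < m + n + 1 \<Longrightarrow> pderiv_at x0 y0 i j u = 0"
  shows "pderiv_at x0 y0 m n (source x0 a u) =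
    - (a x0 y0 * (pderiv_at x0 y0 (m + 2) n u + pderiv_at x0 y0 m (n + 2) u) +
       dx x0 a x0 y0 * pderiv_at x0 y0 (m + 1) n u + dy a x0 y0 * pderiv_at x0 y0 m (n + 1) u)"
proof -
  let ?ux = "dx x0 u" and ?uy = "dy u"
  let ?L = "\<lambda>x y. dx x0 ?ux x y + dy ?uy x y"
  note s = smooth_near_dx[OF u] smooth_near_dy[OF u] smooth_near_dx[OF a] smooth_near_dy[OF a]
    smooth_near_dx[OF smooth_near_dx[OF u]] smooth_near_dy[OF smooth_near_dy[OF u]]
  have jL: "pderiv_at x0 y0 i j ?L = pderiv_at x0 y0 (i + 2) j u + pderiv_at x0 y0 i (j + 2) u" for i j
    by (simp add: pderiv_at_add pderiv_at_dx pderiv_at_dy s u numeral_2_eq_2)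
  have "pderiv_at x0 y0 m n (source x0 a u) =
    - (pderiv_at x0 y0 m n (\<lambda>x y. dx x0 a x y * ?ux x y + a x y * dx x0 ?ux x y) +
       pderiv_at x0 y0 m n (\<lambda>x y. dy a x y * ?uy x y + a x y * dy ?uy x y))"
    by (simp add: pderiv_at_source a u pderiv_at_cong[OF near_eq_dx_mult]
        pderiv_at_cong[OF near_eq_dy_mult] s smooth_near_mult flip: pderiv_at_dx pderiv_at_dy)
  also have "\<dots> = - (pderiv_at x0 y0 m n (\<lambda>x y. a x y * ?L x y) +
      pderiv_at x0 y0 m n (\<lambda>x y. dx x0 a x y * ?ux x y) +
      pderiv_at x0 y0 m n (\<lambda>x y. dy a x y * ?uy x y))"
    by (simp add: distrib_left pderiv_at_add a s smooth_near_mult)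
  also have "pderiv_at x0 y0 m n (\<lambda>x y. a x y * ?L x y) = a x0 y0 * pderiv_at x0 y0 m n ?L"
    using below_vanish[OF below_pderiv_at_mult[OF a] smooth_near_add[OF s(5,6)], of m n] lap
    by (simp add: jL)
  also have "pderiv_at x0 y0 m n (\<lambda>x y. dx x0 a x y * ?ux x y) =
      dx x0 a x0 y0 * pderiv_at x0 y0 m n ?ux"
    using below_vanish[OF below_pderiv_at_mult[OF s(3)] s(1), of m n] low
    by (simp add: pderiv_at_dx u)
  also have "pderiv_at x0 y0 m n (\<lambda>x y. dy a x y * ?uy x y) =
      dy a x0 y0 * pderiv_at x0 y0 m n ?uy"
    using below_vanish[OF below_pderiv_at_mult[OF s(4)] s(2), of m n] low
    by (simp add: pderiv_at_dy)
  finally show ?thesis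
    by (simp add: jL pderiv_at_dx pderiv_at_dy u)
qed

section \<open>Solving the equation for the higher normal derivatives\<close>

text \<open>
  The two families of functionals in a representation, tagged by \<open>Inl\<close> for derivatives of \<open>u\<close> and
  \<open>Inr\<close> for derivatives of the source.
\<close>

definition rep_index :: "nat \<Rightarrow> (nat \<times> nat + nat \<times> nat) set" where
  "rep_index N = Inl ` LamV1 N \<union> Inr ` Lam (N - 2)"

definition rep_functional ::
  "real \<Rightarrow> real \<Rightarrow> (real \<Rightarrow> real \<Rightarrow> real) \<Rightarrow> nat \<times> nat + nat \<times> nat \<Rightarrow> (real \<Rightarrow> real \<Rightarrow> real) \<Rightarrow> real" where
  "rep_functional x0 y0 a i u = (case i of Inl p \<Rightarrow> jet x0 y0 p u | Inr p \<Rightarrow> jet x0 y0 p (source x0 a u))"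

lemma finite_rep_index [simp]: "finite (rep_index N)"
  by (simp add: rep_index_def)

text \<open>
  The principal part of the equation trades two normal derivatives for two tangential ones at the
  price of a derivative of \<open>f\<close> and of lower order terms.  So induct on the order, and for a fixed
  order on the number of normal derivatives.
\<close>

lemma pderiv_at_spanned:
  assumes a: "smooth_near x0 y0 a" "a x0 y0 \<noteq> 0"
  shows "m + n \<le> N \<Longrightarrow> spanned x0 y0 (rep_index N) (rep_functional x0 y0 a) (pderiv_at x0 y0 m n)"
proof (induction "m + n" arbitrary: m n rule: less_induct)
  case (less m n)
  note lower = less.hyps and order_le = less.prems
  define K where "K = m + n"
  have "m + n = K \<Longrightarrow> spanned x0 y0 (rep_index N) (rep_functional x0 y0 a) (pderiv_at x0 y0 m n)"
  proof (induction m arbitrary: n rule: less_induct)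
    case (less m)
    have K: "K \<le> N" using order_le by (simp add: K_def)
    show ?case
    proof (cases "m < 2")
      case True
      have "spanned x0 y0 (rep_index N) (rep_functional x0 y0 a) (rep_functional x0 y0 a (Inl (m, n)))"
        using less.prems K True by (intro spanned_member) (auto simp: rep_index_def intro!: imageI)
      thus ?thesis by (rule spanned_cong) (simp add: rep_functional_def jet_def)
    next
      case False
      define k where "k = m - 2"
      have m: "m = k + 2" using False by (simp add: k_def)
      let ?S = "spanned x0 y0 (rep_index N) (rep_functional x0 y0 a)"
      let ?R = "\<lambda>u. pderiv_at x0 y0 k n (source x0 a u) +
         a x0 y0 * (pderiv_at x0 y0 (k + 2) n u + pderiv_at x0 y0 k (n + 2) u)"
      have R: "?S ?R"
        by (rule spanned_trans[OF below_source[OF a(1)]])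
          (use lower less.prems K in \<open>auto simp: jet_def[abs_def] m K_def[symmetric]\<close>)
      have f: "?S (\<lambda>u. pderiv_at x0 y0 k n (source x0 a u))"
      proof -
        have "?S (rep_functional x0 y0 a (Inr (k, n)))"
          using less.prems K m by (intro spanned_member) (auto simp: rep_index_def)
        thus ?thesis by (rule spanned_cong) (simp add: rep_functional_def jet_def)
      qed
      have y: "?S (pderiv_at x0 y0 k (n + 2))"
        using less.prems m by (intro less.IH) auto
      have "?S (\<lambda>u. (1 / a x0 y0) * (?R u + (-1) * pderiv_at x0 y0 k n (source x0 a u)) +
          (-1) * pderiv_at x0 y0 k (n + 2) u)"
        by (intro spanned_add spanned_cmult R f y)
      thus ?thesis
        by (rule spanned_cong) (use a(2) m in \<open>simp add: field_simps\<close>)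
    qed
  qed
  thus ?case by (simp add: K_def)
qed

lemma is_representation_exists:
  assumes a: "smooth_near x0 y0 a" "a x0 y0 \<noteq> 0"
  shows "is_representation x0 y0 a m n (AVu x0 y0 a m n) (AVf x0 y0 a m n)"
proof -
  obtain \<kappa> where \<kappa>: "\<And>u. smooth_near x0 y0 u \<Longrightarrow>
      pderiv_at x0 y0 m n u = (\<Sum>i\<in>rep_index (m + n). \<kappa> i * rep_functional x0 y0 a i u)"
    using pderiv_at_spanned[OF a order.refl, of m n] by (metis spannedE)
  have "is_representation x0 y0 a m n (\<lambda>i j. \<kappa> (Inl (i, j))) (\<lambda>i j. \<kappa> (Inr (i, j)))"
    unfolding is_representation_def
  proof (intro allI impI)
    fix u assume u: "smooth_near x0 y0 u"
    have "pderiv_at x0 y0 m n u = (\<Sum>i\<in>Inl ` LamV1 (m + n). \<kappa> i * rep_functional x0 y0 a i u) +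
        (\<Sum>i\<in>Inr ` Lam (m + n - 2). \<kappa> i * rep_functional x0 y0 a i u)"
      unfolding \<kappa>[OF u] rep_index_def by (rule sum.union_disjoint) auto
    thus "pderiv_at x0 y0 m n u =
        (\<Sum>(i, j)\<in>LamV1 (m + n). \<kappa> (Inl (i, j)) * pderiv_at x0 y0 i j u) +
        (\<Sum>(i, j)\<in>Lam (m + n - 2). \<kappa> (Inr (i, j)) * pderiv_at x0 y0 i j (source x0 a u))"
      by (simp add: sum.reindex rep_functional_def jet_def case_prod_unfold)
  qed
  hence "is_representation x0 y0 a m n
      (fst ((\<lambda>i j. \<kappa> (Inl (i, j))), (\<lambda>i j. \<kappa> (Inr (i, j)))))
      (snd ((\<lambda>i j. \<kappa> (Inl (i, j))), (\<lambda>i j. \<kappa> (Inr (i, j)))))"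
    by simp
  thus ?thesis
    unfolding AVu_def AVf_def AV_def by (rule someI)
qed

lemma pderiv_at_representation:
  assumes "smooth_near x0 y0 a" "a x0 y0 \<noteq> 0" "smooth_near x0 y0 u"
  shows "pderiv_at x0 y0 m' n' u =
    (\<Sum>(m, n)\<in>LamV1 (m' + n'). AVu x0 y0 a m' n' m n * pderiv_at x0 y0 m n u) +
    (\<Sum>(m, n)\<in>Lam (m' + n' - 2). AVf x0 y0 a m' n' m n * pderiv_at x0 y0 m n (source x0 a u))"
  using is_representation_exists[OF assms(1,2), of m' n'] assms(3)
  by (auto simp: is_representation_def)

lemma pderiv_at_source_taylor_mono:
  assumes "smooth_near x0 y0 a" "m + n + 2 \<le> i + j"
  shows "pderiv_at x0 y0 m n (source x0 a (taylor_mono x0 y0 i j)) =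
    - a x0 y0 * (of_bool (m + 2 = i \<and> n = j) + of_bool (m = i \<and> n + 2 = j))"
  using assms
  by (subst pderiv_at_source_leading) (auto simp: pderiv_at_taylor_mono)

lemma sum_delta_pair:
  assumes "finite A"
  shows "(\<Sum>(m, n)\<in>A. F m n * of_bool (m = i \<and> n = j)) = (if (i, j) \<in> A then F i j else (0::real))"
proof -
  have "(\<Sum>(m, n)\<in>A. F m n * of_bool (m = i \<and> n = j)) = (\<Sum>p\<in>A. if p = (i, j) then F i j else 0)"
    by (intro sum.cong) auto
  thus ?thesis using assms by simp
qed

text \<open>
  The coefficients \<open>AVu\<close> and \<open>AVf\<close> are some choice of coefficients of a representation.  To
  identify those of top order, test it on the monomials of degree \<open>N = m' + n'\<close>: on them all
  lower derivatives vanish, and the derivatives of \<open>f\<close> see only the frozen principal part.  Each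
  monomial gives one equation, which links \<open>AVf\<close> at \<open>p - 2\<close> and \<open>p\<close> normal derivatives.
\<close>

lemma AV_recursion:
  assumes a: "smooth_near x0 y0 a" "a x0 y0 \<noteq> 0" and N: "m' + n' = N" "2 \<le> N" and p: "p \<le> N"
  shows "of_bool (m' = p) = (if p < 2 then AVu x0 y0 a m' n' p (N - p) else 0) -
    a x0 y0 * ((if 2 \<le> p then AVf x0 y0 a m' n' (p - 2) (N - p) else 0) +
               (if p + 2 \<le> N then AVf x0 y0 a m' n' p (N - p - 2) else 0))"
proof -
  let ?Au = "AVu x0 y0 a m' n'" and ?Af = "AVf x0 y0 a m' n'"
  have "(\<Sum>(m, n)\<in>LamV1 N. ?Au m n * pderiv_at x0 y0 m n (taylor_mono x0 y0 p (N - p))) =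
      (\<Sum>(m, n)\<in>LamV1 N. ?Au m n * of_bool (m = p \<and> n = N - p))"
    by (intro sum.cong) (auto simp: pderiv_at_taylor_mono)
  also have "\<dots> = (if p < 2 then ?Au p (N - p) else 0)"
    using p by (subst sum_delta_pair) auto
  finally have 1: "(\<Sum>(m, n)\<in>LamV1 N. ?Au m n * pderiv_at x0 y0 m n (taylor_mono x0 y0 p (N - p))) =
      (if p < 2 then ?Au p (N - p) else 0)" .
  have "(\<Sum>(m, n)\<in>Lam (N - 2).
        ?Af m n * pderiv_at x0 y0 m n (source x0 a (taylor_mono x0 y0 p (N - p)))) =
      (\<Sum>q\<in>Lam (N - 2). - a x0 y0 * (of_bool (2 \<le> p) *
         (case q of (m, n) \<Rightarrow> ?Af m n * of_bool (m = p - 2 \<and> n = N - p)) +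
        of_bool (p + 2 \<le> N) * (case q of (m, n) \<Rightarrow> ?Af m n * of_bool (m = p \<and> n = N - p - 2))))"
  proof (intro sum.cong refl, clarify, goal_cases)
    case (1 m n)
    hence "m + n + 2 \<le> p + (N - p)" using p N by simp
    note source = pderiv_at_source_taylor_mono[OF a(1) this]
    have "of_bool (m + 2 = p \<and> n = N - p) = of_bool (2 \<le> p) * (of_bool (m = p - 2 \<and> n = N - p) :: real)"
      by auto
    moreover have "of_bool (m = p \<and> n + 2 = N - p) =
        of_bool (p + 2 \<le> N) * (of_bool (m = p \<and> n = N - p - 2) :: real)"
      by auto
    ultimately show ?case
      by (simp only: source prod.case) (simp only: algebra_simps)
  qed
  also have "\<dots> = - a x0 y0 * (of_bool (2 \<le> p) * (if 2 \<le> p then ?Af (p - 2) (N - p) else 0) +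
      of_bool (p + 2 \<le> N) * (if p + 2 \<le> N then ?Af p (N - p - 2) else 0))"
    unfolding sum_distrib_left[symmetric] sum.distrib
    using p N by (auto simp: sum_delta_pair)
  finally show ?thesis
    using pderiv_at_representation[OF a, of "taylor_mono x0 y0 p (N - p)" m' n'] 1 N p
    by (auto simp: pderiv_at_taylor_mono)
qed

text \<open>
  The recursion runs downwards from \<open>p = N - 2\<close>.  It produces zero until \<open>p = m' - 2\<close>, where the
  left-hand side is one, and alternating signs in steps of two from there on.
\<close>

lemma AVf_leading:
  assumes a: "smooth_near x0 y0 a" "a x0 y0 \<noteq> 0" and N: "m' + n' = N" and p: "p + 2 \<le> N"
  shows "AVf x0 y0 a m' n' p (N - 2 - p) =
    (if p + 2 \<le> m' \<and> even (m' - p) then (-1) ^ ((m' - p) div 2) / a x0 y0 else 0)"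
  using p
proof (induction "N - p" arbitrary: p rule: less_induct)
  case less
  let ?F = "\<lambda>p. AVf x0 y0 a m' n' p (N - 2 - p)"
  have N2: "2 \<le> N" using less.prems by simp
  have "of_bool (m' = p + 2) = - a x0 y0 * (?F p + (if p + 4 \<le> N then ?F (p + 2) else 0))"
    using AV_recursion[OF a N N2, of "p + 2"] less.prems by (simp add: diff_diff_eq2 add.commute)
  hence F: "?F p = - of_bool (m' = p + 2) / a x0 y0 - (if p + 4 \<le> N then ?F (p + 2) else 0)"
    using a(2) by (simp add: field_simps)
  show ?case
  proof (cases "p + 4 \<le> N")
    case True
    have "N - (p + 2) < N - p" "p + 2 + 2 \<le> N" using True by simp_all
    note IH = less.hyps[OF this]
    have "m' \<le> p + 1 \<or> m' = p + 2 \<or> m' = p + 3 \<or> m' = p + 4 + (m' - (p + 4))"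
      by linarith
    then consider "m' \<le> p + 1" | "m' = p + 2" | "m' = p + 3" | k where "m' = p + 4 + k"
      by blast
    thus ?thesis
    proof cases
      case 4
      have *: "m' - (p + 2) = k + 2" "m' - p = k + 2 + 2" using 4 by simp_all
      have "?F p = - ?F (p + 2)" using F True 4 by simp
      also have "?F (p + 2) = (if even k then (-1) ^ (k div 2 + 1) / a x0 y0 else 0)"
        unfolding IH * using 4 by simp
      finally show ?thesis
        unfolding * using 4 by simp
    qed (use F True IH in simp_all)
  next
    case False
    hence "m' \<le> p + 3" using N less.prems by simp
    then consider "m' \<le> p + 1" | "m' = p + 2" | "m' = p + 3" by linarith
    thus ?thesis by cases (use False F in simp_all)
  qed
qed

lemma AVu_leading:
  assumes a: "smooth_near x0 y0 a" "a x0 y0 \<noteq> 0" and "2 \<le> m'" and p: "p < 2"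
  shows "AVu x0 y0 a m' n' p (m' + n' - p) =
    (if p + 2 \<le> m' \<and> even (m' - p) then (-1) ^ ((m' - p) div 2) else 0)"
proof -
  have "AVu x0 y0 a m' n' p (m' + n' - p) =
      a x0 y0 * (if p + 2 \<le> m' + n' then AVf x0 y0 a m' n' p (m' + n' - 2 - p) else 0)"
    using AV_recursion[OF a refl, of m' n' p] assms(3) p by (simp add: diff_diff_eq2 add.commute)
  thus ?thesis
    using AVf_leading[OF a refl, of p m' n'] a(2) by auto
qed

section \<open>The coefficients one order below the leading ones\<close>

text \<open>
  The jet of order \<open>n + 1\<close> of the solution of \<open>\<Delta>u + p u\<^sub>x + q u\<^sub>y = 0\<close> with \<open>u = y\<^sup>n / n!\<close> and
  \<open>u\<^sub>x = 0\<close> on the boundary: in order \<open>n\<close> the harmonic polynomial \<open>Re z\<^sup>n / n!\<close>, in order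
  \<open>n + 1\<close> the solution of the recursion with zero initial values that this polynomial drives.
\<close>

definition second_jet :: "nat \<Rightarrow> real \<Rightarrow> real \<Rightarrow> nat \<Rightarrow> nat \<Rightarrow> real" where
  "second_jet n p q i j =
     (if i + j = n then (if even i then (-1) ^ (i div 2) else 0)
      else if i + j = n + 1
      then (if even i then (-1) ^ (i div 2) * real (i div 2) * q
            else (-1) ^ (i div 2 + 1) * real (i div 2) * p)
      else 0)"

text \<open>
  For the polynomial with the jet above, \<open>f\<close> vanishes to the order that enters the representation
  and \<open>u\<^sup>(\<^sup>0\<^sup>,\<^sup>n\<^sup>) = 1\<close> is the only remaining term on the right-hand side.  So the coefficient is
  the derivative of the polynomial itself.
\<close>

lemma AVu_second:
  assumes a: "smooth_near x0 y0 a" "a x0 y0 \<noteq> 0" and m': "2 \<le> m'" "m' + n' = n + 1"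
  shows "AVu x0 y0 a m' n' 0 n =
    second_jet n (dx x0 a x0 y0 / a x0 y0) (dy a x0 y0 / a x0 y0) m' n'"
proof -
  let ?U = "second_jet n (dx x0 a x0 y0 / a x0 y0) (dy a x0 y0 / a x0 y0)"
  define u where "u = jet_poly x0 y0 (n + 1) ?U"
  have u: "smooth_near x0 y0 u" by (simp add: u_def)
  have ju: "pderiv_at x0 y0 i j u = ?U i j" for i j
    by (simp add: u_def pderiv_at_jet_poly second_jet_def)
  have f0: "pderiv_at x0 y0 i j (source x0 a u) = 0" if "i + j \<le> m' + n' - 2" for i j
  proof -
    have "pderiv_at x0 y0 i j (source x0 a u) =
      - (a x0 y0 * (?U (i + 2) j + ?U i (j + 2)) +
         dx x0 a x0 y0 * ?U (i + 1) j + dy a x0 y0 * ?U i (j + 1))"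
      using that m'
      by (subst pderiv_at_source_second[OF a(1) u]) (auto simp: ju second_jet_def)
    also have "\<dots> = 0"
      proof (cases "i + j + 1 = n")
      case True
      show ?thesis
      proof (cases "even i")
        case True
        then obtain s where "i = 2 * s" by (elim evenE)
        with \<open>i + j + 1 = n\<close> a(2) show ?thesis by (simp add: second_jet_def field_simps)
      next
        case False
        then obtain s where "i = 2 * s + 1" by (elim oddE)
        with \<open>i + j + 1 = n\<close> a(2) show ?thesis by (simp add: second_jet_def field_simps)
      qed
    next
      case False
      thus ?thesis using that m' by (simp add: second_jet_def)
    qed
    finally show ?thesis .
  qed
  have "(\<Sum>(m, k)\<in>Lam (m' + n' - 2).
      AVf x0 y0 a m' n' m k * pderiv_at x0 y0 m k (source x0 a u)) = 0"
    by (rule sum.neutral) (auto simp: f0)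
  hence "?U m' n' = (\<Sum>(m, k)\<in>LamV1 (m' + n'). AVu x0 y0 a m' n' m k * ?U m k)"
    using pderiv_at_representation[OF a u, of m' n'] by (simp add: ju)
  also have "\<dots> = (\<Sum>(m, k)\<in>LamV1 (m' + n'). AVu x0 y0 a m' n' m k * of_bool (m = 0 \<and> k = n))"
    by (intro sum.cong) (auto simp: second_jet_def)
  also have "\<dots> = AVu x0 y0 a m' n' 0 n"
    using m' by (subst sum_delta_pair) auto
  finally show ?thesis by simp
qed

section \<open>Taylor expansion at the boundary\<close>

lemma Ck_on_dx_funpow:
  "(\<And>k. Ck_on x0 S k u) \<Longrightarrow> Ck_on x0 S k ((dx x0 ^^ m) u)"
  by (induction m arbitrary: k) (auto intro: Ck_on_SucD(4) simp del: Ck_on.simps)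

lemma Ck_on_dy_funpow:
  "(\<And>k. Ck_on x0 S k u) \<Longrightarrow> Ck_on x0 S k ((dy ^^ m) u)"
  by (induction m arbitrary: k) (auto intro: Ck_on_SucD(5) simp del: Ck_on.simps)

text \<open>
  The expansion is taken first along the normal, with a remainder that is uniform in \<open>y\<close>, and then
  along the boundary for each normal derivative on it.  This needs only one-variable Taylor
  theorems.
\<close>

lemma taylor_bound_half_box:
  assumes "d > 0" "\<And>k. Ck_on x0 (half_box x0 y0 d) k u"
  shows "\<exists>B. \<forall>x\<in>{x0..x0 + d/2}. \<forall>y\<in>{y0 - d/2..y0 + d/2}.
    \<bar>u x y - (\<Sum>i\<le>N. (dx x0 ^^ i) u x0 y * (x - x0) ^ i / fact i)\<bar> \<le> B * \<bar>x - x0\<bar> ^ Suc N"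
proof -
  let ?v = "\<lambda>i. (dx x0 ^^ i) u"
  let ?K = "{x0..x0 + d/2} \<times> {y0 - d/2..y0 + d/2}"
  have K: "?K \<subseteq> half_box x0 y0 d" using assms(1) by (auto simp: half_box_iff)
  have C: "Ck_on x0 (half_box x0 y0 d) k (?v i)" for k i
    by (rule Ck_on_dx_funpow[OF assms(2)])
  have "continuous_on ?K (\<lambda>(x, y). ?v (Suc N) x y)"
    using Ck_on_SucD(1)[OF C, of "Suc N"] K by (rule continuous_on_subset)
  hence "bounded ((\<lambda>(x, y). ?v (Suc N) x y) ` ?K)"
    by (intro compact_imp_bounded compact_continuous_image compact_Times) auto
  then obtain B where B: "\<And>p. p \<in> ?K \<Longrightarrow> \<bar>(\<lambda>(x, y). ?v (Suc N) x y) p\<bar> \<le> B"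
    unfolding bounded_iff by fastforce
  show ?thesis
  proof (intro exI[of _ "B / fact N"] ballI)
    fix x y assume x: "x \<in> {x0..x0 + d/2}" and y: "y \<in> {y0 - d/2..y0 + d/2}"
    have "norm (?v 0 x y - (\<Sum>i\<le>N. ?v i x0 y * (x - x0) ^ i / fact i))
        \<le> B * norm (x - x0) ^ Suc N / fact N"
    proof (rule field_Taylor[where f = "\<lambda>i x. ?v i x y" and S = "{x0..x0 + d/2}"])
      fix i t assume t: "t \<in> {x0..x0 + d/2}"
      have "(\<lambda>t. ?v i t y) differentiable (at t within {x0..})"
        using Ck_on_SucD(2)[OF C] K t y by blast
      from dx_works[of "?v i" y t, OF this]
      show "((\<lambda>t. ?v i t y) has_real_derivative ?v (Suc i) t y) (at t within {x0..x0 + d/2})"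
        using DERIV_subset by fastforce
    next
      fix t assume "t \<in> {x0..x0 + d/2}"
      thus "norm (?v (Suc N) t y) \<le> B" using B[of "(t, y)"] y by simp
    qed (use x assms(1) in auto)
    thus "\<bar>u x y - (\<Sum>i\<le>N. ?v i x0 y * (x - x0) ^ i / fact i)\<bar> \<le> B / fact N * \<bar>x - x0\<bar> ^ Suc N"
      by simp
  qed
qed

lemma taylor_bound_boundary:
  assumes "d > 0" "\<And>k. Ck_on x0 (half_box x0 y0 d) k v"
  shows "\<exists>B. \<forall>y\<in>{y0 - d/2..y0 + d/2}.
    \<bar>v x0 y - (\<Sum>j\<le>N. (dy ^^ j) v x0 y0 * (y - y0) ^ j / fact j)\<bar> \<le> B * \<bar>y - y0\<bar> ^ Suc N"
proof -
  let ?v = "\<lambda>i. (dy ^^ i) v"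
  let ?K = "{y0 - d/2..y0 + d/2}"
  have K: "(x0, y) \<in> half_box x0 y0 d" if "y \<in> ?K" for y
    using assms(1) that by (auto simp: half_box_iff)
  have der: "(?v i x0 has_real_derivative ?v (Suc i) x0 t) (at t within ?K)" if "t \<in> ?K" for i t
    using dy_works[of "?v i" x0 t, OF Ck_on_SucD(3)[OF Ck_on_dy_funpow[OF assms(2)] K[OF that]]]
    by (simp add: has_field_derivative_at_within)
  have "continuous_on ?K (?v (Suc N) x0)"
    by (rule DERIV_continuous_on, rule der)
  hence "bounded (?v (Suc N) x0 ` ?K)"
    by (intro compact_imp_bounded compact_continuous_image) auto
  then obtain B where B: "\<And>y. y \<in> ?K \<Longrightarrow> \<bar>?v (Suc N) x0 y\<bar> \<le> B"
    unfolding bounded_iff by fastforce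
  show ?thesis
  proof (intro exI[of _ "B / fact N"] ballI)
    fix y assume y: "y \<in> ?K"
    have "norm (?v 0 x0 y - (\<Sum>i\<le>N. ?v i x0 y0 * (y - y0) ^ i / fact i))
        \<le> B * norm (y - y0) ^ Suc N / fact N"
      by (rule field_Taylor[where f = "\<lambda>i y. ?v i x0 y" and S = ?K])
        (use y assms(1) der B in auto)
    thus "\<bar>v x0 y - (\<Sum>i\<le>N. ?v i x0 y0 * (y - y0) ^ i / fact i)\<bar> \<le> B / fact N * \<bar>y - y0\<bar> ^ Suc N"
      by simp
  qed
qed

definition taylor_poly :: "real \<Rightarrow> real \<Rightarrow> nat \<Rightarrow> (real \<Rightarrow> real \<Rightarrow> real) \<Rightarrow> real \<Rightarrow> real \<Rightarrow> real" where
  "taylor_poly x0 y0 N u x y =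
     (\<Sum>p\<in>Lam N. jet x0 y0 p u * (x ^ fst p * y ^ snd p / (fact (fst p) * fact (snd p))))"

lemma sum_Lam: "sum F (Lam N) = (\<Sum>i\<le>N. \<Sum>j\<le>N - i. F (i, j))"
proof -
  have "Lam N = Sigma {..N} (\<lambda>i. {..N - i})" by (auto simp: Lam_def)
  thus ?thesis by (simp add: sum.Sigma)
qed

lemma eventually_small:
  fixes k e :: real
  assumes "e > 0"
  shows "\<forall>\<^sub>F h in at_right 0. h > 0 \<and> \<bar>k * h\<bar> \<le> e"
proof -
  have "((\<lambda>h. \<bar>k * h\<bar>) \<longlongrightarrow> \<bar>k * 0\<bar>) (at_right 0)"
    by (intro tendsto_intros)
  hence "\<forall>\<^sub>F h in at_right 0. \<bar>k * h\<bar> < e"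
    using assms by (intro order_tendstoD(2)) auto
  moreover have "\<forall>\<^sub>F h in at_right (0::real). h > 0"
    by (rule eventually_at_right_less)
  ultimately show ?thesis by eventually_elim auto
qed

text \<open>
  The nodes \<open>(k h, l h)\<close> stay in the half-plane because \<open>k \<ge> 0\<close>; both remainders are of order
  \<open>N + 1\<close> in \<open>h\<close>, since a tangential remainder of order \<open>N - i + 1\<close> is multiplied by \<open>(k h)\<^sup>i\<close>.
\<close>

lemma taylor_expansion:
  assumes u: "smooth_near x0 y0 u" and k: "k \<ge> 0"
  shows "(\<lambda>h. u (x0 + k * h) (y0 + l * h) - taylor_poly x0 y0 N u (k * h) (l * h))
    \<in> O[at_right 0](\<lambda>h. h ^ Suc N)"
proof -
  obtain d where d: "d > 0" "\<And>k. Ck_on x0 (half_box x0 y0 d) k u"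
    using u by (rule smooth_nearE) blast
  let ?v = "\<lambda>i. (dx x0 ^^ i) u"
  let ?R = "\<lambda>i h. ?v i x0 (y0 + l * h) -
      (\<Sum>j\<le>N - i. (dy ^^ j) (?v i) x0 y0 * (l * h) ^ j / fact j)"
  have ev: "\<forall>\<^sub>F h in at_right 0. h > 0 \<and> x0 + k * h \<in> {x0..x0 + d/2} \<and>
      y0 + l * h \<in> {y0 - d/2..y0 + d/2}"
    using eventually_small[OF half_gt_zero[OF d(1)], of k] eventually_small[OF half_gt_zero[OF d(1)], of l]
    by eventually_elim (use k in \<open>auto simp: abs_le_iff\<close>)
  obtain B where B: "\<And>x y. x \<in> {x0..x0 + d/2} \<Longrightarrow> y \<in> {y0 - d/2..y0 + d/2} \<Longrightarrow>
      \<bar>u x y - (\<Sum>i\<le>N. ?v i x0 y * (x - x0) ^ i / fact i)\<bar> \<le> B * \<bar>x - x0\<bar> ^ Suc N"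
    using taylor_bound_half_box[OF d, of N] by blast
  have normal: "(\<lambda>h. u (x0 + k * h) (y0 + l * h) -
      (\<Sum>i\<le>N. ?v i x0 (y0 + l * h) * (k * h) ^ i / fact i)) \<in> O[at_right 0](\<lambda>h. h ^ Suc N)"
  proof (rule bigoI[of _ "B * \<bar>k\<bar> ^ Suc N"])
    show "\<forall>\<^sub>F h in at_right 0. norm (u (x0 + k * h) (y0 + l * h) -
        (\<Sum>i\<le>N. ?v i x0 (y0 + l * h) * (k * h) ^ i / fact i)) \<le> B * \<bar>k\<bar> ^ Suc N * norm (h ^ Suc N)"
      using ev
    proof eventually_elim
      case (elim h)
      thus ?case
        using B[of "x0 + k * h" "y0 + l * h"] by (simp add: abs_mult power_mult_distrib mult_ac)
    qed
  qed
  have tangential: "?R i \<in> O[at_right 0](\<lambda>h. h ^ Suc (N - i))" for i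
  proof -
    obtain B where B: "\<And>y. y \<in> {y0 - d/2..y0 + d/2} \<Longrightarrow>
        \<bar>?v i x0 y - (\<Sum>j\<le>N - i. (dy ^^ j) (?v i) x0 y0 * (y - y0) ^ j / fact j)\<bar>
          \<le> B * \<bar>y - y0\<bar> ^ Suc (N - i)"
      using taylor_bound_boundary[OF d(1) Ck_on_dx_funpow[OF d(2)], of i "N - i"] by blast
    show ?thesis
    proof (rule bigoI[of _ "B * \<bar>l\<bar> ^ Suc (N - i)"])
      show "\<forall>\<^sub>F h in at_right 0. norm (?R i h) \<le> B * \<bar>l\<bar> ^ Suc (N - i) * norm (h ^ Suc (N - i))"
        using ev
      proof eventually_elim
        case (elim h)
        thus ?case
          using B[of "y0 + l * h"] by (simp add: abs_mult power_mult_distrib mult_ac)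
      qed
    qed
  qed
  have "(\<lambda>h. ?R i h * ((k * h) ^ i / fact i)) \<in> O[at_right 0](\<lambda>h. h ^ Suc N)" if "i \<le> N" for i
  proof -
    have "(\<lambda>h. (k * h) ^ i / fact i) \<in> O[at_right 0](\<lambda>h. h ^ i)"
      by (rule bigoI[of _ "\<bar>k ^ i / fact i\<bar>"]) (simp add: abs_mult power_mult_distrib)
    from landau_o.big_mult[OF tangential[of i] this]
    show ?thesis using that by (simp add: mult.assoc flip: power_add)
  qed
  hence "(\<lambda>h. \<Sum>i\<le>N. ?R i h * ((k * h) ^ i / fact i)) \<in> O[at_right 0](\<lambda>h. h ^ Suc N)"
    by (intro big_sum_in_bigo) auto
  from sum_in_bigo(1)[OF normal this]
  show ?thesis
  proof (rule landau_o.big.in_cong[THEN iffD1, rotated], intro always_eventually allI)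
    fix h
    have jets: "jet x0 y0 (i, j) u = (dy ^^ j) (?v i) x0 y0" for i j
      using near_eq_at_base[OF near_eq_dy_funpow_dx_funpow[OF u]]
      by (simp add: jet_def pderiv_at_def)
    have "taylor_poly x0 y0 N u (k * h) (l * h) =
        (\<Sum>i\<le>N. (\<Sum>j\<le>N - i. (dy ^^ j) (?v i) x0 y0 * (l * h) ^ j / fact j) * ((k * h) ^ i / fact i))"
      unfolding taylor_poly_def sum_Lam jets sum_distrib_right fst_conv snd_conv
      by (intro sum.cong refl) (simp add: field_simps)
    moreover have "(\<Sum>i\<le>N. ?R i h * ((k * h) ^ i / fact i)) =
        (\<Sum>i\<le>N. ?v i x0 (y0 + l * h) * (k * h) ^ i / fact i) -
        (\<Sum>i\<le>N. (\<Sum>j\<le>N - i. (dy ^^ j) (?v i) x0 y0 * (l * h) ^ j / fact j) * ((k * h) ^ i / fact i))"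
      by (simp add: left_diff_distrib diff_divide_distrib sum_subtractf)
    ultimately show "u (x0 + k * h) (y0 + l * h) -
        (\<Sum>i\<le>N. ?v i x0 (y0 + l * h) * (k * h) ^ i / fact i) +
        (\<Sum>i\<le>N. ?R i h * ((k * h) ^ i / fact i)) =
      u (x0 + k * h) (y0 + l * h) - taylor_poly x0 y0 N u (k * h) (l * h)"
      by simp
  qed
qed

section \<open>Taylor polynomials in terms of the data\<close>

text \<open>
  The coefficients of \<open>GV\<close> and \<open>QV\<close> as functions of the exponents \<open>p\<close>, which puts the explicit
  alternating sums and the sums over \<open>AVu\<close>, \<open>AVf\<close> into one table: the explicit part
  is the antidiagonal on which the order of \<open>p\<close> is that of \<open>(m, n)\<close>, or two more for \<open>QV\<close>.
\<close>

definition u_coeff :: "real \<Rightarrow> real \<Rightarrow> (real \<Rightarrow> real \<Rightarrow> real) \<Rightarrow> nat \<Rightarrow> nat \<Rightarrow> nat \<times> nat \<Rightarrow> real" where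
  "u_coeff x0 y0 a m n p =
     (if fst p + snd p < m + n then 0
      else if fst p + snd p = m + n
      then (if m \<le> fst p \<and> even (fst p - m) then (-1) ^ ((fst p - m) div 2) else 0)
      else if 2 \<le> fst p then AVu x0 y0 a (fst p) (snd p) m n else 0)"

definition f_coeff :: "real \<Rightarrow> real \<Rightarrow> (real \<Rightarrow> real \<Rightarrow> real) \<Rightarrow> nat \<Rightarrow> nat \<Rightarrow> nat \<times> nat \<Rightarrow> real" where
  "f_coeff x0 y0 a m n p =
     (if fst p + snd p < m + n + 2 then 0
      else if fst p + snd p = m + n + 2
      then (if m + 2 \<le> fst p \<and> even (fst p - m) then (-1) ^ ((fst p - m) div 2) / a x0 y0 else 0)
      else if 2 \<le> fst p then AVf x0 y0 a (fst p) (snd p) m n else 0)"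

abbreviation mono_at :: "nat \<times> nat \<Rightarrow> real \<Rightarrow> real \<Rightarrow> real" where
  "mono_at p x y \<equiv> x ^ fst p * y ^ snd p / (fact (fst p) * fact (snd p))"

lemma sum_antidiagonal:
  fixes F :: "nat \<times> nat \<Rightarrow> real"
  assumes "m + n \<le> N"
  shows "(\<Sum>p\<in>Lam N. if fst p + snd p = m + n \<and> m + 2 * s \<le> fst p \<and> even (fst p - m) then F p else 0) =
    (\<Sum>l = s..n div 2. F (m + 2 * l, n - 2 * l))"
proof -
  have "(\<Sum>p\<in>Lam N. if fst p + snd p = m + n \<and> m + 2 * s \<le> fst p \<and> even (fst p - m) then F p else 0) =
      (\<Sum>p\<in>{p \<in> Lam N. fst p + snd p = m + n \<and> m + 2 * s \<le> fst p \<and> even (fst p - m)}. F p)"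
    by (simp add: sum.inter_filter)
  also have "\<dots> = (\<Sum>l = s..n div 2. F (m + 2 * l, n - 2 * l))"
  proof (rule sum.reindex_bij_witness[of _ "\<lambda>l. (m + 2 * l, n - 2 * l)" "\<lambda>p. (fst p - m) div 2"], goal_cases)
    case (1 p)
    then obtain i j where p: "p = (i, j)" "i + j = m + n" "m + 2 * s \<le> i" "even (i - m)" by (cases p) auto
    then obtain r where "i = m + 2 * r" by (metis evenE le_add_diff_inverse add_leD1)
    thus ?case using p by auto
  next
    case (2 p)
    then obtain i j where p: "p = (i, j)" "i + j = m + n" "m + 2 * s \<le> i" "even (i - m)" by (cases p) auto
    then obtain r where "i = m + 2 * r" by (metis evenE le_add_diff_inverse add_leD1)
    thus ?case using p by auto
  next
    case (5 p)
    then obtain i j where p: "p = (i, j)" "i + j = m + n" "m + 2 * s \<le> i" "even (i - m)" by (cases p) auto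
    then obtain r where "i = m + 2 * r" by (metis evenE le_add_diff_inverse add_leD1)
    thus ?case using p by auto
  qed (use assms in auto)
  finally show ?thesis .
qed

lemma GV_eq_table:
  assumes "m + n \<le> M + 1"
  shows "GV x0 y0 a M m n x y = (\<Sum>p\<in>Lam (M + 1). u_coeff x0 y0 a m n p * mono_at p x y)"
proof -
  let ?A = "AVu x0 y0 a"
  have index: "(fst (m + 2 * l, k) - m) div 2 = l" for l k :: nat by simp
  have "(\<Sum>p\<in>Lam (M + 1). u_coeff x0 y0 a m n p * mono_at p x y) =
      (\<Sum>p\<in>Lam (M + 1). (if fst p + snd p = m + n \<and> m + 2 * 0 \<le> fst p \<and> even (fst p - m)
          then (-1) ^ ((fst p - m) div 2) * mono_at p x y else 0) +
        (if p \<in> LamV2 (M + 1) \<and> fst p + snd p > m + n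
          then ?A (fst p) (snd p) m n * mono_at p x y else 0))"
    by (intro sum.cong) (auto simp: u_coeff_def)
  also have "\<dots> = (\<Sum>l = 0..n div 2. (-1) ^ l * mono_at (m + 2 * l, n - 2 * l) x y) +
      (\<Sum>p\<in>{p \<in> Lam (M + 1). p \<in> LamV2 (M + 1) \<and> fst p + snd p > m + n}.
        ?A (fst p) (snd p) m n * mono_at p x y)"
    unfolding sum.distrib sum_antidiagonal[OF assms] by (simp only: sum.inter_filter[OF finite_Lam] index)
  also have "{p \<in> Lam (M + 1). p \<in> LamV2 (M + 1) \<and> fst p + snd p > m + n} =
      {(m', n') \<in> LamV2 (M + 1). m' + n' > m + n}"
    by auto
  finally show ?thesis
    by (simp add: GV_def case_prod_unfold mult.assoc)
qed

lemma QV_eq_table: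
  assumes "m + n + 2 \<le> M + 1"
  shows "QV x0 y0 a M m n x y = (\<Sum>p\<in>Lam (M + 1). f_coeff x0 y0 a m n p * mono_at p x y)"
proof -
  let ?A = "AVf x0 y0 a"
  have index: "(fst (m + 2 * l, k) - m) div 2 = l" for l k :: nat by simp
  have le: "m + (n + 2) \<le> M + 1" using assms by simp
  have "(\<Sum>p\<in>Lam (M + 1). f_coeff x0 y0 a m n p * mono_at p x y) =
      (\<Sum>p\<in>Lam (M + 1). (if fst p + snd p = m + (n + 2) \<and> m + 2 * 1 \<le> fst p \<and> even (fst p - m)
          then (-1) ^ ((fst p - m) div 2) / a x0 y0 * mono_at p x y else 0) +
        (if p \<in> LamV2 (M + 1) \<and> fst p + snd p > m + n + 2
          then ?A (fst p) (snd p) m n * mono_at p x y else 0))"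
    by (intro sum.cong) (auto simp: f_coeff_def)
  also have "\<dots> = (\<Sum>l = 1..(n + 2) div 2. (-1) ^ l / a x0 y0 * mono_at (m + 2 * l, n + 2 - 2 * l) x y) +
      (\<Sum>p\<in>{p \<in> Lam (M + 1). p \<in> LamV2 (M + 1) \<and> fst p + snd p > m + n + 2}.
        ?A (fst p) (snd p) m n * mono_at p x y)"
    unfolding sum.distrib sum_antidiagonal[OF le] by (simp only: sum.inter_filter[OF finite_Lam] index)
  also have "{p \<in> Lam (M + 1). p \<in> LamV2 (M + 1) \<and> fst p + snd p > m + n + 2} =
      {(m', n') \<in> LamV2 (M + 1). m' + n' > m + n + 2}"
    by auto
  also have "(n + 2) div 2 = 1 + n div 2" by simp
  finally show ?thesis
    unfolding QV_def sum_distrib_left case_prod_unfold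
    by (elim ssubst) (intro arg_cong2[where f = "(+)"] sum.cong refl; simp)
qed

text \<open>
  The table entries are the coefficients of the representation on its index sets, by
  \<open>AVu_leading\<close> and \<open>AVf_leading\<close> on the antidiagonal, and zero elsewhere.  For fewer than two
  normal derivatives the table reduces to the trivial representation.
\<close>

lemma pderiv_at_tables:
  assumes a: "smooth_near x0 y0 a" "a x0 y0 \<noteq> 0" and u: "smooth_near x0 y0 u"
    and p: "p \<in> Lam N"
  shows "jet x0 y0 p u = (\<Sum>q\<in>LamV1 N. u_coeff x0 y0 a (fst q) (snd q) p * jet x0 y0 q u) +
    (\<Sum>q\<in>Lam (N - 2). f_coeff x0 y0 a (fst q) (snd q) p * jet x0 y0 q (source x0 a u))"
proof -
  obtain m' n' where p_eq: "p = (m', n')" by (cases p)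
  with p have N: "m' + n' \<le> N" by simp
  show ?thesis
  proof (cases "2 \<le> m'")
    case True
    have "(\<Sum>q\<in>LamV1 N. u_coeff x0 y0 a (fst q) (snd q) p * jet x0 y0 q u) =
        (\<Sum>q\<in>LamV1 (m' + n'). u_coeff x0 y0 a (fst q) (snd q) p * jet x0 y0 q u)"
      using N by (intro sum.mono_neutral_right) (auto simp: u_coeff_def p_eq)
    also have "\<dots> = (\<Sum>(m, n)\<in>LamV1 (m' + n'). AVu x0 y0 a m' n' m n * pderiv_at x0 y0 m n u)"
    proof (intro sum.cong refl, clarify, goal_cases)
      case (1 m n)
      hence mn: "m + n \<le> m' + n'" "m < 2" by auto
      have "AVu x0 y0 a m' n' m n = u_coeff x0 y0 a m n (m', n')"
      proof (cases "m + n = m' + n'")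
        case eq: True
        hence n: "n = m' + n' - m" by simp
        have parity: "m + 2 \<le> m' \<and> even (m' - m) \<longleftrightarrow> m \<le> m' \<and> even (m' - m)"
          using True mn(2) by presburger
        thus ?thesis
          unfolding n AVu_leading[OF a True mn(2)] u_coeff_def parity fst_conv snd_conv
          using eq by simp
      qed (use mn True in \<open>simp add: u_coeff_def\<close>)
      thus ?case by (simp add: jet_def p_eq)
    qed
    finally have 1: "(\<Sum>q\<in>LamV1 N. u_coeff x0 y0 a (fst q) (snd q) p * jet x0 y0 q u) =
      (\<Sum>(m, n)\<in>LamV1 (m' + n'). AVu x0 y0 a m' n' m n * pderiv_at x0 y0 m n u)" .
    have "(\<Sum>q\<in>Lam (N - 2). f_coeff x0 y0 a (fst q) (snd q) p * jet x0 y0 q (source x0 a u)) =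
        (\<Sum>q\<in>Lam (m' + n' - 2). f_coeff x0 y0 a (fst q) (snd q) p * jet x0 y0 q (source x0 a u))"
      using N True by (intro sum.mono_neutral_right) (auto simp: f_coeff_def p_eq)
    also have "\<dots> = (\<Sum>(m, n)\<in>Lam (m' + n' - 2).
        AVf x0 y0 a m' n' m n * pderiv_at x0 y0 m n (source x0 a u))"
    proof (intro sum.cong refl, clarify, goal_cases)
      case (1 m n)
      hence mn: "m + n + 2 \<le> m' + n'" using True by simp
      have "AVf x0 y0 a m' n' m n = f_coeff x0 y0 a m n (m', n')"
      proof (cases "m + n + 2 = m' + n'")
        case eq: True
        hence n: "m' + n' - 2 - m = n" and le: "m + 2 \<le> m' + n'" by simp_all
        have "AVf x0 y0 a m' n' m (m' + n' - 2 - m) = f_coeff x0 y0 a m n (m', n')"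
          unfolding AVf_leading[OF a refl le] using eq by (auto simp: f_coeff_def)
        thus ?thesis by (simp only: n)
      qed (use mn True in \<open>simp add: f_coeff_def\<close>)
      thus ?case by (simp add: jet_def p_eq)
    qed
    finally show ?thesis
      using pderiv_at_representation[OF a u, of m' n'] 1 by (simp add: jet_def p_eq)
  next
    case False
    have "(\<Sum>q\<in>LamV1 N. u_coeff x0 y0 a (fst q) (snd q) p * jet x0 y0 q u) =
        (\<Sum>q\<in>LamV1 N. if q = p then jet x0 y0 p u else 0)"
      using False by (intro sum.cong) (auto simp: u_coeff_def p_eq)
    moreover have "(\<Sum>q\<in>Lam (N - 2). f_coeff x0 y0 a (fst q) (snd q) p * jet x0 y0 q (source x0 a u)) = 0"
      using False by (intro sum.neutral) (auto simp: f_coeff_def p_eq)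
    ultimately show ?thesis
      using False N by (simp add: p_eq)
  qed
qed

text \<open>
  Insert the representation into the Taylor polynomial and exchange the sums.
\<close>

lemma taylor_poly_eq:
  assumes a: "smooth_near x0 y0 a" "a x0 y0 \<noteq> 0" and u: "smooth_near x0 y0 u" and M: "1 \<le> M"
  shows "taylor_poly x0 y0 (M + 1) u x y =
    (\<Sum>(m, n)\<in>LamV1 (M + 1). pderiv_at x0 y0 m n u * GV x0 y0 a M m n x y) +
    (\<Sum>(m, n)\<in>Lam (M - 1). pderiv_at x0 y0 m n (source x0 a u) * QV x0 y0 a M m n x y)"
proof -
  let ?V = "LamV1 (M + 1)" and ?L = "Lam (M + 1)" and ?f = "source x0 a u"
  have "taylor_poly x0 y0 (M + 1) u x y =
      (\<Sum>p\<in>?L. (\<Sum>q\<in>?V. u_coeff x0 y0 a (fst q) (snd q) p * jet x0 y0 q u) * mono_at p x y) +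
      (\<Sum>p\<in>?L. (\<Sum>q\<in>Lam (M - 1). f_coeff x0 y0 a (fst q) (snd q) p * jet x0 y0 q ?f) * mono_at p x y)"
    unfolding taylor_poly_def sum.distrib[symmetric] distrib_right[symmetric]
    using pderiv_at_tables[OF a u, of _ "M + 1"] by (intro sum.cong) auto
  also have "(\<Sum>p\<in>?L. (\<Sum>q\<in>?V. u_coeff x0 y0 a (fst q) (snd q) p * jet x0 y0 q u) * mono_at p x y) =
      (\<Sum>q\<in>?V. jet x0 y0 q u * (\<Sum>p\<in>?L. u_coeff x0 y0 a (fst q) (snd q) p * mono_at p x y))"
    unfolding sum_distrib_right sum_distrib_left
    by (subst sum.swap) (simp add: mult_ac)
  also have "\<dots> = (\<Sum>(m, n)\<in>?V. pderiv_at x0 y0 m n u * GV x0 y0 a M m n x y)"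
    by (intro sum.cong) (auto simp: GV_eq_table jet_def)
  also have "(\<Sum>p\<in>?L. (\<Sum>q\<in>Lam (M - 1). f_coeff x0 y0 a (fst q) (snd q) p * jet x0 y0 q ?f) * mono_at p x y) =
      (\<Sum>q\<in>Lam (M - 1). jet x0 y0 q ?f * (\<Sum>p\<in>?L. f_coeff x0 y0 a (fst q) (snd q) p * mono_at p x y))"
    unfolding sum_distrib_right sum_distrib_left
    by (subst sum.swap) (simp add: mult_ac)
  also have "\<dots> = (\<Sum>(m, n)\<in>Lam (M - 1). pderiv_at x0 y0 m n ?f * QV x0 y0 a M m n x y)"
    using M by (intro sum.cong) (auto simp: QV_eq_table jet_def)
  finally show ?thesis .
qed

section \<open>The boundary data\<close>

lemma dy_funpow_apply: "(dy ^^ n) u x = (deriv ^^ n) (u x)"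
proof (induction n)
  case (Suc n)
  have "(dy ^^ Suc n) u x = deriv ((dy ^^ n) u x)"
    by (simp add: dy_def[of "(dy ^^ n) u"])
  thus ?case using Suc by simp
qed simp

lemma smooth1_on_subset: "smooth1_on I g \<Longrightarrow> J \<subseteq> I \<Longrightarrow> smooth1_on J g"
  by (auto simp: smooth1_on_def)

lemma smooth1_onD:
  assumes "smooth1_on I g" "y \<in> I"
  shows "((deriv ^^ n) g has_real_derivative (deriv ^^ Suc n) g y) (at y)"
  using assms DERIV_deriv_iff_real_differentiable by (auto simp: smooth1_on_def)

lemma smooth_near_boundary:
  assumes "smooth_near x0 y0 u"
  obtains e where "e > 0" "smooth1_on {y0 - e<..<y0 + e} (u x0)"
proof -
  obtain d where d: "d > 0" "\<And>k. Ck_on x0 (half_box x0 y0 d) k u"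
    using assms by (rule smooth_nearE) blast
  have "smooth1_on {y0 - d<..<y0 + d} (u x0)"
    unfolding smooth1_on_def dy_funpow_apply[symmetric]
  proof (intro allI ballI)
    fix n y assume "y \<in> {y0 - d<..<y0 + d}"
    thus "(dy ^^ n) u x0 differentiable (at y)"
      using Ck_on_SucD(3)[OF Ck_on_dy_funpow[OF d(2)], of x0 y n] d(1) by (simp add: half_box_iff)
  qed
  with d(1) show ?thesis by (rule that)
qed

lemma deriv_eqI_on_open:
  assumes "open I" "y \<in> I" "\<And>t. t \<in> I \<Longrightarrow> f t = g t" "(g has_real_derivative D) (at y)"
  shows "deriv f y = D"
proof -
  have "\<forall>\<^sub>F t in nhds y. f t = g t"
    using eventually_nhds_in_open[OF assms(1,2)] by eventually_elim (rule assms(3))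
  hence "(f has_real_derivative D) (at y)"
    using DERIV_cong_ev[OF refl _ refl, of f g y D] assms(4) by blast
  thus ?thesis by (rule DERIV_imp_deriv)
qed

lemma funpow_deriv_add:
  assumes "open I" "smooth1_on I f" "smooth1_on I g"
  shows "y \<in> I \<Longrightarrow> (deriv ^^ n) (\<lambda>y. f y + g y) y = (deriv ^^ n) f y + (deriv ^^ n) g y"
proof (induction n arbitrary: y)
  case (Suc n)
  have "deriv ((deriv ^^ n) (\<lambda>y. f y + g y)) y = (deriv ^^ Suc n) f y + (deriv ^^ Suc n) g y"
    by (rule deriv_eqI_on_open[OF assms(1) Suc.prems Suc.IH], assumption)
      (intro DERIV_add smooth1_onD[OF assms(2)] smooth1_onD[OF assms(3)] Suc.prems)
  thus ?case by simp
qed simp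

lemma funpow_deriv_uminus:
  assumes "open I" "smooth1_on I f"
  shows "y \<in> I \<Longrightarrow> (deriv ^^ n) (\<lambda>y. - f y) y = - (deriv ^^ n) f y"
proof (induction n arbitrary: y)
  case (Suc n)
  have "deriv ((deriv ^^ n) (\<lambda>y. - f y)) y = - (deriv ^^ Suc n) f y"
    by (rule deriv_eqI_on_open[OF assms(1) Suc.prems Suc.IH], assumption)
      (intro DERIV_minus smooth1_onD[OF assms(2)] Suc.prems)
  thus ?case by simp
qed simp

text \<open>
  Leibniz rule with explicit coefficients.  They are needed here because the binomial coefficients
  occur in the linear system.
\<close>

lemma funpow_deriv_mult:
  assumes I: "open I" and f: "smooth1_on I f" and g: "smooth1_on I g"
  shows "y \<in> I \<Longrightarrow> (deriv ^^ n) (\<lambda>y. f y * g y) y =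
    (\<Sum>k\<le>n. real (n choose k) * (deriv ^^ (n - k)) f y * (deriv ^^ k) g y)"
proof (induction n arbitrary: y)
  case (Suc n)
  let ?f = "\<lambda>k. (deriv ^^ k) f y" and ?g = "\<lambda>k. (deriv ^^ k) g y"
  have "deriv ((deriv ^^ n) (\<lambda>y. f y * g y)) y =
      (\<Sum>k\<le>n. real (n choose k) * ?f (Suc (n - k)) * ?g k + real (n choose k) * ?f (n - k) * ?g (Suc k))"
  proof (rule deriv_eqI_on_open[OF I Suc.prems Suc.IH], assumption, rule DERIV_sum)
    fix k
    show "((\<lambda>y. real (n choose k) * (deriv ^^ (n - k)) f y * (deriv ^^ k) g y) has_real_derivative
        real (n choose k) * ?f (Suc (n - k)) * ?g k + real (n choose k) * ?f (n - k) * ?g (Suc k)) (at y)"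
      using DERIV_mult[OF DERIV_cmult[OF smooth1_onD[OF f Suc.prems, of "n - k"], of "real (n choose k)"]
          smooth1_onD[OF g Suc.prems, of k]]
      by (simp add: algebra_simps)
  qed
  also have "\<dots> = (\<Sum>k\<le>n. real (n choose k) * ?f (Suc n - k) * ?g k) +
      (\<Sum>k\<le>n. real (n choose k) * ?f (n - k) * ?g (Suc k))"
    by (simp add: sum.distrib Suc_diff_le)
  also have "(\<Sum>k\<le>n. real (n choose k) * ?f (Suc n - k) * ?g k) =
      (\<Sum>k\<le>Suc n. real (n choose k) * ?f (Suc n - k) * ?g k)"
    by simp
  also have "\<dots> = ?f (Suc n) * ?g 0 + (\<Sum>k\<le>n. real (n choose Suc k) * ?f (n - k) * ?g (Suc k))"
    by (subst sum.atMost_Suc_shift) simp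
  also have "?f (Suc n) * ?g 0 + (\<Sum>k\<le>n. real (n choose Suc k) * ?f (n - k) * ?g (Suc k)) +
      (\<Sum>k\<le>n. real (n choose k) * ?f (n - k) * ?g (Suc k)) =
      ?f (Suc n) * ?g 0 + (\<Sum>k\<le>n. real (Suc n choose Suc k) * ?f (n - k) * ?g (Suc k))"
    by (simp add: sum.distrib[symmetric] algebra_simps)
  also have "\<dots> = (\<Sum>k\<le>Suc n. real (Suc n choose k) * ?f (Suc n - k) * ?g k)"
    unfolding sum.atMost_Suc_shift[of _ n] by simp
  finally show ?case by simp
qed simp

lemma smooth1_on_uminus:
  assumes "open I" "smooth1_on I f"
  shows "smooth1_on I (\<lambda>y. - f y)"
  unfolding smooth1_on_def
proof (intro allI ballI)
  fix n y assume y: "y \<in> I"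
  have "((\<lambda>y. - (deriv ^^ n) f y) has_real_derivative - (deriv ^^ Suc n) f y) (at y)"
    by (intro DERIV_minus smooth1_onD[OF assms(2) y])
  moreover have "\<forall>\<^sub>F t in nhds y. (deriv ^^ n) (\<lambda>y. - f y) t = - (deriv ^^ n) f t"
    using eventually_nhds_in_open[OF assms(1) y]
    by eventually_elim (rule funpow_deriv_uminus[OF assms])
  ultimately have "((deriv ^^ n) (\<lambda>y. - f y) has_real_derivative - (deriv ^^ Suc n) f y) (at y)"
    using DERIV_cong_ev[OF refl _ refl, of "(deriv ^^ n) (\<lambda>y. - f y)" "\<lambda>y. - (deriv ^^ n) f y" y]
    by blast
  thus "(deriv ^^ n) (\<lambda>y. - f y) differentiable (at y)"
    by (auto simp: real_differentiable_def)
qed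

lemma smooth1_on_mult:
  assumes "open I" "smooth1_on I f" "smooth1_on I g"
  shows "smooth1_on I (\<lambda>y. f y * g y)"
  unfolding smooth1_on_def
proof (intro allI ballI)
  fix n y assume y: "y \<in> I"
  let ?S = "\<lambda>y. \<Sum>k\<le>n. real (n choose k) * (deriv ^^ (n - k)) f y * (deriv ^^ k) g y"
  have "?S differentiable (at y)"
    by (intro differentiable_sum finite_atMost ballI differentiable_mult differentiable_const)
      (use assms y in \<open>auto simp: smooth1_on_def\<close>)
  then obtain D where "(?S has_real_derivative D) (at y)"
    by (auto simp: real_differentiable_def)
  moreover have "\<forall>\<^sub>F t in nhds y. (deriv ^^ n) (\<lambda>y. f y * g y) t = ?S t"
    using eventually_nhds_in_open[OF assms(1) y]
    by eventually_elim (rule funpow_deriv_mult[OF assms])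
  ultimately have "((deriv ^^ n) (\<lambda>y. f y * g y) has_real_derivative D) (at y)"
    using DERIV_cong_ev[OF refl _ refl, of "(deriv ^^ n) (\<lambda>y. f y * g y)" ?S y]
    by blast
  thus "(deriv ^^ n) (\<lambda>y. f y * g y) differentiable (at y)"
    by (auto simp: real_differentiable_def)
qed

lemma funpow_deriv_robin_data:
  assumes u: "smooth_near x0 y0 u" and \<alpha>: "smooth1_on I \<alpha>" and I: "open I" "y0 \<in> I"
  shows "(deriv ^^ n) (robin_data x0 \<alpha> u) y0 = - pderiv_at x0 y0 1 n u +
    (\<Sum>k\<le>n. real (n choose k) * (deriv ^^ (n - k)) \<alpha> y0 * pderiv_at x0 y0 0 k u)"
proof -
  obtain d e where d: "d > 0" "smooth1_on {y0 - d<..<y0 + d} (u x0)"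
    and e: "e > 0" "smooth1_on {y0 - e<..<y0 + e} (dx x0 u x0)"
    using smooth_near_boundary[OF u] smooth_near_boundary[OF smooth_near_dx[OF u]] by metis
  define J where "J = I \<inter> {y0 - d<..<y0 + d} \<inter> {y0 - e<..<y0 + e}"
  have J: "open J" "y0 \<in> J"
    using I d(1) e(1) by (auto simp: J_def intro!: open_Int)
  have s: "smooth1_on J \<alpha>" "smooth1_on J (u x0)" "smooth1_on J (dx x0 u x0)"
    by (rule smooth1_on_subset[OF \<alpha>] smooth1_on_subset[OF d(2)] smooth1_on_subset[OF e(2)],
        auto simp: J_def)+
  have "(deriv ^^ n) (robin_data x0 \<alpha> u) y0 =
      - (deriv ^^ n) (dx x0 u x0) y0 + (deriv ^^ n) (\<lambda>y. \<alpha> y * u x0 y) y0"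
    unfolding robin_data_def funpow_deriv_uminus[OF J(1) s(3) J(2), symmetric]
    by (rule funpow_deriv_add[OF J(1) smooth1_on_uminus[OF J(1) s(3)] smooth1_on_mult[OF J(1) s(1,2)] J(2)])
  also have "(deriv ^^ n) (dx x0 u x0) y0 = pderiv_at x0 y0 0 n (dx x0 u)"
    by (simp add: pderiv_at_def dy_funpow_apply)
  also have "\<dots> = pderiv_at x0 y0 1 n u"
    by (simp add: pderiv_at_dx u)
  also have "(deriv ^^ n) (\<lambda>y. \<alpha> y * u x0 y) y0 =
      (\<Sum>k\<le>n. real (n choose k) * (deriv ^^ (n - k)) \<alpha> y0 * pderiv_at x0 y0 0 k u)"
    by (simp add: funpow_deriv_mult[OF J(1) s(1,2) J(2)] pderiv_at_def dy_funpow_apply)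
  finally show ?thesis .
qed

section \<open>Consistency of the scheme\<close>

lemma stencil_sum_add:
  "stencil_sum C (\<lambda>x y. F x y + G x y) h = stencil_sum C F h + stencil_sum C G h"
  by (simp add: stencil_sum_def sum.distrib distrib_left)

lemma stencil_sum_cmult: "stencil_sum C (\<lambda>x y. c * F x y) h = c * stencil_sum C F h"
  by (simp add: stencil_sum_def algebra_simps)

lemma stencil_sum_zero: "stencil_sum C (\<lambda>x y. 0) h = 0"
  by (simp add: stencil_sum_def)

lemma stencil_sum_sum:
  "stencil_sum C (\<lambda>x y. \<Sum>i\<in>I. F i x y) h = (\<Sum>i\<in>I. stencil_sum C (F i) h)"
  by (induction I rule: infinite_finite_induct) (simp_all add: stencil_sum_zero stencil_sum_add)

lemma poly_bigo_1: "(\<lambda>h. poly p h) \<in> O[at_right 0](\<lambda>_. 1 :: real)"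
proof (rule bigoI_tendsto)
  have "(poly p \<longlongrightarrow> poly p 0) (at 0 within {0<..})"
    by (intro tendsto_intros)
  thus "((\<lambda>h. poly p h / 1) \<longlongrightarrow> poly p 0) (at_right 0)" by simp
qed simp

lemma stencil_sum_bigo:
  assumes "\<And>k l. k \<ge> 0 \<Longrightarrow> (\<lambda>h. w (k * h) (l * h)) \<in> O[at_right 0](g)"
  shows "stencil_sum C w \<in> O[at_right 0](g :: real \<Rightarrow> real)"
  unfolding stencil_sum_def
proof (intro big_sum_in_bigo)
  fix k :: nat and l :: int
  show "(\<lambda>h. poly (C k l) h * w (real k * h) (of_int l * h)) \<in> O[at_right 0](g)"
    using landau_o.big_mult[OF poly_bigo_1 assms[of "real k" "of_int l"], of "C k l"] by simp
qed

lemma sum_LamV1: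
  "(\<Sum>(m, n)\<in>LamV1 (Suc N). F m n) = (\<Sum>n\<le>Suc N. F 0 n) + (\<Sum>n\<le>N. F 1 n)"
proof -
  have "LamV1 (Suc N) = Pair 0 ` {..Suc N} \<union> Pair 1 ` {..N}"
    by (auto simp: image_iff)
  moreover have "(\<Sum>p\<in>Pair 0 ` {..Suc N} \<union> Pair 1 ` {..N}. F (fst p) (snd p)) =
      (\<Sum>p\<in>Pair 0 ` {..Suc N}. F (fst p) (snd p)) + (\<Sum>p\<in>Pair 1 ` {..N}. F (fst p) (snd p))"
    by (rule sum.union_disjoint) auto
  ultimately show ?thesis
    by (simp add: case_prod_unfold sum.reindex inj_on_def del: sum.atMost_Suc)
qed

lemma sum_triangle_swap:
  fixes F :: "nat \<Rightarrow> nat \<Rightarrow> real"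
  shows "(\<Sum>n\<le>M. \<Sum>k\<le>n. F n k) = (\<Sum>k\<le>M. \<Sum>n = k..M. F n k)"
  by (induction M) (simp_all add: sum.distrib)

text \<open>
  The Taylor polynomial of the solution of \<open>div (a grad u) = 0\<close> with boundary values \<open>y\<^sup>n / n!\<close>
  and \<open>u\<^sub>x = \<alpha> u\<close> on the boundary: the derivative \<open>u\<^sup>(\<^sup>1\<^sup>,\<^sup>i\<^sup>)\<close> of such a solution is
  \<open>(i choose n) \<alpha>\<^sup>(\<^sup>i\<^sup>-\<^sup>n\<^sup>)\<close>.
\<close>

definition robin_basis ::
  "real \<Rightarrow> real \<Rightarrow> (real \<Rightarrow> real \<Rightarrow> real) \<Rightarrow> (real \<Rightarrow> real) \<Rightarrow> nat \<Rightarrow> nat \<Rightarrow> real \<Rightarrow> real \<Rightarrow> real" where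
  "robin_basis x0 y0 a \<alpha> M n x y = GV x0 y0 a M 0 n x y +
     (\<Sum>i = n..M. real (i choose n) * (deriv ^^ (i - n)) \<alpha> y0 * GV x0 y0 a M 1 i x y)"

text \<open>
  The boundary condition replaces each \<open>u\<^sup>(\<^sup>1\<^sup>,\<^sup>n\<^sup>)\<close> by a derivative of \<open>g\<close> and by
  \<open>u\<^sup>(\<^sup>0\<^sup>,\<^sup>k\<^sup>)\<close> with \<open>k \<le> n\<close>; collecting the latter for each \<open>k\<close> produces the basis functions.
\<close>

lemma taylor_poly_robin:
  assumes a: "smooth_near x0 y0 a" "a x0 y0 \<noteq> 0" and u: "smooth_near x0 y0 u" and M: "1 \<le> M"
    and \<alpha>: "smooth1_on I \<alpha>" and I: "open I" "y0 \<in> I"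
  shows "taylor_poly x0 y0 (M + 1) u x y =
    (\<Sum>n\<le>M + 1. pderiv_at x0 y0 0 n u * robin_basis x0 y0 a \<alpha> M n x y) -
    (\<Sum>n\<le>M. (deriv ^^ n) (robin_data x0 \<alpha> u) y0 * GV x0 y0 a M 1 n x y) +
    (\<Sum>(m, n)\<in>Lam (M - 1). pderiv_at x0 y0 m n (source x0 a u) * QV x0 y0 a M m n x y)"
proof -
  let ?c = "\<lambda>i k. real (i choose k) * (deriv ^^ (i - k)) \<alpha> y0"
  let ?G = "\<lambda>n. GV x0 y0 a M 1 n x y"
  let ?u = "\<lambda>n. pderiv_at x0 y0 0 n u"
  have "(\<Sum>n\<le>M. pderiv_at x0 y0 1 n u * ?G n) =
      (\<Sum>n\<le>M. (\<Sum>k\<le>n. ?c n k * ?u k) * ?G n - (deriv ^^ n) (robin_data x0 \<alpha> u) y0 * ?G n)"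
    by (intro sum.cong refl)
      (simp add: funpow_deriv_robin_data[OF u \<alpha> I] left_diff_distrib[symmetric])
  also have "\<dots> = (\<Sum>n\<le>M. \<Sum>k\<le>n. ?u k * (?c n k * ?G n)) -
      (\<Sum>n\<le>M. (deriv ^^ n) (robin_data x0 \<alpha> u) y0 * ?G n)"
    unfolding sum_subtractf sum_distrib_right by (simp only: mult_ac)
  also have "(\<Sum>n\<le>M. \<Sum>k\<le>n. ?u k * (?c n k * ?G n)) = (\<Sum>k\<le>M. \<Sum>n = k..M. ?u k * (?c n k * ?G n))"
    by (rule sum_triangle_swap)
  also have "\<dots> = (\<Sum>k\<le>M + 1. ?u k * (\<Sum>n = k..M. ?c n k * ?G n))"
    by (simp add: sum_distrib_left)
  finally have "(\<Sum>n\<le>M. pderiv_at x0 y0 1 n u * ?G n) =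
      (\<Sum>k\<le>M + 1. ?u k * (\<Sum>n = k..M. ?c n k * ?G n)) -
      (\<Sum>n\<le>M. (deriv ^^ n) (robin_data x0 \<alpha> u) y0 * ?G n)" .
  moreover have "(\<Sum>n\<le>M + 1. ?u n * robin_basis x0 y0 a \<alpha> M n x y) =
      (\<Sum>n\<le>M + 1. ?u n * GV x0 y0 a M 0 n x y) + (\<Sum>k\<le>M + 1. ?u k * (\<Sum>n = k..M. ?c n k * ?G n))"
    by (simp only: robin_basis_def distrib_left sum.distrib)
  moreover have "(\<Sum>(m, n)\<in>LamV1 (M + 1). pderiv_at x0 y0 m n u * GV x0 y0 a M m n x y) =
      (\<Sum>n\<le>M + 1. ?u n * GV x0 y0 a M 0 n x y) + (\<Sum>n\<le>M. pderiv_at x0 y0 1 n u * ?G n)"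
    using sum_LamV1[of "\<lambda>m n. pderiv_at x0 y0 m n u * GV x0 y0 a M m n x y" M]
    by (simp del: sum.atMost_Suc)
  ultimately show ?thesis
    unfolding taylor_poly_eq[OF a u M] by linarith
qed

text \<open>
  The data terms of the Taylor polynomial cancel exactly against the right-hand side of the scheme.
  What is left are the Taylor remainder and the stencil sums of the basis functions, multiplied by
  constants.
\<close>

theorem scheme_of_order_from_system:
  assumes a: "smooth_near x0 y0 a" "a x0 y0 \<noteq> 0" and M: "1 \<le> M"
    and \<alpha>: "smooth1_on I \<alpha>" and I: "open I" "y0 \<in> I"
    and C: "nontrivial C"
    and sys: "\<And>n. n \<le> M + 1 \<Longrightarrow>
      stencil_sum C (robin_basis x0 y0 a \<alpha> M n) \<in> O[at_right 0](\<lambda>h. h ^ (M + 2))"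
  shows "scheme_of_order x0 y0 a \<alpha> C
    (Lam (M - 1)) (\<lambda>m n h. stencil_sum C (QV x0 y0 a M m n) h)
    {0..M} (\<lambda>n h. - stencil_sum C (GV x0 y0 a M 1 n) h) (M + 1)"
  unfolding scheme_of_order_def
proof (intro conjI allI impI C)
  fix u assume u: "smooth_near x0 y0 u"
  let ?T = "taylor_poly x0 y0 (M + 1) u" and ?f = "source x0 a u" and ?g = "robin_data x0 \<alpha> u"
  let ?w = "\<lambda>x y. u (x0 + x) (y0 + y) + (-1) * ?T x y"
  have "stencil_sum C ?w \<in> O[at_right 0](\<lambda>h. h ^ Suc (M + 1))"
    by (rule stencil_sum_bigo) (use taylor_expansion[OF u, of _ _ "M + 1"] in simp)
  moreover have "(\<lambda>h. \<Sum>n\<le>M + 1. pderiv_at x0 y0 0 n u * stencil_sum C (robin_basis x0 y0 a \<alpha> M n) h)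
      \<in> O[at_right 0](\<lambda>h. h ^ Suc (M + 1))"
    using sys by (intro big_sum_in_bigo) auto
  ultimately have "(\<lambda>h. stencil_sum C ?w h +
      (\<Sum>n\<le>M + 1. pderiv_at x0 y0 0 n u * stencil_sum C (robin_basis x0 y0 a \<alpha> M n) h))
      \<in> O[at_right 0](\<lambda>h. h ^ Suc (M + 1))"
    by (rule sum_in_bigo)
  moreover have "stencil_sum C ?w h +
      (\<Sum>n\<le>M + 1. pderiv_at x0 y0 0 n u * stencil_sum C (robin_basis x0 y0 a \<alpha> M n) h) =
      stencil_sum C (\<lambda>x y. u (x0 + x) (y0 + y)) h -
        ((\<Sum>(m, n)\<in>Lam (M - 1). pderiv_at x0 y0 m n ?f * stencil_sum C (QV x0 y0 a M m n) h) +
         (\<Sum>n\<in>{0..M}. (deriv ^^ n) ?g y0 * - stencil_sum C (GV x0 y0 a M 1 n) h))" for h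
  proof -
    have "?T = (\<lambda>x y. ((\<Sum>n\<le>M + 1. pderiv_at x0 y0 0 n u * robin_basis x0 y0 a \<alpha> M n x y) +
        (-1) * (\<Sum>n\<le>M. (deriv ^^ n) ?g y0 * GV x0 y0 a M 1 n x y)) +
        (\<Sum>p\<in>Lam (M - 1). pderiv_at x0 y0 (fst p) (snd p) ?f * QV x0 y0 a M (fst p) (snd p) x y))"
      by (intro ext) (simp add: taylor_poly_robin[OF a u M \<alpha> I, simplified] case_prod_unfold)
    hence "stencil_sum C ?T h =
        (\<Sum>n\<le>M + 1. pderiv_at x0 y0 0 n u * stencil_sum C (robin_basis x0 y0 a \<alpha> M n) h) +
        (-1) * (\<Sum>n\<le>M. (deriv ^^ n) ?g y0 * stencil_sum C (GV x0 y0 a M 1 n) h) +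
        (\<Sum>p\<in>Lam (M - 1). pderiv_at x0 y0 (fst p) (snd p) ?f * stencil_sum C (QV x0 y0 a M (fst p) (snd p)) h)"
      by (simp only: stencil_sum_add stencil_sum_cmult stencil_sum_sum)
    moreover have "stencil_sum C ?w h = stencil_sum C (\<lambda>x y. u (x0 + x) (y0 + y)) h +
        (-1) * stencil_sum C ?T h"
      by (simp only: stencil_sum_add stencil_sum_cmult)
    ultimately show ?thesis
      by (simp add: case_prod_unfold sum_negf atMost_atLeast0 del: sum.atMost_Suc)
  qed
  ultimately show "(\<lambda>h. stencil_sum C (\<lambda>x y. u (x0 + x) (y0 + y)) h -
        ((\<Sum>(m, n)\<in>Lam (M - 1). pderiv_at x0 y0 m n ?f * stencil_sum C (QV x0 y0 a M m n) h) +
         (\<Sum>n\<in>{0..M}. (deriv ^^ n) ?g y0 * - stencil_sum C (GV x0 y0 a M 1 n) h)))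
      \<in> O[at_right 0](\<lambda>h. h ^ (M + 1 + 1))"
    by simp
qed auto

section \<open>Orders of vanishing of stencil sums\<close>

text \<open>
  A stencil with constant weights applied to a function at the six nodes for \<open>h = 1\<close>.
\<close>

definition pairing :: "(nat \<Rightarrow> int \<Rightarrow> real) \<Rightarrow> (real \<Rightarrow> real \<Rightarrow> real) \<Rightarrow> real" where
  "pairing c w = (\<Sum>k\<in>{0, 1}. \<Sum>l\<in>{-1, 0, 1}. c k l * w (real k) (of_int l))"

lemma pairing_expand:
  "pairing c w = c 0 (-1) * w 0 (-1) + c 0 0 * w 0 0 + c 0 1 * w 0 1 +
     c 1 (-1) * w 1 (-1) + c 1 0 * w 1 0 + c 1 1 * w 1 1"
  by (simp add: pairing_def)

lemma pairing_zero [simp]: "pairing c (\<lambda>x y. 0) = 0"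
  by (simp add: pairing_def)

text \<open>
  The homogeneous part of degree \<open>s\<close> of the polynomial with derivatives \<open>W\<close> at the origin.
\<close>

definition hom_part :: "(nat \<Rightarrow> nat \<Rightarrow> real) \<Rightarrow> nat \<Rightarrow> real \<Rightarrow> real \<Rightarrow> real" where
  "hom_part W s x y = (\<Sum>i\<le>s. W i (s - i) * mono_at (i, s - i) x y)"

lemma hom_part_scale: "hom_part W s (x * h) (y * h) = hom_part W s x y * h ^ s"
proof -
  have "mono_at (i, s - i) (x * h) (y * h) = mono_at (i, s - i) x y * h ^ s" if "i \<le> s" for i
    using that by (simp add: power_mult_distrib mult_ac flip: power_add)
  thus ?thesis
    by (simp add: hom_part_def sum_distrib_right mult.assoc)
qed

lemma sum_Lam_hom_parts:
  "(\<Sum>p\<in>Lam N. W (fst p) (snd p) * mono_at p x y) = (\<Sum>s\<le>N. hom_part W s x y)"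
  using sum.triangle_reindex_eq[of "\<lambda>i j. W i j * mono_at (i, j) x y" N]
  by (simp add: hom_part_def Lam_def case_prod_unfold)

definition stencil_poly :: "(nat \<Rightarrow> int \<Rightarrow> real poly) \<Rightarrow> nat \<Rightarrow> (nat \<Rightarrow> nat \<Rightarrow> real) \<Rightarrow> real poly" where
  "stencil_poly C N W =
     (\<Sum>k\<in>{0, 1}. \<Sum>l\<in>{-1, 0, 1}. C k l * (\<Sum>s\<le>N. monom (hom_part W s (real k) (of_int l)) s))"

lemma poly_stencil_poly:
  "stencil_sum C (\<lambda>x y. \<Sum>p\<in>Lam N. W (fst p) (snd p) * mono_at p x y) h = poly (stencil_poly C N W) h"
  unfolding sum_Lam_hom_parts stencil_sum_def stencil_poly_def
  by (simp only: poly_sum poly_mult poly_monom hom_part_scale)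

text \<open>
  On homogeneous parts the step size factors out, so that a stencil sum is a polynomial in \<open>h\<close>
  whose coefficients are Cauchy products of the expansions of the weights and of the function.
\<close>

lemma coeff_stencil_poly:
  assumes "t \<le> N"
  shows "coeff (stencil_poly C N W) t = (\<Sum>j\<le>t. pairing (\<lambda>k l. coeff (C k l) j) (hom_part W (t - j)))"
proof -
  have "coeff (\<Sum>s\<le>N. monom (hom_part W s x y) s) i = hom_part W i x y" if "i \<le> N" for i x y
    using that by (simp add: coeff_sum)
  hence "coeff (C k l * (\<Sum>s\<le>N. monom (hom_part W s x y) s)) t =
      (\<Sum>j\<le>t. coeff (C k l) j * hom_part W (t - j) x y)" for k l x y
    using assms by (simp add: coeff_mult)
  thus ?thesis
    unfolding stencil_poly_def pairing_def coeff_sum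
    by (simp add: sum.distrib)
qed

lemma poly_bigo_power:
  assumes "\<And>t. t < N \<Longrightarrow> coeff p t = (0 :: real)"
  shows "poly p \<in> O[at_right 0](\<lambda>h. h ^ N)"
proof -
  have "monom 1 N dvd p" using assms by (simp add: monom_1_dvd_iff')
  then obtain q where "p = monom 1 N * q" by (elim dvdE)
  hence "poly p = (\<lambda>h. h ^ N * poly q h)" by (simp add: fun_eq_iff poly_monom)
  thus ?thesis
    using landau_o.big.mult[OF landau_o.big_refl poly_bigo_1, of "\<lambda>h. h ^ N" q] by simp
qed

lemma coeff_eq_0_if_bigo_power:
  assumes "poly p \<in> O[at_right 0](\<lambda>h. h ^ N)"
  shows "t < N \<Longrightarrow> coeff p t = (0 :: real)"
  using assms
proof (induction N arbitrary: p t)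
  case (Suc N)
  obtain c where "\<forall>\<^sub>F h in at_right 0. norm (poly p h) \<le> c * norm (h ^ Suc N)"
    using Suc.prems(2) by (elim landau_o.bigE)
  moreover have "((\<lambda>h::real. c * norm (h ^ Suc N)) \<longlongrightarrow> c * norm ((0::real) ^ Suc N)) (at_right 0)"
    by (intro tendsto_intros tendsto_norm)
  hence "((\<lambda>h::real. c * norm (h ^ Suc N)) \<longlongrightarrow> 0) (at_right 0)" by simp
  ultimately have "(poly p \<longlongrightarrow> 0) (at_right 0)"
    by (rule Lim_null_comparison)
  moreover have "(poly p \<longlongrightarrow> poly p 0) (at_right 0)"
    by (intro tendsto_intros)
  ultimately have "poly p 0 = 0"
    using tendsto_unique trivial_limit_at_right_real by blast
  then obtain q where p: "p = [:0, 1:] * q"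
    using poly_eq_0_iff_dvd[of p 0] by (auto elim: dvdE)
  have "(\<lambda>h. h * poly q h) \<in> O[at_right 0](\<lambda>h. h * h ^ N)"
    using Suc.prems(2) unfolding p by simp
  hence "poly q \<in> O[at_right 0](\<lambda>h. h ^ N)"
    by (subst (asm) landau_o.big.mult_cancel_left) (auto simp: eventually_at_filter)
  hence "coeff q t' = 0" if "t' < N" for t'
    using Suc.IH that by blast
  thus ?case
    using Suc.prems(1) by (cases t) (auto simp: p)
qed simp

section \<open>Solving the linear system\<close>

text \<open>
  \<open>Re (y + i x)\<^sup>n / n!\<close>
\<close>

definition harmonic :: "nat \<Rightarrow> real \<Rightarrow> real \<Rightarrow> real" where
  "harmonic n = hom_part (\<lambda>i j. if even i then (-1) ^ (i div 2) else 0) n"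

lemma harmonic_x0: "harmonic n 0 y = y ^ n / fact n"
proof -
  have "harmonic n 0 y = (\<Sum>i\<le>n. if i = 0 then y ^ n / fact n else 0)"
    unfolding harmonic_def hom_part_def by (intro sum.cong) (auto simp: power_0_left)
  thus ?thesis by simp
qed

lemma harmonic_x1:
  "harmonic 0 1 y = 1"
  "harmonic 1 1 y = y"
  "harmonic 2 1 y = (y^2 - 1) / 2"
  "harmonic 3 1 y = (y^3 - 3 * y) / 6"
  "harmonic 4 1 y = (y^4 - 6 * y^2 + 1) / 24"
  "harmonic 5 1 y = (y^5 - 10 * y^3 + 5 * y) / 120"
  "harmonic 6 1 y = (y^6 - 15 * y^4 + 15 * y^2 - 1) / 720"
  by (simp_all add: harmonic_def hom_part_def atMost_nat_numeral fact_numeral field_simps)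

text \<open>
  The hypothesis is the relation \<open>120 P\<^sub>5 + 2/3 P\<^sub>1 - 10 P\<^sub>3 = 0\<close> between the harmonic polynomials
  on the six nodes; it is the only one, as the explicit weights show.  They are found by splitting
  into weights even and odd in \<open>l\<close>: the even ones are determined by \<open>b\<close> at \<open>0, 2, 4\<close> with the
  outer nodes of the second row left at zero, the odd ones by \<open>b\<close> at \<open>1, 3\<close>.
\<close>

lemma pairing_harmonic_surj:
  assumes "120 * b 5 + 2 / 3 * b 1 - 10 * b 3 = 0"
  obtains c where "\<And>n. n \<le> 5 \<Longrightarrow> pairing c (harmonic n) = b n"
proof -
  define c :: "nat \<Rightarrow> int \<Rightarrow> real" where
    "c k l =
      (if k = 0 then
         if l = 0 then b 0 - 24 * b 4
         else (b 2 + 12 * b 4) / 2 + of_int l * (b 1 / 3 + b 3)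
       else
         if l = 0 then 12 * b 4 - b 2
         else of_int l * (b 1 / 6 - b 3))" for k l
  have "pairing c (harmonic n) = b n" if le: "n \<le> 5" for n
  proof -
    consider "n = 0" | "n = 1" | "n = 2" | "n = 3" | "n = 4" | "n = 5"
      using le by linarith
    thus ?thesis
      using assms
      by cases (simp_all add: pairing_expand harmonic_x0 harmonic_x1 harmonic_x1(2)[simplified] c_def fact_numeral field_simps)
  qed
  thus ?thesis by (rule that)
qed

text \<open>
  Half of the nine-point Laplacian \<open>(1, 4, 1; 4, -20, 4; 1, 4, 1)\<close> after adding the weights at
  nodes that are mirror images of each other in the boundary.
\<close>

definition folded_laplacian :: "nat \<Rightarrow> int \<Rightarrow> real" where
  "folded_laplacian k l = (if k = 0 then if l = 0 then -10 else 2 else if l = 0 then 4 else 1)"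

lemma pairing_folded_laplacian_harmonic: "n \<le> 6 \<Longrightarrow> pairing folded_laplacian (harmonic n) = 0"
proof -
  assume "n \<le> 6"
  then consider "n = 0" | "n = 1" | "n = 2" | "n = 3" | "n = 4" | "n = 5" | "n = 6"
    by linarith
  thus ?thesis
    by cases (simp_all add: pairing_expand harmonic_x0 harmonic_x1 harmonic_x1(2)[simplified] folded_laplacian_def fact_numeral)
qed

text \<open>
  The three values are \<open>q / 60\<close>, \<open>-3 q\<close> and \<open>0\<close>.  Monomials with an odd exponent of \<open>x\<close> have an
  odd exponent of \<open>y\<close> too, hence do not contribute to the symmetric weights, and for even exponents
  the hypothesis gives the coefficients.
\<close>

lemma folded_laplacian_compatible:
  assumes "\<And>n i j. i + j = n + 1 \<Longrightarrow> even i \<Longrightarrow> R n i j = (-1) ^ (i div 2) * real (i div 2) * q"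
  shows "120 * pairing folded_laplacian (hom_part (R 5) 6) + 2 / 3 * pairing folded_laplacian (hom_part (R 1) 2)
    - 10 * pairing folded_laplacian (hom_part (R 3) 4) = 0"
  by (simp add: pairing_expand hom_part_def folded_laplacian_def atMost_nat_numeral fact_numeral assms)

text \<open>
  The equation of degree \<open>t = n + J\<close> for the \<open>n\<close>-th function involves \<open>c 0, \<dots>, c J\<close>, and \<open>c J\<close>
  only through its values on the harmonic polynomials.  So the equations are solved by induction on
  \<open>J\<close>, with the previous weights left unchanged.
\<close>

lemma triangular_system:
  fixes H :: "nat \<Rightarrow> nat \<Rightarrow> real \<Rightarrow> real \<Rightarrow> real"
  assumes low: "\<And>n s. s < n \<Longrightarrow> n \<le> 6 \<Longrightarrow> H n s = (\<lambda>x y. 0)"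
    and diag: "\<And>n. n \<le> 6 \<Longrightarrow> H n n = harmonic n"
    and compat: "120 * pairing folded_laplacian (H 5 6) + 2 / 3 * pairing folded_laplacian (H 1 2)
      - 10 * pairing folded_laplacian (H 3 4) = 0"
  obtains c where "c 0 = folded_laplacian"
    "\<And>n t. n \<le> 6 \<Longrightarrow> t \<le> 6 \<Longrightarrow> (\<Sum>j\<le>t. pairing (c j) (H n (t - j))) = 0"
proof -
  have "\<exists>c. c 0 = folded_laplacian \<and> (\<forall>J\<le>m. \<forall>n\<le>6 - J. (\<Sum>j\<le>J. pairing (c j) (H n (n + J - j))) = 0)"
    if "m \<le> 6" for m
    using that
  proof (induction m)
    case 0
    show ?case
      by (intro exI[of _ "\<lambda>_. folded_laplacian"]) (simp add: diag pairing_folded_laplacian_harmonic)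
  next
    case (Suc m)
    then obtain c where c: "c 0 = folded_laplacian"
      "\<And>J n. J \<le> m \<Longrightarrow> n \<le> 6 - J \<Longrightarrow> (\<Sum>j\<le>J. pairing (c j) (H n (n + J - j))) = 0"
      by force
    define r where "r n = - (\<Sum>j\<le>m. pairing (c j) (H n (n + Suc m - j)))" for n
    \<comment> \<open>for later weights the value at 5 is unconstrained, and is chosen to satisfy the relation\<close>
    define b where "b n = (if n = 5 \<and> m \<noteq> 0 then r 3 / 12 - r 1 / 180 else r n)" for n
    have "120 * b 5 + 2 / 3 * b 1 - 10 * b 3 = 0"
      using compat by (cases "m = 0") (simp_all add: b_def r_def c(1) flip: numeral_2_eq_2)
    then obtain d where d: "\<And>n. n \<le> 5 \<Longrightarrow> pairing d (harmonic n) = b n"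
      by (rule pairing_harmonic_surj) blast
    let ?c = "c(Suc m := d)"
    have old: "(\<Sum>j\<le>J. pairing (?c j) (H n (n + J' - j))) = (\<Sum>j\<le>J. pairing (c j) (H n (n + J' - j)))"
      if "J \<le> m" for J J' n
      using that by (intro sum.cong) auto
    have new: "(\<Sum>j\<le>Suc m. pairing (?c j) (H n (n + Suc m - j))) = 0" if n: "n \<le> 6 - Suc m" for n
    proof -
      have "(\<Sum>j\<le>Suc m. pairing (?c j) (H n (n + Suc m - j))) = - r n + pairing d (H n n)"
        by (simp add: old r_def del: fun_upd_apply) (simp add: r_def)
      moreover have "n \<le> 5" "\<not> (n = 5 \<and> m \<noteq> 0)"
        using n Suc.prems by auto
      hence "pairing d (H n n) = r n"
        using d[of n] diag[of n] by (auto simp: b_def)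
      ultimately show ?thesis by simp
    qed
    show ?case
    proof (intro exI[of _ ?c] conjI allI impI)
      show "?c 0 = folded_laplacian" by (simp add: c(1))
      fix J n assume J: "J \<le> Suc m" "n \<le> 6 - J"
      show "(\<Sum>j\<le>J. pairing (?c j) (H n (n + J - j))) = 0"
      proof (cases "J = Suc m")
        case True
        thus ?thesis using J new by blast
      next
        case False
        hence "J \<le> m" using J by simp
        thus ?thesis using J by (simp only: old c(2))
      qed
    qed
  qed
  then obtain c where c: "c 0 = folded_laplacian"
    "\<And>J n. J \<le> 6 \<Longrightarrow> n \<le> 6 - J \<Longrightarrow> (\<Sum>j\<le>J. pairing (c j) (H n (n + J - j))) = 0"
    by (metis order.refl)
  have "(\<Sum>j\<le>t. pairing (c j) (H n (t - j))) = 0" if n: "n \<le> 6" and t: "t \<le> 6" for n t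
  proof (cases "n \<le> t")
    case True
    have "(\<Sum>j\<le>t. pairing (c j) (H n (t - j))) = (\<Sum>j\<le>t - n. pairing (c j) (H n (t - j)))"
    proof (intro sum.mono_neutral_right ballI)
      fix i assume "i \<in> {..t} - {..t - n}"
      hence "t - i < n" by auto
      thus "pairing (c i) (H n (t - i)) = 0" by (simp add: low[OF _ n])
    qed auto
    also have "\<dots> = (\<Sum>j\<le>t - n. pairing (c j) (H n (n + (t - n) - j)))"
      using True by simp
    also have "\<dots> = 0"
      using n t True by (intro c(2)) auto
    finally show ?thesis .
  next
    case False
    thus ?thesis by (intro sum.neutral ballI) (simp add: low[OF _ n])
  qed
  with c(1) show ?thesis by (rule that)
qed

lemma robin_basis_eq_table:
  assumes "n \<le> M + 1"
  shows "robin_basis x0 y0 a \<alpha> M n x y = (\<Sum>p\<in>Lam (M + 1).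
    (u_coeff x0 y0 a 0 n p +
     (\<Sum>i = n..M. real (i choose n) * (deriv ^^ (i - n)) \<alpha> y0 * u_coeff x0 y0 a 1 i p)) * mono_at p x y)"
proof -
  let ?c = "\<lambda>i. real (i choose n) * (deriv ^^ (i - n)) \<alpha> y0"
  have "(\<Sum>i = n..M. ?c i * GV x0 y0 a M 1 i x y) =
      (\<Sum>i = n..M. \<Sum>p\<in>Lam (M + 1). ?c i * u_coeff x0 y0 a 1 i p * mono_at p x y)"
    by (intro sum.cong refl) (simp add: GV_eq_table sum_distrib_left mult.assoc)
  also have "\<dots> = (\<Sum>p\<in>Lam (M + 1). (\<Sum>i = n..M. ?c i * u_coeff x0 y0 a 1 i p) * mono_at p x y)"
    unfolding sum_distrib_right by (rule sum.swap)
  finally show ?thesis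
    unfolding robin_basis_def distrib_right sum.distrib using assms
    by (subst GV_eq_table) simp_all
qed

text \<open>
  The lowest part of each basis function is harmonic whatever \<open>a\<close> and \<open>\<alpha>\<close> are.  In the next one
  \<open>\<alpha>\<close> enters only through monomials odd in \<open>x\<close>, so that the compatibility condition depends on
  \<open>AVu_second\<close> alone.
\<close>

lemma robin_system_solvable:
  assumes a: "smooth_near x0 y0 a" "a x0 y0 \<noteq> 0"
  obtains C where "nontrivial C"
    "\<And>n. n \<le> 6 \<Longrightarrow> stencil_sum C (robin_basis x0 y0 a \<alpha> 5 n) \<in> O[at_right 0](\<lambda>h. h ^ 7)"
proof -
  define R where "R n i j = u_coeff x0 y0 a 0 n (i, j) +
     (\<Sum>r = n..5. real (r choose n) * (deriv ^^ (r - n)) \<alpha> y0 * u_coeff x0 y0 a 1 r (i, j))" for n i j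
  define q where "q = dy a x0 y0 / a x0 y0"
  have R_low: "R n i j = 0" if "i + j < n" for n i j
    unfolding R_def using that by (auto simp: u_coeff_def intro!: sum.neutral)
  have R_lead: "R n i j = (if even i then (-1) ^ (i div 2) else 0)" if "i + j = n" for n i j
    unfolding R_def using that by (auto simp: u_coeff_def intro!: sum.neutral)
  have R_second: "R n i j = (-1) ^ (i div 2) * real (i div 2) * q" if ij: "i + j = n + 1" "even i" for n i j
  proof -
    have "(\<Sum>r = n..5. real (r choose n) * (deriv ^^ (r - n)) \<alpha> y0 * u_coeff x0 y0 a 1 r (i, j)) = 0"
    proof (intro sum.neutral ballI)
      fix r assume "r \<in> {n..5}"
      have "u_coeff x0 y0 a 1 r (i, j) = 0"
        using ij \<open>r \<in> {n..5}\<close> by (cases "i = 0") (auto simp: u_coeff_def elim!: evenE)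
      thus "real (r choose n) * (deriv ^^ (r - n)) \<alpha> y0 * u_coeff x0 y0 a 1 r (i, j) = 0" by simp
    qed
    moreover have "u_coeff x0 y0 a 0 n (i, j) = (-1) ^ (i div 2) * real (i div 2) * q"
    proof (cases "i = 0")
      case False
      hence "2 \<le> i" using ij(2) by (auto elim!: evenE)
      thus ?thesis
        using AVu_second[OF a, of i j n] ij by (simp add: u_coeff_def second_jet_def q_def)
    qed (use ij in \<open>simp add: u_coeff_def\<close>)
    ultimately show ?thesis by (simp add: R_def)
  qed
  obtain c where c: "c 0 = folded_laplacian"
    "\<And>n t. n \<le> 6 \<Longrightarrow> t \<le> 6 \<Longrightarrow> (\<Sum>j\<le>t. pairing (c j) (hom_part (R n) (t - j))) = 0"
  proof (rule triangular_system[of "\<lambda>n. hom_part (R n)"])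
    show "hom_part (R n) s = (\<lambda>x y. 0)" if "s < n" for n s
      using that by (intro ext) (simp add: hom_part_def R_low)
    show "hom_part (R n) n = harmonic n" for n
      by (intro ext) (simp add: hom_part_def harmonic_def R_lead)
    show "120 * pairing folded_laplacian (hom_part (R 5) 6) + 2 / 3 * pairing folded_laplacian (hom_part (R 1) 2)
      - 10 * pairing folded_laplacian (hom_part (R 3) 4) = 0"
      by (rule folded_laplacian_compatible[of R q]) (rule R_second)
  qed (rule that)
  define C where "C k l = (\<Sum>j\<le>6. monom (c j k l) j)" for k l
  have coeff_C: "coeff (C k l) j = c j k l" if "j \<le> 6" for j k l
    using that by (simp add: C_def coeff_sum)
  show ?thesis
  proof (rule that[of C])
    have "poly (C 0 0) 0 \<noteq> 0"
      using coeff_C[of 0 0 0] by (simp add: poly_0_coeff_0 c(1) folded_laplacian_def)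
    thus "nontrivial C" by (auto simp: nontrivial_def)
  next
    fix n :: nat assume n: "n \<le> 6"
    have "coeff (stencil_poly C 6 (R n)) t = 0" if "t < 7" for t
      using that c(2)[OF n, of t] by (simp add: coeff_stencil_poly coeff_C)
    hence "poly (stencil_poly C 6 (R n)) \<in> O[at_right 0](\<lambda>h. h ^ 7)"
      by (rule poly_bigo_power)
    moreover have basis: "robin_basis x0 y0 a \<alpha> 5 n =
        (\<lambda>x y. \<Sum>p\<in>Lam 6. R n (fst p) (snd p) * mono_at p x y)"
      using n by (intro ext) (simp add: robin_basis_eq_table R_def)
    have "stencil_sum C (robin_basis x0 y0 a \<alpha> 5 n) = poly (stencil_poly C 6 (R n))"
      unfolding basis by (intro ext poly_stencil_poly)
    ultimately show "stencil_sum C (robin_basis x0 y0 a \<alpha> 5 n) \<in> O[at_right 0](\<lambda>h. h ^ 7)"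
      by simp
  qed
qed

section \<open>The order barrier\<close>

text \<open>
  \<open>Im (y + i x)\<^sup>n / n!\<close>
\<close>

definition conj_harmonic :: "nat \<Rightarrow> real \<Rightarrow> real \<Rightarrow> real" where
  "conj_harmonic n = hom_part (\<lambda>i j. if odd i then (-1) ^ (i div 2) else 0) n"

lemma conj_harmonic_x0: "conj_harmonic n 0 y = 0"
  unfolding conj_harmonic_def hom_part_def by (intro sum.neutral) (auto elim: oddE)

lemma conj_harmonic_x1:
  "conj_harmonic 3 1 y = (3 * y^2 - 1) / 6"
  "conj_harmonic 7 1 y = (7 * y^6 - 35 * y^4 + 21 * y^2 - 1) / 5040"
  by (simp_all add: conj_harmonic_def hom_part_def atMost_nat_numeral fact_numeral field_simps)

text \<open>
  Derivatives of \<open>Re z\<^sup>n / n! + Im z\<^sup>n\<^sup>+\<^sup>1 / (n+1)!\<close>, which is harmonic and satisfies \<open>u\<^sub>x = u\<close> on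
  the boundary.
\<close>

definition robin_harmonic :: "nat \<Rightarrow> nat \<Rightarrow> nat \<Rightarrow> real" where
  "robin_harmonic n i j = (if 2 * (i div 2) + j = n then (-1) ^ (i div 2) else 0)"

lemma funpow_deriv_const: "(deriv ^^ n) (\<lambda>y. c :: real) = (\<lambda>y. if n = 0 then c else 0)"
proof (induction n)
  case (Suc n)
  have "(deriv ^^ Suc n) (\<lambda>y. c) = deriv (\<lambda>y. if n = 0 then c else 0)"
    by (simp add: Suc)
  thus ?case by (simp add: fun_eq_iff)
qed simp

lemma robin_harmonic_data:
  fixes x0 y0 :: real and n :: nat
  defines "u \<equiv> jet_poly x0 y0 (n + 1) (robin_harmonic n)"
  shows "pderiv_at x0 y0 i j (source x0 (\<lambda>x y. 1) u) = 0"
    and "(deriv ^^ k) (robin_data x0 (\<lambda>y. 1) u) y0 = 0"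
proof -
  have u: "smooth_near x0 y0 u" by (simp add: u_def)
  have jet: "pderiv_at x0 y0 i j u = robin_harmonic n i j" for i j
    by (auto simp: u_def pderiv_at_jet_poly robin_harmonic_def)
  show "pderiv_at x0 y0 i j (source x0 (\<lambda>x y. 1) u) = 0"
    using pderiv_at_source[of x0 y0 "\<lambda>x y. 1" u i j] u
    by (simp add: pderiv_at_dx pderiv_at_dy jet robin_harmonic_def)
  have "(deriv ^^ k) (robin_data x0 (\<lambda>y. 1) u) y0 = - pderiv_at x0 y0 1 k u +
      (\<Sum>r\<le>k. real (k choose r) * (deriv ^^ (k - r)) (\<lambda>y. 1) y0 * pderiv_at x0 y0 0 r u)"
    by (rule funpow_deriv_robin_data[OF u, of UNIV])
      (auto simp: smooth1_on_def funpow_deriv_const)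
  also have "(\<Sum>r\<le>k. real (k choose r) * (deriv ^^ (k - r)) (\<lambda>y. 1) y0 * pderiv_at x0 y0 0 r u) =
      (\<Sum>r\<le>k. if r = k then pderiv_at x0 y0 0 k u else 0)"
    by (intro sum.cong) (auto simp: funpow_deriv_const)
  finally show "(deriv ^^ k) (robin_data x0 (\<lambda>y. 1) u) y0 = 0"
    by (simp add: jet robin_harmonic_def)
qed

text \<open>
  The functions above have vanishing data, so the right-hand side of a scheme disappears whatever
  its coefficients are, and the first eight coefficients of a polynomial in \<open>h\<close> must vanish.
  The two lowest ones for each \<open>n\<close> already contradict non-triviality.
\<close>

lemma scheme_order_le_six:
  assumes "scheme_of_order x0 y0 (\<lambda>x y. 1) (\<lambda>y. 1) C I cf J cg p"
  shows "p \<le> 6"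
proof (rule ccontr)
  assume "\<not> p \<le> 6"
  define c where "c j = (\<lambda>k l. coeff (C k l) j)" for j
  have C: "nontrivial C"
    and order: "\<And>u. smooth_near x0 y0 u \<Longrightarrow>
      (\<lambda>h. stencil_sum C (\<lambda>x y. u (x0 + x) (y0 + y)) h -
        ((\<Sum>(m, n)\<in>I. pderiv_at x0 y0 m n (source x0 (\<lambda>x y. 1) u) * cf m n h) +
         (\<Sum>n\<in>J. (deriv ^^ n) (robin_data x0 (\<lambda>y. 1) u) y0 * cg n h)))
      \<in> O[at_right 0](\<lambda>h. h ^ (p + 1))"
    using assms by (auto simp: scheme_of_order_def)
  have coeff_0: "coeff (stencil_poly C (n + 1) (robin_harmonic n)) t = 0" if "t < 8" for n t
  proof -
    let ?u = "jet_poly x0 y0 (n + 1) (robin_harmonic n)"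
    have u: "(\<lambda>x y. ?u (x0 + x) (y0 + y)) =
        (\<lambda>x y. \<Sum>p\<in>Lam (n + 1). robin_harmonic n (fst p) (snd p) * mono_at p x y)"
      by (simp add: jet_poly_def taylor_mono_def)
    have "stencil_sum C (\<lambda>x y. ?u (x0 + x) (y0 + y)) = poly (stencil_poly C (n + 1) (robin_harmonic n))"
      unfolding u by (intro ext poly_stencil_poly)
    hence "poly (stencil_poly C (n + 1) (robin_harmonic n)) \<in> O[at_right 0](\<lambda>h. h ^ (p + 1))"
      using order[OF smooth_near_jet_poly, of "n + 1" "robin_harmonic n"]
      by (simp only: robin_harmonic_data mult_zero_left case_prod_unfold sum.neutral_const add_0 diff_0_right)
    thus ?thesis
      by (rule coeff_eq_0_if_bigo_power) (use that \<open>\<not> p \<le> 6\<close> in simp)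
  qed
  have part_low: "hom_part (robin_harmonic n) s = (\<lambda>x y. 0)" if "s < n" for n s
    using that by (intro ext) (auto simp: hom_part_def robin_harmonic_def intro!: sum.neutral)
  have part_lead: "hom_part (robin_harmonic n) n = harmonic n" for n
    unfolding hom_part_def harmonic_def
    by (intro ext sum.cong refl) (auto simp: robin_harmonic_def elim!: evenE oddE)
  have part_next: "hom_part (robin_harmonic n) (Suc n) = conj_harmonic (Suc n)" for n
    unfolding hom_part_def conj_harmonic_def
    by (intro ext sum.cong refl) (auto simp: robin_harmonic_def elim!: evenE oddE)
  have order_0: "pairing (c 0) (harmonic n) = 0" if "n < 8" for n
  proof -
    have "0 = (\<Sum>j\<le>n. pairing (c j) (hom_part (robin_harmonic n) (n - j)))"
      using coeff_0[OF that, of n] by (simp add: coeff_stencil_poly c_def)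
    also have "\<dots> = (\<Sum>j\<le>n. if j = 0 then pairing (c 0) (harmonic n) else 0)"
      by (intro sum.cong) (auto simp: part_low part_lead)
    finally show ?thesis by simp
  qed
  have order_1: "pairing (c 0) (conj_harmonic (Suc n)) + pairing (c 1) (harmonic n) = 0" if "n < 7" for n
  proof -
    have "0 = (\<Sum>j\<le>Suc n. pairing (c j) (hom_part (robin_harmonic n) (Suc n - j)))"
      using coeff_0[of "Suc n" n] that by (simp add: coeff_stencil_poly c_def del: sum.atMost_Suc)
    also have "\<dots> = pairing (c 0) (conj_harmonic (Suc n)) +
        (\<Sum>j\<le>n. pairing (c (Suc j)) (hom_part (robin_harmonic n) (n - j)))"
      by (subst sum.atMost_Suc_shift) (simp add: part_next)
    also have "(\<Sum>j\<le>n. pairing (c (Suc j)) (hom_part (robin_harmonic n) (n - j))) =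
        (\<Sum>j\<le>n. if j = 0 then pairing (c 1) (harmonic n) else 0)"
      by (intro sum.cong) (auto simp: part_low part_lead)
    finally show ?thesis by simp
  qed
  note evaluate = pairing_expand harmonic_x0 harmonic_x1 harmonic_x1(2)[simplified]
    conj_harmonic_x0 conj_harmonic_x1 fact_numeral
  \<comment> \<open>the real parts of the sixth and the second power of \<open>y + i x\<close> agree at all six nodes\<close>
  have "720 * pairing (c 1) (harmonic 6) = 2 * pairing (c 1) (harmonic 2)"
    by (simp add: evaluate)
  hence "720 * pairing (c 0) (conj_harmonic 7) = 2 * pairing (c 0) (conj_harmonic 3)"
    using order_1[of 6] order_1[of 2] by simp
  hence "38 * (c 0 1 (-1) + c 0 1 1) = 4 * c 0 1 0"
    by (simp add: evaluate field_simps)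
  moreover have "c 0 0 (-1) + c 0 0 0 + c 0 0 1 + c 0 1 (-1) + c 0 1 0 + c 0 1 1 = 0"
    "c 0 0 1 - c 0 0 (-1) + c 0 1 1 - c 0 1 (-1) = 0"
    "c 0 0 1 + c 0 0 (-1) - c 0 1 0 = 0"
    "c 0 0 1 - c 0 0 (-1) - 2 * c 0 1 1 + 2 * c 0 1 (-1) = 0"
    "c 0 0 1 + c 0 0 (-1) + c 0 1 0 - 4 * c 0 1 1 - 4 * c 0 1 (-1) = 0"
    using order_0[of 0] order_0[of 1] order_0[of 2] order_0[of 3] order_0[of 4]
    by (simp_all add: evaluate field_simps)
  ultimately have eqs: "38 * (c 0 1 (-1) + c 0 1 1) = 4 * c 0 1 0"
    "c 0 0 (-1) + c 0 0 0 + c 0 0 1 + c 0 1 (-1) + c 0 1 0 + c 0 1 1 = 0"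
    "c 0 0 1 - c 0 0 (-1) + c 0 1 1 - c 0 1 (-1) = 0"
    "c 0 0 1 + c 0 0 (-1) - c 0 1 0 = 0"
    "c 0 0 1 - c 0 0 (-1) - 2 * c 0 1 1 + 2 * c 0 1 (-1) = 0"
    "c 0 0 1 + c 0 0 (-1) + c 0 1 0 - 4 * c 0 1 1 - 4 * c 0 1 (-1) = 0"
    by blast+
  \<comment> \<open>the equations of odd degree force symmetry; the even ones then leave a multiple of the folded Laplacian\<close>
  have odd: "c 0 1 (-1) = c 0 1 1" "c 0 0 (-1) = c 0 0 1"
    using eqs(3,5) by linarith+
  have "c 0 1 0 = 4 * c 0 1 1" "76 * c 0 1 1 = 4 * c 0 1 0"
    using eqs(1,4,6) unfolding odd by simp_all
  hence "c 0 1 1 = 0" "c 0 1 0 = 0" by linarith+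
  moreover from this have "c 0 0 1 = 0" "c 0 0 0 = 0"
    using eqs(2,4) odd by linarith+
  ultimately have "c 0 0 (-1) = 0 \<and> c 0 0 0 = 0 \<and> c 0 0 1 = 0 \<and>
      c 0 1 (-1) = 0 \<and> c 0 1 0 = 0 \<and> c 0 1 1 = 0"
    using odd by simp
  thus False
    using C by (auto simp: nontrivial_def c_def poly_0_coeff_0)
qed


theorem theorem2p2:
  fixes l1 l2 l3 l4 h0 x0 yj :: real and N1 N2 j :: nat
  assumes "l1 < l2" and "l3 < l4" and "h0 > 0"
    and "l2 = l1 + real N1 * h0" and "l4 = l3 + real N2 * h0"
    and "yj = l3 + real j * h0"
    and "(x0, yj) \<in> {l1} \<times> {l3<..<l4}"
  shows
    "(\<forall>a \<alpha> C.
        smooth_near x0 yj a \<and> positive_near x0 yj a \<and> smooth1_on {l3<..<l4} \<alpha> \<and>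
        (\<forall>k\<in>{0, 1}. \<forall>l\<in>{-1, 0, 1}. degree (C k l) \<le> 6) \<and> nontrivial C \<and>
        (\<forall>n\<in>{0..6}.
           (\<lambda>h. stencil_sum C
                  (\<lambda>x y. GV x0 yj a 5 0 n x y +
                     (\<Sum>i = n..5. real (i choose n) * (deriv ^^ (i - n)) \<alpha> yj * GV x0 yj a 5 1 i x y
                        * (1 - (if n = 6 then 1 else 0)))) h)
           \<in> O[at_right 0](\<lambda>h. h ^ 7))
        \<longrightarrow>
        scheme_of_order x0 yj a \<alpha> C
          (Lam 4) (\<lambda>m n h. stencil_sum C (QV x0 yj a 5 m n) h)
          {0..5} (\<lambda>n h. - stencil_sum C (GV x0 yj a 5 1 n) h)
          6)
     \<and>
     (\<forall>a \<alpha>. smooth_near x0 yj a \<and> positive_near x0 yj a \<and> smooth1_on {l3<..<l4} \<alpha> \<longrightarrow>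
        (\<exists>C I cf J cg. scheme_of_order x0 yj a \<alpha> C I cf J cg 6))
     \<and>
     (\<forall>p. (\<forall>a \<alpha>. smooth_near x0 yj a \<and> positive_near x0 yj a \<and> smooth1_on {l3<..<l4} \<alpha> \<longrightarrow>
             (\<exists>C I cf J cg. scheme_of_order x0 yj a \<alpha> C I cf J cg p))
           \<longrightarrow> p \<le> 6)"
proof -
  have yj: "yj \<in> {l3<..<l4}" using assms by simp
  have a0: "a x0 yj \<noteq> 0" if a_pos: "positive_near x0 yj a" for a
  proof -
    obtain d where d: "d > 0" and pos: "\<forall>(x, y)\<in>half_box x0 yj d. a x y > 0"
      using a_pos unfolding positive_near_def by blast
    have "case (x0, yj) of (x, y) \<Rightarrow> a x y > 0"
      by (rule bspec[OF pos base_in_half_box[OF d]])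
    thus ?thesis by simp
  qed
  have scheme: "scheme_of_order x0 yj a \<alpha> C
      (Lam 4) (\<lambda>m n h. stencil_sum C (QV x0 yj a 5 m n) h)
      {0..5} (\<lambda>n h. - stencil_sum C (GV x0 yj a 5 1 n) h) 6"
    if "smooth_near x0 yj a" "positive_near x0 yj a" "smooth1_on {l3<..<l4} \<alpha>" "nontrivial C"
      "\<And>n. n \<le> 6 \<Longrightarrow> stencil_sum C (robin_basis x0 yj a \<alpha> 5 n) \<in> O[at_right 0](\<lambda>h. h ^ 7)"
    for a \<alpha> C
    using scheme_of_order_from_system[OF that(1) a0[OF that(2)], of 5 "{l3<..<l4}" \<alpha> C] that yj
    by simp
  show ?thesis
  proof (intro conjI allI impI, elim conjE)
    fix a \<alpha> and C :: "nat \<Rightarrow> int \<Rightarrow> real poly"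
    let ?G = "\<lambda>n x y. GV x0 yj a 5 0 n x y +
      (\<Sum>i = n..5. real (i choose n) * (deriv ^^ (i - n)) \<alpha> yj * GV x0 yj a 5 1 i x y
        * (1 - (if n = 6 then 1 else 0)))"
    assume A: "smooth_near x0 yj a" "positive_near x0 yj a" "smooth1_on {l3<..<l4} \<alpha>" "nontrivial C"
    assume sys: "\<forall>n\<in>{0..6}. (\<lambda>h. stencil_sum C (?G n) h) \<in> O[at_right 0](\<lambda>h. h ^ 7)"
    \<comment> \<open>for \<open>n = 6\<close> both sums over \<open>i\<close> are empty\<close>
    have G: "?G n = robin_basis x0 yj a \<alpha> 5 n" for n
      by (cases "n = 6") (simp_all add: robin_basis_def fun_eq_iff)
    have "stencil_sum C (robin_basis x0 yj a \<alpha> 5 n) \<in> O[at_right 0](\<lambda>h. h ^ 7)" if "n \<le> 6" for n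
      using sys that unfolding G by simp
    thus "scheme_of_order x0 yj a \<alpha> C
      (Lam 4) (\<lambda>m n h. stencil_sum C (QV x0 yj a 5 m n) h)
      {0..5} (\<lambda>n h. - stencil_sum C (GV x0 yj a 5 1 n) h) 6"
      by (rule scheme[OF A])
  next
    fix a \<alpha>
    assume A: "smooth_near x0 yj a \<and> positive_near x0 yj a \<and> smooth1_on {l3<..<l4} \<alpha>"
    obtain C where "nontrivial C"
      "\<And>n. n \<le> 6 \<Longrightarrow> stencil_sum C (robin_basis x0 yj a \<alpha> 5 n) \<in> O[at_right 0](\<lambda>h. h ^ 7)"
      using robin_system_solvable[of x0 yj a \<alpha>] a0 A by blast
    thus "\<exists>C I cf J cg. scheme_of_order x0 yj a \<alpha> C I cf J cg 6"
      using scheme A by blast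
  next
    fix p
    assume "\<forall>a \<alpha>. smooth_near x0 yj a \<and> positive_near x0 yj a \<and> smooth1_on {l3<..<l4} \<alpha> \<longrightarrow>
      (\<exists>C I cf J cg. scheme_of_order x0 yj a \<alpha> C I cf J cg p)"
    moreover have "positive_near x0 yj (\<lambda>x y. 1)"
      by (auto simp: positive_near_def intro: exI[of _ 1])
    moreover have "smooth1_on {l3<..<l4} (\<lambda>y. 1)"
      by (simp add: smooth1_on_def funpow_deriv_const)
    ultimately obtain C I cf J cg where "scheme_of_order x0 yj (\<lambda>x y. 1) (\<lambda>y. 1) C I cf J cg p"
      using smooth_near_const by blast
    thus "p \<le> 6" by (rule scheme_order_le_six)
  qed
qed

end
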